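(* Consider an $[[n,1,d]]$ stabilizer code with logical basis states $|0_L\rangle,|1_L\rangle\in(\mathbb{C}^2)^{\otimes n}$, and let $\alpha,\beta\in\mathbb{C}$ with $|\alpha|^2+|\beta|^2=1$. For the state $|\Psi\rangle=\alpha|0\rangle|0_L\rangle+\beta|1\rangle|1_L\rangle$ of an unencoded qubit $T$ together with the $n$ physical qubits, the superdense capacity $C_A$ between the unencoded qubit $T$ and any subset $A\subseteq\{1,\dots,n\}$ of the physical qubits is $$C_A=1+(l_A-1)\,H_T,$$ where $l_A$ is the number of independent logical operator cosets supported on $A$; equivalently, $C_A=1+H_T$ if $l_A=2$, $C_A=1$ if $l_A=1$, and $C_A=1-H_T$ if $l_A=0$.
   Context: $H(\cdot)$ is the von Neumann entropy with base-2 logarithm. The superdense capacity between the qubit $T$ and a subset $A$ of physical qubits is $C_A=H(\frac12\mathbb{1}_T\otimes\rho_A)-H(\rho_{TA})=1+H(\rho_A)-H(\rho_{TA})$, where $\rho_A,\rho_{TA}$ are the reduced states of $|\Psi\rangle\langle\Psi|$ (the first term is the entropy after completely depolarizing $T$). $H_T=H(\rho_T)=-|\alpha|^2\log_2|\alpha|^2-|\beta|^2\log_2|\beta|^2$. An $[[n,1,d]]$ stabilizer code is given by an abelian subgroup $S$ of the $n$-qubit Pauli group, with $-\mathbb{1}\notin S$ and $n-1$ independent generators; the codespace is $\{|\psi\rangle: s|\psi\rangle=|\psi\rangle\ \forall s\in S\}$ (dimension 2), and $d$ is the code distance (its value plays no role here). $C(S)$ denotes the set of Pauli group elements commuting with all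 of $S$. Anticommuting Hermitian logical operators $\bar Z,\bar X\in C(S)\setminus S$ are fixed, and $|0_L\rangle,|1_L\rangle$ are the unit vectors of the codespace (each determined up to phase) with $\bar Z|0_L\rangle=|0_L\rangle$, $\bar Z|1_L\rangle=-|1_L\rangle$. A Pauli operator is supported on $A$ if it acts as the identity (up to an overall phase) on every qubit outside $A$. Modulo phases, $C(S)/S$ is a 2-dimensional $\mathbb{F}_2$-vector space (generated by the cosets of $\bar X$ and $\bar Z$); $l_A\in\{0,1,2\}$ is the $\mathbb{F}_2$-dimension of the subspace of cosets that contain a representative supported on $A$. *)

theory Defs
  imports
    "Jordan_Normal_Form.Schur_Decomposition"
    "HOL-Computational_Algebra.Fundamental_Theorem_Algebra"
    "HOL-Number_Theory.Residues"
    "HOL-Algebra.Generated_Groups"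
    "HOL-Algebra.Coset"
begin

section \<open>Registers of labelled qubits\<close>

text \<open>
  A register is a finite set \<open>Q\<close> of qubit labels. A computational basis state of \<open>Q\<close> is
  a subset \<open>x \<subseteq> Q\<close>, namely the set of qubits that are in the state 1. Vectors and operators
  on \<open>Q\<close> are vectors and matrices of dimension \<open>2 ^ card Q\<close>; the basis states are numbered in
  binary, the smallest label of \<open>Q\<close> being the least significant bit, and \<open>basis_index Q\<close> and
  \<open>basis_label Q\<close> are mutually inverse bijections between \<open>Pow Q\<close> and \<open>{..<2 ^ card Q}\<close>.
\<close>

definition basis_index :: "nat set \<Rightarrow> nat set \<Rightarrow> nat" where
  "basis_index Q x = (\<Sum>q\<in>x. 2 ^ card {r \<in> Q. r < q})"

definition basis_label :: "nat set \<Rightarrow> nat \<Rightarrow> nat set" where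
  "basis_label Q i = {q \<in> Q. bit i (card {r \<in> Q. r < q})}"

definition ket_on :: "nat set \<Rightarrow> (nat set \<Rightarrow> complex) \<Rightarrow> complex vec" where
  "ket_on Q f = vec (2 ^ card Q) (\<lambda>i. f (basis_label Q i))"

definition op_on :: "nat set \<Rightarrow> (nat set \<Rightarrow> nat set \<Rightarrow> complex) \<Rightarrow> complex mat" where
  "op_on Q f = mat (2 ^ card Q) (2 ^ card Q) (\<lambda>(i, j). f (basis_label Q i) (basis_label Q j))"

definition amplitude :: "nat set \<Rightarrow> complex vec \<Rightarrow> nat set \<Rightarrow> complex" where
  "amplitude Q v x = v $ basis_index Q x"

definition entry :: "nat set \<Rightarrow> complex mat \<Rightarrow> nat set \<Rightarrow> nat set \<Rightarrow> complex" where
  "entry Q M x y = M $$ (basis_index Q x, basis_index Q y)"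

text \<open>Tensor products of vectors and of operators on disjoint registers \<open>Q\<close> and \<open>R\<close>.\<close>

definition tensor_ket :: "nat set \<Rightarrow> nat set \<Rightarrow> complex vec \<Rightarrow> complex vec \<Rightarrow> complex vec" where
  "tensor_ket Q R u v = ket_on (Q \<union> R) (\<lambda>x. amplitude Q u (x \<inter> Q) * amplitude R v (x \<inter> R))"

definition tensor_op :: "nat set \<Rightarrow> nat set \<Rightarrow> complex mat \<Rightarrow> complex mat \<Rightarrow> complex mat" where
  "tensor_op Q R M N =
     op_on (Q \<union> R) (\<lambda>x y. entry Q M (x \<inter> Q) (y \<inter> Q) * entry R N (x \<inter> R) (y \<inter> R))"

definition pure_density :: "complex vec \<Rightarrow> complex mat" where
  "pure_density v = mat (dim_vec v) (dim_vec v) (\<lambda>(i, j). v $ i * cnj (v $ j))"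

text \<open>\<open>partial_trace Q B \<rho>\<close> traces out the qubits of \<open>Q - B\<close> and leaves an operator on
  the register \<open>B \<subseteq> Q\<close>.\<close>

definition partial_trace :: "nat set \<Rightarrow> nat set \<Rightarrow> complex mat \<Rightarrow> complex mat" where
  "partial_trace Q B \<rho> = op_on B (\<lambda>x y. \<Sum>z\<in>Pow (Q - B). entry Q \<rho> (x \<union> z) (y \<union> z))"

text \<open>The von Neumann entropy of a density matrix, as the Shannon entropy of its eigenvalues
  counted with multiplicity; eigenvalues 0 contribute 0. The eigenvalues of a density matrix
  are real, so \<open>Re\<close> is only a type conversion.\<close>

definition vn_entropy :: "complex mat \<Rightarrow> real" where
  "vn_entropy \<rho> = - (\<Sum>e\<in>#proots (char_poly \<rho>). Re e * log 2 (Re e))"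


section \<open>The Pauli group\<close>

datatype pauli = PauliI | PauliX | PauliY | PauliZ

fun pauli_entry :: "pauli \<Rightarrow> bool \<Rightarrow> bool \<Rightarrow> complex" where
  "pauli_entry PauliI a b = (if a = b then 1 else 0)"
| "pauli_entry PauliX a b = (if a = b then 0 else 1)"
| "pauli_entry PauliY a b = (if a = b then 0 else if a then \<i> else - \<i>)"
| "pauli_entry PauliZ a b = (if a = b then (if a then - 1 else 1) else 0)"

definition pauli_op :: "nat set \<Rightarrow> (nat \<Rightarrow> pauli) \<Rightarrow> complex mat" where
  "pauli_op Q p = op_on Q (\<lambda>x y. \<Prod>q\<in>Q. pauli_entry (p q) (q \<in> x) (q \<in> y))"

definition pauli_group :: "nat set \<Rightarrow> complex mat monoid" where
  "pauli_group Q =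
     \<lparr>carrier = {\<i> ^ k \<cdot>\<^sub>m pauli_op Q p | k p. True}, monoid.mult = (*), one = 1\<^sub>m (2 ^ card Q)\<rparr>"

definition supported_on :: "nat set \<Rightarrow> nat set \<Rightarrow> complex mat \<Rightarrow> bool" where
  "supported_on Q A P \<longleftrightarrow>
     (\<exists>k p. P = \<i> ^ k \<cdot>\<^sub>m pauli_op Q p \<and> (\<forall>q\<in>Q - A. p q = PauliI))"


section \<open>Stabilizer codes with one logical qubit\<close>

text \<open>The physical qubits of a code are labelled \<open>1, \<dots>, n\<close>.\<close>

definition stabilizer_group :: "nat \<Rightarrow> complex mat set \<Rightarrow> bool" where
  "stabilizer_group n S \<longleftrightarrow>
     subgroup S (pauli_group {1..n}) \<and> (\<forall>s\<in>S. \<forall>t\<in>S. s * t = t * s) \<and> - 1\<^sub>m (2 ^ n) \<notin> S"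

definition independent_generators :: "nat \<Rightarrow> complex mat set \<Rightarrow> complex mat set \<Rightarrow> bool" where
  "independent_generators n S G \<longleftrightarrow>
     finite G \<and> G \<subseteq> S \<and> generate (pauli_group {1..n}) G = S \<and>
     (\<forall>g\<in>G. g \<notin> generate (pauli_group {1..n}) (G - {g}))"

text \<open>\<open>commutant n S\<close> is the set \<open>C(S)\<close>. It contains all phases \<open>\<i> ^ k\<close>, so working modulo
  phases means replacing \<open>S\<close> by \<open>phase_closure S\<close>.\<close>

definition commutant :: "nat \<Rightarrow> complex mat set \<Rightarrow> complex mat set" where
  "commutant n S = {P \<in> carrier (pauli_group {1..n}). \<forall>s\<in>S. P * s = s * P}"

definition phase_closure :: "complex mat set \<Rightarrow> complex mat set" where
  "phase_closure S = {\<i> ^ k \<cdot>\<^sub>m s | k s. s \<in> S}"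

text \<open>The distance is the least number of qubits supporting a nontrivial logical operator.\<close>

definition code_distance :: "nat \<Rightarrow> complex mat set \<Rightarrow> nat" where
  "code_distance n S =
     (LEAST w. \<exists>P \<in> commutant n S - phase_closure S. \<exists>B \<subseteq> {1..n}.
        supported_on {1..n} B P \<and> card B = w)"

text \<open>An \<open>[[n,1,d]]\<close> code. Writing \<open>card G + 1 = n\<close> instead of \<open>card G = n - 1\<close> excludes
  \<open>n = 0\<close>.\<close>

definition stabilizer_code_1 :: "nat \<Rightarrow> nat \<Rightarrow> complex mat set \<Rightarrow> bool" where
  "stabilizer_code_1 n d S \<longleftrightarrow>
     stabilizer_group n S \<and> (\<exists>G. independent_generators n S G \<and> card G + 1 = n) \<and>
     d = code_distance n S"

definition codespace :: "nat \<Rightarrow> complex mat set \<Rightarrow> complex vec set" where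
  "codespace n S = {\<psi> \<in> carrier_vec (2 ^ n). \<forall>s\<in>S. s *\<^sub>v \<psi> = \<psi>}"

definition logical_pair :: "nat \<Rightarrow> complex mat set \<Rightarrow> complex mat \<Rightarrow> complex mat \<Rightarrow> bool" where
  "logical_pair n S Z X \<longleftrightarrow>
     Z \<in> commutant n S - S \<and> X \<in> commutant n S - S \<and>
     mat_adjoint Z = Z \<and> mat_adjoint X = X \<and> Z * X = - (X * Z)"

definition logical_basis ::
    "nat \<Rightarrow> complex mat set \<Rightarrow> complex mat \<Rightarrow> complex vec \<Rightarrow> complex vec \<Rightarrow> bool" where
  "logical_basis n S Z \<psi>\<^sub>0 \<psi>\<^sub>1 \<longleftrightarrow>
     \<psi>\<^sub>0 \<in> codespace n S \<and> \<psi>\<^sub>0 \<bullet>c \<psi>\<^sub>0 = 1 \<and> Z *\<^sub>v \<psi>\<^sub>0 = \<psi>\<^sub>0 \<and>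
     \<psi>\<^sub>1 \<in> codespace n S \<and> \<psi>\<^sub>1 \<bullet>c \<psi>\<^sub>1 = 1 \<and> Z *\<^sub>v \<psi>\<^sub>1 = - \<psi>\<^sub>1"

definition logical_quotient :: "nat \<Rightarrow> complex mat set \<Rightarrow> complex mat set monoid" where
  "logical_quotient n S = (pauli_group {1..n})\<lparr>carrier := commutant n S\<rparr> Mod phase_closure S"

text \<open>The cosets in \<open>C(S)/S\<close> (modulo phases) with a representative supported on \<open>A\<close>, as a
  vector space over the field \<open>residue_ring 2\<close>: vector addition is the product of cosets and
  scalars act as exponents. The ring multiplication and unit of the record are irrelevant.\<close>

definition supported_logicals ::
    "nat \<Rightarrow> complex mat set \<Rightarrow> nat set \<Rightarrow> (int, complex mat set) module" where
  "supported_logicals n S A =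
     \<lparr>carrier = {K \<in> carrier (logical_quotient n S). \<exists>P\<in>K. supported_on {1..n} A P},
      monoid.mult = undefined, one = undefined,
      zero = one (logical_quotient n S),
      add = monoid.mult (logical_quotient n S),
      module.smult = (\<lambda>a K. K [^]\<^bsub>logical_quotient n S\<^esub> a)\<rparr>"

definition logical_dim :: "nat \<Rightarrow> complex mat set \<Rightarrow> nat set \<Rightarrow> nat" where
  "logical_dim n S A = vectorspace.dim (residue_ring 2) (supported_logicals n S A)"


section \<open>The purified state and its superdense capacities\<close>

text \<open>The unencoded qubit \<open>T\<close> has label 0, so that the whole register is \<open>{0..n}\<close>.\<close>

definition encoded_state ::
    "nat \<Rightarrow> complex \<Rightarrow> complex \<Rightarrow> complex vec \<Rightarrow> complex vec \<Rightarrow> complex vec" where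
  "encoded_state n \<alpha> \<beta> \<psi>\<^sub>0 \<psi>\<^sub>1 =
     \<alpha> \<cdot>\<^sub>v tensor_ket {0} {1..n} (unit_vec 2 0) \<psi>\<^sub>0 + \<beta> \<cdot>\<^sub>v tensor_ket {0} {1..n} (unit_vec 2 1) \<psi>\<^sub>1"

definition reduced_state :: "nat \<Rightarrow> complex vec \<Rightarrow> nat set \<Rightarrow> complex mat" where
  "reduced_state n \<Psi> B = partial_trace {0..n} B (pure_density \<Psi>)"

definition superdense_capacity :: "nat \<Rightarrow> complex vec \<Rightarrow> nat set \<Rightarrow> real" where
  "superdense_capacity n \<Psi> A =
     vn_entropy (tensor_op {0} A ((1 / 2) \<cdot>\<^sub>m 1\<^sub>m 2) (reduced_state n \<Psi> A))
     - vn_entropy (reduced_state n \<Psi> (insert 0 A))"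

end

theory Submission
  imports Defs "HOL-Library.Nat_Bijection" "HOL-Library.Function_Algebras"
begin

text \<open>Let \<open>S'\<close> be the group generated by \<open>S\<close> and \<open>Z\<close>. The projections onto the two logical
  basis states are \<open>2\<^sup>-\<^sup>n\<close> times the sums of \<open>s \<plusminus> Z s\<close> over \<open>s \<in> S\<close>. A partial trace keeps exactly the
  Pauli operators supported on the remaining register \<open>B\<close>. Hence \<open>\<rho>\<^sub>B\<close> is proportional to a
  projection if no element of \<open>Z S\<close> is supported on \<open>B\<close> (put \<open>z\<^sub>B = 0\<close>), and otherwise it is a mixture
  of two orthogonal ones with weights \<open>|\<alpha>|\<^sup>2\<close> and \<open>|\<beta>|\<^sup>2\<close> (put \<open>z\<^sub>B = 1\<close>). In both cases its entropy is
  \<open>z\<^sub>B H\<^sub>T - log c\<^sub>B\<close> with \<open>c\<^sub>B = |S'\<^sub>B| / 2\<^sup>|\<^sup>B\<^sup>|\<close>. The state of \<open>T A\<close> has the same nonzero spectrum as that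
  of the complement \<open>A'\<close> of \<open>A\<close> among the physical qubits, so that \<open>C\<^sub>A = 1 + (z\<^sub>A - z\<^sub>A\<^sub>') H\<^sub>T\<close> provided
  that \<open>c\<^sub>A = c\<^sub>A\<^sub>'\<close>. A character sum counts the Pauli labels on \<open>A\<close> that commute with a given group.
  Applied to the self-dual group \<open>S'\<close> it gives \<open>c\<^sub>A = c\<^sub>A\<^sub>'\<close>, and applied to \<open>S\<close> it gives
  \<open>z\<^sub>A - z\<^sub>A\<^sub>' = l\<^sub>A - 1\<close>.\<close>

section \<open>Registers\<close>

text \<open>The entropy counts roots of the characteristic polynomial with multiplicity, and the
  multiplicities are awkward to obtain. Two facts replace a diagonalisation: a cubic identity
  confines the eigenvalues of \<open>M\<close> to 0, \<open>p c\<close> and \<open>q c\<close>, and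
  the traces of \<open>M\<close> and \<open>M * M\<close> fix the rest. The confinement and the
  traces pass from one marginal of a pure state to the other, so the state of \<open>T A\<close> is
  never computed. The constant \<open>c\<close> is a normalisation: tracing out the qubits outside
  \<open>B\<close> turns 2^-n into 2^-|B|, and the sum over a group of m Pauli operators squares to
  m times itself. For the exponents, let C be the group of all labels commuting with
  \<open>S\<close>. The character sums read |C_A| |S| = 4^|A| |S_A'| and |S'_A| 2^n = 4^|A| |S'_A'|.
  With |C_A| = 2^l_A |S_A|, |S'_A| = 2^z_A |S_A| and |S| = 2^(n-1), division gives 2^(z_A + 1) =
  2^(l_A + z_A'). The -1 in l_A - 1 is thus the generator that \<open>S\<close> lacks compared with
  the self-dual S'.\<close>

lemma rank_bij_betw:
  fixes Q :: "nat set"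
  assumes "finite Q"
  shows "bij_betw (\<lambda>q. card {r \<in> Q. r < q}) Q {..<card Q}"
proof -
  have lt: "card {r \<in> Q. r < a} < card {r \<in> Q. r < b}" if "a \<in> Q" "b \<in> Q" "a < b" for a b
    using that assms by (intro psubset_card_mono) auto
  have inj: "inj_on (\<lambda>q. card {r \<in> Q. r < q}) Q"
    by (rule linorder_inj_onI) (use lt in force)+
  have "card {r \<in> Q. r < q} < card Q" if "q \<in> Q" for q
    using that assms by (intro psubset_card_mono) auto
  then have sub: "(\<lambda>q. card {r \<in> Q. r < q}) ` Q \<subseteq> {..<card Q}" by auto
  show ?thesis
    using inj sub card_subset_eq[OF _ sub] card_image[OF inj] by (auto simp: bij_betw_def)
qed

text \<open>The rank of a qubit is its bit position, so the numbering of basis states is the library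
  encoding of finite sets of naturals, whose known inverse recovers the bits.\<close>

lemma basis_index_eq_set_encode:
  assumes "finite Q" "x \<subseteq> Q"
  shows "basis_index Q x = set_encode ((\<lambda>q. card {r \<in> Q. r < q}) ` x)"
proof -
  have "inj_on (\<lambda>q. card {r \<in> Q. r < q}) x"
    using rank_bij_betw[OF assms(1)] assms(2) by (meson bij_betw_def inj_on_subset)
  then show ?thesis
    unfolding basis_index_def set_encode_def by (simp add: sum.reindex)
qed

lemma basis_label_basis_index [simp]:
  assumes "finite Q" "x \<subseteq> Q"
  shows "basis_label Q (basis_index Q x) = x"
proof -
  let ?r = "\<lambda>q. card {r \<in> Q. r < q}"
  have fin: "finite (?r ` x)" using assms by (meson finite_imageI finite_subset)
  have "bit (basis_index Q x) k \<longleftrightarrow> k \<in> ?r ` x" for k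
    using set_encode_inverse[OF fin] basis_index_eq_set_encode[OF assms]
    by (auto simp: set_decode_def bit_iff_odd)
  moreover have "inj_on ?r Q"
    using rank_bij_betw[OF assms(1)] by (simp add: bij_betw_def)
  ultimately show ?thesis
    using assms(2) unfolding basis_label_def by (auto dest: inj_onD)
qed

lemma basis_index_less:
  assumes "finite Q" "x \<subseteq> Q"
  shows "basis_index Q x < 2 ^ card Q"
proof -
  let ?r = "\<lambda>q. card {r \<in> Q. r < q}"
  have "?r ` x \<subseteq> {..<card Q}"
    using rank_bij_betw[OF assms(1)] assms(2) by (auto simp: bij_betw_def)
  then have "(\<Sum>k\<in>?r ` x. 2 ^ k) \<le> (\<Sum>k<card Q. 2 ^ k :: nat)"
    by (intro sum_mono2) auto
  also have "\<dots> < 2 ^ card Q"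
    using sum_power2[of "card Q"] by (simp add: lessThan_atLeast0)
  finally show ?thesis
    by (simp add: basis_index_eq_set_encode[OF assms] set_encode_def)
qed

lemma basis_index_bij_betw:
  assumes "finite Q"
  shows "bij_betw (basis_index Q) (Pow Q) {..<2 ^ card Q}"
proof -
  have inj: "inj_on (basis_index Q) (Pow Q)"
    by (rule inj_on_inverseI[of _ "basis_label Q"]) (use assms in auto)
  have sub: "basis_index Q ` Pow Q \<subseteq> {..<2 ^ card Q}"
    using basis_index_less assms by auto
  have "card (basis_index Q ` Pow Q) = card {..<2 ^ card Q :: nat}"
    using assms by (simp add: card_image[OF inj] card_Pow)
  with inj sub show ?thesis by (simp add: bij_betw_def card_subset_eq)
qed

lemma basis_label_subset [simp]: "basis_label Q i \<subseteq> Q"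
  by (auto simp: basis_label_def)

lemma basis_index_basis_label [simp]:
  assumes "finite Q" "i < 2 ^ card Q"
  shows "basis_index Q (basis_label Q i) = i"
proof -
  obtain x where "x \<subseteq> Q" "i = basis_index Q x"
    using basis_index_bij_betw[OF assms(1)] assms(2)
    by (metis PowD bij_betw_imp_surj_on imageE lessThan_iff)
  then show ?thesis using assms(1) by simp
qed

lemma sum_basis_label:
  assumes "finite Q"
  shows "(\<Sum>i<2 ^ card Q. g (basis_label Q i)) = (\<Sum>x\<in>Pow Q. g x)"
proof -
  have "(\<Sum>x\<in>Pow Q. g x) = (\<Sum>x\<in>Pow Q. g (basis_label Q (basis_index Q x)))"
    using assms by simp
  also have "\<dots> = (\<Sum>i<2 ^ card Q. g (basis_label Q i))"
    by (rule sum.reindex_bij_betw[OF basis_index_bij_betw[OF assms]])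
  finally show ?thesis by simp
qed

section \<open>Traces and operators given by kernels on basis states\<close>

definition mat_trace :: "'a::comm_monoid_add mat \<Rightarrow> 'a" where
  "mat_trace M = (\<Sum>i<dim_row M. M $$ (i, i))"

lemma mat_trace_comm:
  fixes M N :: "'a::comm_semiring_0 mat"
  assumes "M \<in> carrier_mat m k" "N \<in> carrier_mat k m"
  shows "mat_trace (M * N) = mat_trace (N * M)"
proof -
  have "mat_trace (M * N) = (\<Sum>i<m. \<Sum>j<k. M $$ (i, j) * N $$ (j, i))"
    using assms by (simp add: mat_trace_def scalar_prod_def lessThan_atLeast0)
  also have "\<dots> = (\<Sum>j<k. \<Sum>i<m. N $$ (j, i) * M $$ (i, j))"
    by (subst sum.swap) (simp add: mult.commute)
  also have "\<dots> = mat_trace (N * M)"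
    using assms by (simp add: mat_trace_def scalar_prod_def lessThan_atLeast0)
  finally show ?thesis .
qed

lemma mat_trace_smult: "mat_trace (u \<cdot>\<^sub>m M) = (u :: 'a::comm_semiring_0) * mat_trace M" if "M \<in> carrier_mat m m"
  using that by (simp add: mat_trace_def sum_distrib_left)

lemma smult_smult_mat: "u \<cdot>\<^sub>m (v \<cdot>\<^sub>m M) = (u * v :: 'a::semigroup_mult) \<cdot>\<^sub>m M"
  by (intro eq_matI) (auto simp: mult.assoc)

lemma one_smult_mat [simp]: "(1 :: 'a::monoid_mult) \<cdot>\<^sub>m M = M"
  by (intro eq_matI) auto

lemma op_on_carrier [simp, intro]: "op_on Q f \<in> carrier_mat (2 ^ card Q) (2 ^ card Q)"
  by (simp add: op_on_def)

lemma dim_op_on [simp]: "dim_row (op_on Q f) = 2 ^ card Q" "dim_col (op_on Q f) = 2 ^ card Q"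
  by (simp_all add: op_on_def)

lemma entry_op_on [simp]:
  assumes "finite Q" "x \<subseteq> Q" "y \<subseteq> Q"
  shows "entry Q (op_on Q f) x y = f x y"
  using assms by (simp add: entry_def op_on_def basis_index_less)

lemma op_on_entry:
  assumes "finite Q" "M \<in> carrier_mat (2 ^ card Q) (2 ^ card Q)"
  shows "op_on Q (entry Q M) = M"
  using assms by (intro eq_matI) (auto simp: entry_def op_on_def)

lemma op_on_cong:
  assumes "\<And>x y. x \<subseteq> Q \<Longrightarrow> y \<subseteq> Q \<Longrightarrow> f x y = g x y"
  shows "op_on Q f = op_on Q g"
  using assms by (auto simp: op_on_def)

lemma op_on_mult:
  assumes "finite Q"
  shows "op_on Q f * op_on Q g = op_on Q (\<lambda>x y. \<Sum>z\<in>Pow Q. f x z * g z y)"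
  using assms
  by (intro eq_matI)
    (auto simp: op_on_def scalar_prod_def lessThan_atLeast0[symmetric] sum_basis_label[symmetric])

lemma op_on_smult: "c \<cdot>\<^sub>m op_on Q f = op_on Q (\<lambda>x y. c * f x y)"
  by (auto simp: op_on_def)

lemma op_on_add: "op_on Q f + op_on Q g = op_on Q (\<lambda>x y. f x y + g x y)"
  by (auto simp: op_on_def)

lemma op_on_one:
  assumes "finite Q"
  shows "1\<^sub>m (2 ^ card Q) = op_on Q (\<lambda>x y. of_bool (x = y))"
proof (intro eq_matI, goal_cases)
  case (1 i j)
  have "basis_label Q i = basis_label Q j \<longleftrightarrow> i = j"
    using 1 assms by (metis basis_index_basis_label dim_op_on)
  then show ?case using 1 by (simp add: op_on_def)
qed auto

lemma mat_trace_op_on: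
  assumes "finite Q"
  shows "mat_trace (op_on Q f) = (\<Sum>x\<in>Pow Q. f x x)"
  using assms by (simp add: mat_trace_def op_on_def sum_basis_label[symmetric])

lemma ket_on_index:
  assumes "finite Q" "x \<subseteq> Q"
  shows "ket_on Q f $ basis_index Q x = f x"
  using assms by (simp add: ket_on_def basis_index_less)

lemma amplitude_ket_on [simp]:
  assumes "finite Q" "x \<subseteq> Q"
  shows "amplitude Q (ket_on Q f) x = f x"
  using assms by (simp add: amplitude_def ket_on_index)

section \<open>Entropies from traces\<close>

text \<open>By a Schur decomposition \<open>M\<close> is similar to an upper triangular
  \<open>B\<close> with the roots on its diagonal. Similarity preserves traces, and the diagonal of
  \<open>B * B\<close> consists of the squares.\<close>

lemma char_poly_roots_traces:
  fixes M :: "complex mat"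
  assumes M: "M \<in> carrier_mat m m"
  obtains es where "proots (char_poly M) = mset es" "mat_trace M = sum_list es"
    "mat_trace (M * M) = (\<Sum>e\<leftarrow>es. e * e)" "\<And>e. e \<in> set es \<Longrightarrow> eigenvalue M e"
proof -
  obtain es where es: "char_poly M = (\<Prod>e\<leftarrow>es. [:- e, 1:])"
    using char_poly_factorized[OF M] by blast
  obtain B P Q where "schur_decomposition M es = (B, P, Q)"
    by (cases "schur_decomposition M es")
  from schur_decomposition[OF M es this]
  have sim: "similar_mat_wit M B P Q" and ut: "upper_triangular B" and diag: "diag_mat B = es"
    by auto
  note wit = similar_mat_witD2[OF M sim]
  have B: "B \<in> carrier_mat m m" and P: "P \<in> carrier_mat m m" and Q: "Q \<in> carrier_mat m m"
    and QP: "Q * P = 1\<^sub>m m" and MB: "M = P * B * Q"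
    using wit by auto
  have conj_trace: "mat_trace (P * C * Q) = mat_trace C" if C: "C \<in> carrier_mat m m" for C
  proof -
    have "mat_trace (P * C * Q) = mat_trace (Q * (P * C))"
      using P Q C by (intro mat_trace_comm[of _ m m]) auto
    also have "Q * (P * C) = C"
      using P Q C QP by (simp flip: assoc_mult_mat)
    finally show ?thesis .
  qed
  have dg: "es = map (\<lambda>i. B $$ (i, i)) [0..<m]"
    using diag B by (auto simp: diag_mat_def)
  have BB: "(B * B) $$ (i, i) = B $$ (i, i) * B $$ (i, i)" if "i < m" for i
  proof -
    have "(B * B) $$ (i, i) = (\<Sum>j<m. B $$ (i, j) * B $$ (j, i))"
      using B that by (simp add: scalar_prod_def lessThan_atLeast0)
    \<comment> \<open>For \<open>j \<noteq> i\<close> one of the two factors lies below the diagonal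
      of \<open>B\<close>.\<close>
    also have "\<dots> = (\<Sum>j<m. if j = i then B $$ (i, i) * B $$ (i, i) else 0)"
      using upper_triangularD[OF ut] B that
      by (intro sum.cong refl) (auto simp: linorder_neq_iff)
    finally show ?thesis using that by simp
  qed
  have "M * M = P * (B * B) * Q"
  proof -
    have "M * M = P * B * (Q * P) * B * Q"
      unfolding MB using P Q B
      by (simp add: assoc_mult_mat[of _ m m _ m _ m])
    then show ?thesis
      using P Q B by (simp add: QP assoc_mult_mat[of _ m m _ m _ m])
  qed
  then have "mat_trace (M * M) = mat_trace (B * B)"
    using conj_trace[of "B * B"] B by auto
  also have "mat_trace (B * B) = (\<Sum>i<m. B $$ (i, i) * B $$ (i, i))"
    unfolding mat_trace_def using B BB by (intro sum.cong) auto
  also have "\<dots> = (\<Sum>e\<leftarrow>es. e * e)"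
    unfolding dg by (simp add: comp_def sum_list_sum_nth lessThan_atLeast0)
  finally have 2: "mat_trace (M * M) = (\<Sum>e\<leftarrow>es. e * e)" .
  have 1: "mat_trace M = sum_list es"
    using B conj_trace[OF B] by (simp add: MB[symmetric] mat_trace_def dg sum_list_sum_nth lessThan_atLeast0)
  have lin: "(\<Sum>p\<leftarrow>map (\<lambda>e. [:- e, 1:]) xs. proots p) = mset xs" for xs :: "complex list"
    by (induct xs) auto
  have "proots (char_poly M) = mset es"
    unfolding es lin[symmetric]
    by (subst proots_prod_list[of "map (\<lambda>e. [:- e, 1:]) es", unfolded list.map_ident]) auto
  moreover have "eigenvalue M e" if "e \<in> set es" for e
  proof -
    have "poly (char_poly M) e = (\<Prod>r\<leftarrow>es. poly [:- r, 1:] e)"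
      unfolding es by (simp only: poly_prod_list list.map_comp comp_def)
    also have "\<dots> = 0" using that by (auto simp: prod_list_zero_iff)
    finally show ?thesis by (simp add: eigenvalue_root_char_poly[OF M])
  qed
  ultimately show ?thesis using that 1 2 by metis
qed

text \<open>The Shannon entropy of a two-point distribution. The pair (1, 0) gives 0, so a state
  with a single nonzero level fits the same formula.\<close>

definition two_entropy :: "real \<Rightarrow> real \<Rightarrow> real" where
  "two_entropy p q = - p * log 2 p - q * log 2 q"

text \<open>On three points 0, \<open>a\<close>, \<open>b\<close> the entropy function agrees with a polynomial without
  constant term, so two traces determine the entropy without knowing multiplicities.\<close>

lemma vn_entropy_of_traces:
  fixes p q c :: real
  assumes M: "M \<in> carrier_mat m m"
    and pq: "p \<ge> 0" "q \<ge> 0" "p + q = 1" and c: "c > 0"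
    and eig: "\<And>e. eigenvalue M e \<Longrightarrow> e = 0 \<or> e = of_real (p * c) \<or> e = of_real (q * c)"
    and tr: "mat_trace M = 1" and tr2: "mat_trace (M * M) = of_real ((p\<^sup>2 + q\<^sup>2) * c)"
  shows "vn_entropy M = two_entropy p q - log 2 c"
proof -
  obtain es where es: "proots (char_poly M) = mset es" "1 = sum_list es"
    "of_real ((p\<^sup>2 + q\<^sup>2) * c) = (\<Sum>e\<leftarrow>es. e * e)" "\<And>e. e \<in> set es \<Longrightarrow> eigenvalue M e"
    using char_poly_roots_traces[OF M] tr tr2 by metis
  define h where "h = (\<lambda>x. x * log 2 x)"
  have "\<exists>u v. h (p * c) = u * (p * c) + v * (p * c)\<^sup>2 \<and> h (q * c) = u * (q * c) + v * (q * c)\<^sup>2"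
  proof (cases "p = 0 \<or> q = 0 \<or> p = q")
    \<comment> \<open>At most one nonzero point is left here, so the linear term alone interpolates,
      with the logarithm at that point as its coefficient.\<close>
    case True
    then show ?thesis
      using pq c
      by (intro exI[of _ "if p = 0 then log 2 (q * c) else log 2 (p * c)"] exI[of _ 0])
        (auto simp: h_def)
  next
    case False
    define a b where "a = p * c" and "b = q * c"
    have ab: "a \<noteq> 0" "b \<noteq> 0" "a - b \<noteq> 0" using False c by (auto simp: a_def b_def)
    \<comment> \<open>After division by x the interpolation is linear interpolation of the
      logarithm, so \<open>v\<close> is its divided difference between \<open>a\<close> and
      \<open>b\<close>.\<close>
    define v where "v = (log 2 a - log 2 b) / (a - b)"
    have v: "v * (a - b) = log 2 a - log 2 b" using ab by (simp add: v_def)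
    have "h a = (log 2 a - v * a) * a + v * a\<^sup>2"
      by (simp add: h_def algebra_simps power2_eq_square)
    moreover have "h b = (log 2 a - v * a) * b + v * b\<^sup>2"
    proof -
      have "log 2 b = log 2 a - v * a + v * b" using v by (simp add: algebra_simps)
      then show ?thesis unfolding h_def by (subst \<open>log 2 b = _\<close>) (simp add: algebra_simps power2_eq_square)
    qed
    ultimately show ?thesis unfolding a_def b_def by blast
  qed
  then obtain u v where uv: "h (p * c) = u * (p * c) + v * (p * c)\<^sup>2"
    "h (q * c) = u * (q * c) + v * (q * c)\<^sup>2" by blast
  have val: "h (Re e) = u * Re e + v * Re (e * e)" if "e \<in> set es" for e
    using eig[OF es(4)[OF that]] uv by (auto simp: h_def power2_eq_square)
  have "- vn_entropy M = (\<Sum>e\<leftarrow>es. h (Re e))"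
    by (simp add: vn_entropy_def es(1) h_def flip: mset_map sum_mset_sum_list)
  also have "\<dots> = (\<Sum>e\<leftarrow>es. u * Re e + v * Re (e * e))"
    by (intro arg_cong[where f = sum_list] map_cong refl val)
  also have "\<dots> = u * Re (sum_list es) + v * Re (\<Sum>e\<leftarrow>es. e * e)"
    by (induct es) (auto simp: algebra_simps)
  also have "\<dots> = u + v * ((p\<^sup>2 + q\<^sup>2) * c)"
    unfolding es(2,3)[symmetric] Re_complex_of_real by simp
  \<comment> \<open>The traces give the same value as 1 / \<open>c\<close> copies of each of the two
    levels would, without the multiplicities being known.\<close>
  also have "\<dots> = (h (p * c) + h (q * c)) / c"
  proof -
    have "h (p * c) + h (q * c) = u * (p + q) * c + v * ((p\<^sup>2 + q\<^sup>2) * c) * c"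
      unfolding uv by (simp add: algebra_simps power2_eq_square)
    then show ?thesis using c pq(3) by (simp add: field_simps)
  qed
  also have "\<dots> = p * log 2 (p * c) + q * log 2 (q * c)"
    using c by (simp add: h_def field_simps)
  also have "\<dots> = p * log 2 p + q * log 2 q + (p + q) * log 2 c"
  proof -
    \<comment> \<open>A weight may be 0, where the product rule of the logarithm does not
      apply.\<close>
    have "r * log 2 (r * c) = r * log 2 r + r * log 2 c" if "r \<ge> 0" for r
      using that c by (cases "r = 0") (auto simp: log_mult algebra_simps)
    then show ?thesis using pq(1,2) by (simp only: distrib_right)
  qed
  finally show ?thesis using pq(3) by (simp add: two_entropy_def)
qed

text \<open>\<open>P\<close> maps an eigenvector of \<open>Q * P\<close> to one of
  \<open>P * Q\<close>; as \<open>e \<noteq> 0\<close>, the image cannot vanish.\<close>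

lemma eigenvalue_mult_comm:
  fixes P Q :: "complex mat"
  assumes P: "P \<in> carrier_mat m k" and Q: "Q \<in> carrier_mat k m"
    and ev: "eigenvalue (Q * P) e" and e: "e \<noteq> 0"
  shows "eigenvalue (P * Q) e"
proof -
  obtain v where v: "v \<in> carrier_vec k" "v \<noteq> 0\<^sub>v k" "(Q * P) *\<^sub>v v = e \<cdot>\<^sub>v v"
    using ev P Q by (auto simp: eigenvalue_def eigenvector_def)
  have QPv: "Q *\<^sub>v (P *\<^sub>v v) = e \<cdot>\<^sub>v v"
    using v P Q by (simp flip: assoc_mult_mat_vec)
  have Pv: "P *\<^sub>v v \<in> carrier_vec m" using P v by simp
  have "P *\<^sub>v v \<noteq> 0\<^sub>v m"
  proof
    assume "P *\<^sub>v v = 0\<^sub>v m"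
    then have "e \<cdot>\<^sub>v v = 0\<^sub>v k" using QPv Q by (auto simp flip: QPv)
    moreover obtain i where "i < k" "v $ i \<noteq> 0" using v(1,2) by (auto simp: vec_eq_iff)
    ultimately show False using e v(1) by (auto dest!: arg_cong[where f = "\<lambda>w. w $ i"])
  qed
  moreover have "(P * Q) *\<^sub>v (P *\<^sub>v v) = e \<cdot>\<^sub>v (P *\<^sub>v v)"
    using P Q Pv QPv v(1) by (simp add: mult_mat_vec)
  ultimately show ?thesis
    using P Pv by (auto simp: eigenvalue_def eigenvector_def)
qed

lemma smult_mat_mult_vec:
  fixes M :: "'a::comm_semiring_0 mat"
  assumes "M \<in> carrier_mat m k" "v \<in> carrier_vec k"
  shows "(u \<cdot>\<^sub>m M) *\<^sub>v v = u \<cdot>\<^sub>v (M *\<^sub>v v)"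
proof (rule eq_vecI)
  fix i assume "i < dim_vec (u \<cdot>\<^sub>v (M *\<^sub>v v))"
  then show "((u \<cdot>\<^sub>m M) *\<^sub>v v) $ i = (u \<cdot>\<^sub>v (M *\<^sub>v v)) $ i"
    using assms by (simp add: scalar_prod_def sum_distrib_left mult.assoc)
qed (use assms in simp)

text \<open>The nonzero eigenvalues of \<open>M\<close> are \<open>p c\<close> and \<open>q c\<close>, each with multiplicity \<open>1 / c\<close>
  (\<open>q = 0\<close> is allowed); this is phrased without diagonalising \<open>M\<close>.\<close>

definition two_level :: "complex mat \<Rightarrow> nat \<Rightarrow> real \<Rightarrow> real \<Rightarrow> real \<Rightarrow> bool" where
  "two_level M m p q c \<longleftrightarrow> M \<in> carrier_mat m m \<and>
     M * M * M + complex_of_real (p * q * c\<^sup>2) \<cdot>\<^sub>m M = complex_of_real c \<cdot>\<^sub>m (M * M) \<and>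
     mat_trace M = 1 \<and> mat_trace (M * M) = of_real ((p\<^sup>2 + q\<^sup>2) * c) \<and>
     p \<ge> 0 \<and> q \<ge> 0 \<and> p + q = 1 \<and> c > 0"

text \<open>Since \<open>p + q = 1\<close>, the cubic identity says M (M - p c) (M - q c) = 0, and
  every eigenvalue is a root of the corresponding polynomial.\<close>

lemma two_level_eigenvalue:
  assumes "two_level M m p q c" "eigenvalue M e"
  shows "e = 0 \<or> e = of_real (p * c) \<or> e = of_real (q * c)"
proof -
  note a = assms(1)[unfolded two_level_def]
  have M: "M \<in> carrier_mat m m" using a by blast
  obtain v where v: "v \<in> carrier_vec m" "v \<noteq> 0\<^sub>v m" "M *\<^sub>v v = e \<cdot>\<^sub>v v"
    using assms(2) M by (auto simp: eigenvalue_def eigenvector_def)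
  obtain i where i: "i < m" "v $ i \<noteq> 0" using v(1,2) by (auto simp: vec_eq_iff)
  have 2: "(M * M) *\<^sub>v v = (e * e) \<cdot>\<^sub>v v"
    using M v by (simp add: mult_mat_vec smult_smult_assoc)
  have 3: "(M * M * M) *\<^sub>v v = (e * (e * e)) \<cdot>\<^sub>v v"
  proof -
    have "(M * M * M) *\<^sub>v v = (M * M) *\<^sub>v (M *\<^sub>v v)"
      using M v(1) by (intro assoc_mult_mat_vec) auto
    also have "\<dots> = e \<cdot>\<^sub>v ((M * M) *\<^sub>v v)"
      unfolding v(3) using M v(1) by (intro mult_mat_vec) auto
    finally show ?thesis by (simp add: 2 smult_smult_assoc)
  qed
  have "(M * M * M + complex_of_real (p * q * c\<^sup>2) \<cdot>\<^sub>m M) *\<^sub>v v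
      = (e * (e * e)) \<cdot>\<^sub>v v + complex_of_real (p * q * c\<^sup>2) \<cdot>\<^sub>v (e \<cdot>\<^sub>v v)"
    using M v 3 by (subst add_mult_distrib_mat_vec[of _ m m]) (auto simp: smult_mat_mult_vec[of _ m m])
  moreover have "(complex_of_real c \<cdot>\<^sub>m (M * M)) *\<^sub>v v = complex_of_real c \<cdot>\<^sub>v ((e * e) \<cdot>\<^sub>v v)"
    using M v 2 by (subst smult_mat_mult_vec[of _ m m]) auto
  ultimately have "(e * (e * e)) \<cdot>\<^sub>v v + complex_of_real (p * q * c\<^sup>2) \<cdot>\<^sub>v (e \<cdot>\<^sub>v v)
      = complex_of_real c \<cdot>\<^sub>v ((e * e) \<cdot>\<^sub>v v)"
    using a by simp
  from arg_cong[OF this, where f = "\<lambda>w. w $ i"]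
  have "(e * (e * e) + of_real (p * q * c\<^sup>2) * e) * v $ i = (of_real c * (e * e)) * v $ i"
    using i(1) v(1) by (simp add: distrib_right mult.assoc)
  then have "e * (e * e) + of_real (p * q * c\<^sup>2) * e = of_real c * (e * e)"
    using i(2) mult_right_cancel by blast
  \<comment> \<open>The second summand corrects the coefficient of e^2 from (p + q) c to c; it
    vanishes because \<open>p + q = 1\<close>.\<close>
  then have "e * ((e - of_real (p * c)) * (e - of_real (q * c))) + e * e * of_real c * (of_real (p + q) - 1) = 0"
    by (simp add: algebra_simps power2_eq_square)
  then show ?thesis using a by simp
qed

lemma vn_entropy_two_level:
  assumes "two_level M m p q c"
  shows "vn_entropy M = two_entropy p q - log 2 c"
  using assms two_level_eigenvalue[OF assms]
  by (intro vn_entropy_of_traces[of M m]) (auto simp: two_level_def)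

text \<open>The nonzero eigenvalues and, by cyclicity, both traces are shared by the two products.
  The sizes may differ, which affects only the number of zero eigenvalues, and these contribute
  nothing.\<close>

lemma vn_entropy_two_level_comm:
  assumes P: "P \<in> carrier_mat m k" and Q: "Q \<in> carrier_mat k m"
    and tl: "two_level (P * Q) m p q c"
  shows "vn_entropy (Q * P) = two_entropy p q - log 2 c"
proof (rule vn_entropy_of_traces)
  show QP: "Q * P \<in> carrier_mat k k" using P Q by simp
  show "e = 0 \<or> e = of_real (p * c) \<or> e = of_real (q * c)" if "eigenvalue (Q * P) e" for e
    using eigenvalue_mult_comm[OF P Q that] two_level_eigenvalue[OF tl] by blast
  show "mat_trace (Q * P) = 1"
    using tl mat_trace_comm[OF P Q] by (simp add: two_level_def)
  have "mat_trace (Q * P * (Q * P)) = mat_trace (Q * (P * (Q * P)))"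
    using P Q by (simp add: assoc_mult_mat[of _ k m _ k _ k])
  also have "\<dots> = mat_trace (P * (Q * P) * Q)"
    using P Q by (intro mat_trace_comm[of _ k m]) auto
  also have "P * (Q * P) * Q = P * Q * (P * Q)"
    using assoc_mult_mat[OF P Q P] assoc_mult_mat[of "P * Q" m m P k Q m] P Q by simp
  finally show "mat_trace (Q * P * (Q * P)) = of_real ((p\<^sup>2 + q\<^sup>2) * c)"
    using tl by (simp add: two_level_def)
qed (use tl in \<open>auto simp: two_level_def\<close>)

section \<open>Adjoining a maximally mixed qubit\<close>

lemma sum_Pow_insert:
  assumes "finite R" "a \<notin> R"
  shows "(\<Sum>z\<in>Pow (insert a R). f z) = (\<Sum>z\<in>Pow R. f z + f (insert a z))"
proof -
  have inj: "inj_on (insert a) (Pow R)"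
    using assms(2) by (intro inj_onI) (metis Diff_insert_absorb PowD in_mono insert_absorb insert_ident)
  have "(\<Sum>z\<in>Pow (insert a R). f z) = (\<Sum>z\<in>Pow R. f z) + (\<Sum>z\<in>insert a ` Pow R. f z)"
    unfolding Pow_insert using assms by (intro sum.union_disjoint) auto
  then show ?thesis
    by (simp add: sum.reindex[OF inj] sum.distrib)
qed

text \<open>\<open>M\<close> on \<open>R\<close> tensored with the identity on the qubit
  \<open>a\<close>. Leaving out the normalising factor 1/2 makes the map multiplicative.\<close>

definition idle_op :: "nat \<Rightarrow> nat set \<Rightarrow> complex mat \<Rightarrow> complex mat" where
  "idle_op a R M =
     op_on (insert a R) (\<lambda>x y. of_bool (a \<in> x \<longleftrightarrow> a \<in> y) * entry R M (x - {a}) (y - {a}))"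

context
  fixes a :: nat and R :: "nat set"
  assumes R: "finite R" "a \<notin> R"
begin

lemma idle_op_mult:
  assumes "M \<in> carrier_mat (2 ^ card R) (2 ^ card R)" "N \<in> carrier_mat (2 ^ card R) (2 ^ card R)"
  shows "idle_op a R M * idle_op a R N = idle_op a R (M * N)"
proof -
  have MN: "M * N = op_on R (\<lambda>x y. \<Sum>z\<in>Pow R. entry R M x z * entry R N z y)"
    using op_on_mult[OF R(1), of "entry R M" "entry R N"] op_on_entry[OF R(1)] assms by simp
  have "(\<Sum>z\<in>Pow (insert a R). of_bool (a \<in> x \<longleftrightarrow> a \<in> z) * entry R M (x - {a}) (z - {a}) *
      (of_bool (a \<in> z \<longleftrightarrow> a \<in> y) * entry R N (z - {a}) (y - {a})))
    = of_bool (a \<in> x \<longleftrightarrow> a \<in> y) * (\<Sum>z\<in>Pow R. entry R M (x - {a}) z * entry R N z (y - {a}))"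
    (is "?l = ?r") for x y
  proof -
    have "?l = (\<Sum>z\<in>Pow R. of_bool (a \<in> x \<longleftrightarrow> a \<in> y) * (entry R M (x - {a}) z * entry R N z (y - {a})))"
      unfolding sum_Pow_insert[OF R]
    proof (intro sum.cong refl)
      fix z assume "z \<in> Pow R"
      then have "a \<notin> z" "z - {a} = z" "insert a z - {a} = z" using R by auto
      then show "of_bool (a \<in> x \<longleftrightarrow> a \<in> z) * entry R M (x - {a}) (z - {a}) *
          (of_bool (a \<in> z \<longleftrightarrow> a \<in> y) * entry R N (z - {a}) (y - {a})) +
          of_bool (a \<in> x \<longleftrightarrow> a \<in> insert a z) * entry R M (x - {a}) (insert a z - {a}) *
          (of_bool (a \<in> insert a z \<longleftrightarrow> a \<in> y) * entry R N (insert a z - {a}) (y - {a}))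
          = of_bool (a \<in> x \<longleftrightarrow> a \<in> y) * (entry R M (x - {a}) z * entry R N z (y - {a}))"
        by (cases "a \<in> x"; cases "a \<in> y") simp_all
    qed
    then show ?thesis by (simp add: sum_distrib_left)
  qed
  moreover have "x - {a} \<subseteq> R" if "x \<subseteq> insert a R" for x using that by auto
  ultimately show ?thesis
    unfolding idle_op_def using R by (simp add: op_on_mult MN) (intro op_on_cong, simp)
qed

lemma mat_trace_idle_op:
  assumes "M \<in> carrier_mat (2 ^ card R) (2 ^ card R)"
  shows "mat_trace (idle_op a R M) = 2 * mat_trace M"
proof -
  have "z - {a} = z" if "z \<subseteq> R" for z using that R by auto
  then have "mat_trace (idle_op a R M) = (\<Sum>z\<in>Pow R. entry R M z z + entry R M z z)"
    unfolding idle_op_def using R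
    by (subst mat_trace_op_on) (auto simp: sum_Pow_insert intro!: sum.cong)
  also have "\<dots> = 2 * (\<Sum>z\<in>Pow R. entry R M z z)" by (simp add: sum_distrib_left)
  also have "(\<Sum>z\<in>Pow R. entry R M z z) = mat_trace M"
    using mat_trace_op_on[OF R(1), of "entry R M"] op_on_entry[OF R(1) assms] by simp
  finally show ?thesis .
qed

lemma idle_op_carrier [simp]: "idle_op a R M \<in> carrier_mat (2 ^ card (insert a R)) (2 ^ card (insert a R))"
  by (simp only: idle_op_def op_on_carrier)

lemma idle_op_add_smult:
  assumes "M \<in> carrier_mat (2 ^ card R) (2 ^ card R)" "N \<in> carrier_mat (2 ^ card R) (2 ^ card R)"
  shows "idle_op a R (M + u \<cdot>\<^sub>m N) = idle_op a R M + u \<cdot>\<^sub>m idle_op a R N"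
proof -
  have "entry R (M + u \<cdot>\<^sub>m N) (x - {a}) (y - {a})
      = entry R M (x - {a}) (y - {a}) + u * entry R N (x - {a}) (y - {a})"
    if "x \<subseteq> insert a R" "y \<subseteq> insert a R" for x y
  proof -
    have "x - {a} \<subseteq> R" "y - {a} \<subseteq> R" using that by auto
    then show ?thesis using assms R by (simp add: entry_def basis_index_less)
  qed
  then show ?thesis
    unfolding idle_op_def op_on_smult op_on_add by (intro op_on_cong) (simp add: algebra_simps)
qed

lemma idle_op_smult:
  assumes "M \<in> carrier_mat (2 ^ card R) (2 ^ card R)"
  shows "idle_op a R (u \<cdot>\<^sub>m M) = u \<cdot>\<^sub>m idle_op a R M"
proof -
  have "entry R (u \<cdot>\<^sub>m M) (x - {a}) (y - {a}) = u * entry R M (x - {a}) (y - {a})"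
    if "x \<subseteq> insert a R" "y \<subseteq> insert a R" for x y
  proof -
    have "x - {a} \<subseteq> R" "y - {a} \<subseteq> R" using that by auto
    then show ?thesis using assms R by (simp add: entry_def basis_index_less)
  qed
  then show ?thesis
    unfolding idle_op_def op_on_smult by (intro op_on_cong) simp
qed

lemma tensor_op_maximally_mixed:
  "tensor_op {a} R ((1 / 2) \<cdot>\<^sub>m 1\<^sub>m 2) M = (1 / 2) \<cdot>\<^sub>m idle_op a R M"
proof -
  have "(1 / 2) \<cdot>\<^sub>m 1\<^sub>m 2 = op_on {a} (\<lambda>x y. 1 / 2 * of_bool (x = y))"
    using op_on_one[of "{a}"] by (simp add: op_on_smult)
  then have half: "entry {a} ((1 / 2) \<cdot>\<^sub>m 1\<^sub>m 2) (x \<inter> {a}) (y \<inter> {a}) = 1 / 2 * of_bool (a \<in> x \<longleftrightarrow> a \<in> y)"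
    for x y by (cases "a \<in> x"; cases "a \<in> y") simp_all
  have "x \<inter> R = x - {a}" if "x \<subseteq> insert a R" for x using that R by auto
  then show ?thesis
    unfolding tensor_op_def idle_op_def op_on_smult half insert_is_Un[symmetric]
    by (intro op_on_cong) simp
qed

text \<open>A maximally mixed qubit halves every eigenvalue and doubles its multiplicity, hence
  \<open>c / 2\<close>. This halving is the origin of the summand 1 in the capacity.\<close>

lemma two_level_idle:
  assumes tl: "two_level M (2 ^ card R) p q c"
  shows "two_level ((1 / 2) \<cdot>\<^sub>m idle_op a R M) (2 ^ card (insert a R)) p q (c / 2)"
proof -
  define I where "I = idle_op a R"
  define m where "m = (2 :: nat) ^ card (insert a R)"
  have M: "M \<in> carrier_mat (2 ^ card R) (2 ^ card R)" using tl by (simp add: two_level_def)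
  have I: "I N \<in> carrier_mat m m" for N unfolding I_def m_def by simp
  have I2: "I M * I M = I (M * M)" and I3: "I M * I M * I M = I (M * M * M)"
    using M by (simp_all add: I_def idle_op_mult)
  have cubic: "I (M * M * M) + complex_of_real (p * q * c\<^sup>2) \<cdot>\<^sub>m I M = complex_of_real c \<cdot>\<^sub>m I (M * M)"
    using tl M unfolding I_def two_level_def
    by (subst idle_op_add_smult[symmetric], simp, simp, subst idle_op_smult[symmetric]) auto
  have sm: "((1 / 2) \<cdot>\<^sub>m K) * ((1 / 2) \<cdot>\<^sub>m N) = (1 / 4 :: complex) \<cdot>\<^sub>m (K * N)"
    if "K \<in> carrier_mat m m" "N \<in> carrier_mat m m" for K N :: "complex mat"
    using that by (auto simp: mult_smult_assoc_mat[of _ m m _ m] mult_smult_distrib[of _ m m _ m])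
  have sm': "((1 / 4) \<cdot>\<^sub>m K) * ((1 / 2) \<cdot>\<^sub>m N) = (1 / 8 :: complex) \<cdot>\<^sub>m (K * N)"
    if "K \<in> carrier_mat m m" "N \<in> carrier_mat m m" for K N :: "complex mat"
    using that by (auto simp: mult_smult_assoc_mat[of _ m m _ m] mult_smult_distrib[of _ m m _ m])
  let ?N = "(1 / 2 :: complex) \<cdot>\<^sub>m I M"
  have N2: "?N * ?N = (1 / 4) \<cdot>\<^sub>m I (M * M)" using sm[OF I I] I2 by simp
  have N3: "?N * ?N * ?N = (1 / 8) \<cdot>\<^sub>m I (M * M * M)"
    unfolding N2 using sm'[OF I I] I2 I3 by metis
  have "?N * ?N * ?N + complex_of_real (p * q * (c / 2)\<^sup>2) \<cdot>\<^sub>m ?N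
      = (1 / 8) \<cdot>\<^sub>m (I (M * M * M) + complex_of_real (p * q * c\<^sup>2) \<cdot>\<^sub>m I M)"
    unfolding N3 using I[of M] I[of "M * M * M"]
    by (intro eq_matI) (auto simp: power2_eq_square algebra_simps)
  also have "\<dots> = complex_of_real (c / 2) \<cdot>\<^sub>m (?N * ?N)"
    unfolding N2 cubic by (intro eq_matI) auto
  finally have "?N * ?N * ?N + complex_of_real (p * q * (c / 2)\<^sup>2) \<cdot>\<^sub>m ?N = complex_of_real (c / 2) \<cdot>\<^sub>m (?N * ?N)" .
  moreover have "mat_trace (I M) = 2 * mat_trace M" "mat_trace (I (M * M)) = 2 * mat_trace (M * M)"
    using M unfolding I_def by (auto intro!: mat_trace_idle_op)
  ultimately show ?thesis
    using tl I[of M] I[of "M * M"] unfolding two_level_def I_def[symmetric] m_def[symmetric]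
    by (simp add: N2 mat_trace_smult[OF I])
qed

end

section \<open>Pauli labels\<close>

text \<open>The additive group structure is multiplication modulo phases.\<close>

instantiation pauli :: ab_group_add
begin

fun plus_pauli :: "pauli \<Rightarrow> pauli \<Rightarrow> pauli" where
  "PauliI + b = b"
| "a + PauliI = a"
| "PauliX + PauliX = PauliI" | "PauliX + PauliY = PauliZ" | "PauliX + PauliZ = PauliY"
| "PauliY + PauliX = PauliZ" | "PauliY + PauliY = PauliI" | "PauliY + PauliZ = PauliX"
| "PauliZ + PauliX = PauliY" | "PauliZ + PauliY = PauliX" | "PauliZ + PauliZ = PauliI"

definition zero_pauli :: pauli where "0 = PauliI"
definition uminus_pauli :: "pauli \<Rightarrow> pauli" where "- a = (a :: pauli)"
definition minus_pauli :: "pauli \<Rightarrow> pauli \<Rightarrow> pauli" where "a - b = a + (b :: pauli)"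

instance
proof
  fix a b c :: pauli
  show "a + b + c = a + (b + c)" by (cases a; cases b; cases c) simp_all
  show "a + b = b + a" by (cases a; cases b) simp_all
  show "0 + a = a" by (simp add: zero_pauli_def)
  show "- a + a = 0" by (cases a) (simp_all add: zero_pauli_def uminus_pauli_def)
  show "a - b = a + - b" by (simp add: minus_pauli_def uminus_pauli_def)
qed

end

lemma pauli_UNIV: "(UNIV :: pauli set) = {PauliI, PauliX, PauliY, PauliZ}"
  using pauli.exhaust by auto

instance pauli :: finite
  by standard (simp add: pauli_UNIV)

lemma pauli_add_self [simp]: "a + a = (0 :: pauli)"
  by (cases a) (simp_all add: zero_pauli_def)

lemma pauli_fun_add_self [simp]: "p + p = (0 :: 'a \<Rightarrow> pauli)"
  by (simp add: fun_eq_iff)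

lemma pauli_fun_add_cancel [simp]: "p + (p + r) = (r :: 'a \<Rightarrow> pauli)"
  by (simp flip: add.assoc)

text \<open>The scalar by which the matrix product of two Pauli matrices differs from the matrix of
  the sum of their labels, as in X Y = i Z.\<close>

fun pauli_phase :: "pauli \<Rightarrow> pauli \<Rightarrow> complex" where
  "pauli_phase PauliX PauliY = \<i>" | "pauli_phase PauliY PauliX = - \<i>"
| "pauli_phase PauliY PauliZ = \<i>" | "pauli_phase PauliZ PauliY = - \<i>"
| "pauli_phase PauliZ PauliX = \<i>" | "pauli_phase PauliX PauliZ = - \<i>"
| "pauli_phase a b = 1"

text \<open>The commutation sign: 1 for commuting and -1 for anticommuting Pauli matrices. It is a
  bicharacter of the label group, which is what the counting rests on.\<close>

definition pauli_sign :: "pauli \<Rightarrow> pauli \<Rightarrow> complex" where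
  "pauli_sign a b = (if a = 0 \<or> b = 0 \<or> a = b then 1 else - 1)"

lemma pauli_entry_mult:
  "pauli_entry a i False * pauli_entry b False j + pauli_entry a i True * pauli_entry b True j
    = pauli_phase a b * pauli_entry (a + b) i j"
  by (cases a; cases b; cases i; cases j) (simp_all add: zero_pauli_def)

lemma pauli_phase_commute: "pauli_phase a b = pauli_sign a b * pauli_phase b a"
  by (cases a; cases b) (simp_all add: pauli_sign_def zero_pauli_def)

lemma pauli_phase_self [simp]: "pauli_phase a a = 1" by (cases a) simp_all

lemma pauli_phase_0 [simp]: "pauli_phase 0 a = 1" "pauli_phase a 0 = 1"
  by (cases a; simp add: zero_pauli_def)+

lemma pauli_sign_add: "pauli_sign (a + b) c = pauli_sign a c * pauli_sign b c"
  by (cases a; cases b; cases c) (simp_all add: pauli_sign_def zero_pauli_def)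

lemma pauli_sign_commute: "pauli_sign a b = pauli_sign b a"
  by (auto simp: pauli_sign_def)

text \<open>A nonzero label commutes with 0 and with itself and anticommutes with the other two, so
  the signs cancel.\<close>

lemma sum_pauli_sign: "(\<Sum>a\<in>UNIV. pauli_sign a b) = (if b = 0 then 4 else 0)"
  by (cases b) (simp_all add: pauli_UNIV pauli_sign_def zero_pauli_def)

lemma cnj_pauli_entry: "cnj (pauli_entry a i j) = pauli_entry a j i"
  by (cases a; cases i; cases j) simp_all

lemma pauli_entry_trace: "pauli_entry a False False + pauli_entry a True True = (if a = 0 then 2 else 0)"
  by (cases a) (simp_all add: zero_pauli_def)

lemma pauli_entry_0: "pauli_entry 0 i j = of_bool (i = j)"
  by (simp add: zero_pauli_def)

section \<open>Pauli operators on a register, computed qubit by qubit\<close>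

lemma sum_Pow_prod:
  assumes "finite Q"
  shows "(\<Sum>z\<in>Pow Q. \<Prod>q\<in>Q. F q (q \<in> z)) = (\<Prod>q\<in>Q. F q False + F q True :: 'b::comm_semiring_1)"
  using assms
proof (induction Q)
  case (insert a Q)
  have "(\<Sum>z\<in>Pow (insert a Q). \<Prod>q\<in>insert a Q. F q (q \<in> z))
      = (\<Sum>z\<in>Pow Q. (F a False + F a True) * (\<Prod>q\<in>Q. F q (q \<in> z)))"
    unfolding sum_Pow_insert[OF insert.hyps]
  proof (intro sum.cong refl)
    fix z assume "z \<in> Pow Q"
    then have "a \<notin> z" "(\<Prod>q\<in>Q. F q (q \<in> insert a z)) = (\<Prod>q\<in>Q. F q (q \<in> z))"
      using insert.hyps by (auto intro!: prod.cong arg_cong[where f = "F _"])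
    then show "(\<Prod>q\<in>insert a Q. F q (q \<in> z)) + (\<Prod>q\<in>insert a Q. F q (q \<in> insert a z))
        = (F a False + F a True) * (\<Prod>q\<in>Q. F q (q \<in> z))"
      using insert.hyps by (simp add: distrib_right)
  qed
  then show ?case using insert by (simp flip: sum_distrib_left)
qed simp

text \<open>Kept as a function of basis states instead of a matrix, so that one label can be read on
  a register and on any part of it.\<close>

definition pauli_kernel :: "nat set \<Rightarrow> (nat \<Rightarrow> pauli) \<Rightarrow> nat set \<Rightarrow> nat set \<Rightarrow> complex" where
  "pauli_kernel Q p x y = (\<Prod>q\<in>Q. pauli_entry (p q) (q \<in> x) (q \<in> y))"

definition label_phase :: "nat set \<Rightarrow> (nat \<Rightarrow> pauli) \<Rightarrow> (nat \<Rightarrow> pauli) \<Rightarrow> complex" where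
  "label_phase Q p r = (\<Prod>q\<in>Q. pauli_phase (p q) (r q))"

definition label_sign :: "nat set \<Rightarrow> (nat \<Rightarrow> pauli) \<Rightarrow> (nat \<Rightarrow> pauli) \<Rightarrow> complex" where
  "label_sign Q p r = (\<Prod>q\<in>Q. pauli_sign (p q) (r q))"

lemma pauli_op_kernel: "pauli_op Q p = op_on Q (pauli_kernel Q p)"
  unfolding pauli_op_def pauli_kernel_def ..

lemma pauli_op_carrier [simp]: "pauli_op Q p \<in> carrier_mat (2 ^ card Q) (2 ^ card Q)"
  by (simp add: pauli_op_def)

lemma dim_pauli_op [simp]: "dim_row (pauli_op Q p) = 2 ^ card Q" "dim_col (pauli_op Q p) = 2 ^ card Q"
  by (simp_all add: pauli_op_def)

lemma pauli_kernel_mult: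
  assumes "finite Q"
  shows "(\<Sum>z\<in>Pow Q. pauli_kernel Q p x z * pauli_kernel Q r z y)
    = label_phase Q p r * pauli_kernel Q (p + r) x y"
proof -
  have "(\<Sum>z\<in>Pow Q. pauli_kernel Q p x z * pauli_kernel Q r z y)
      = (\<Sum>z\<in>Pow Q. \<Prod>q\<in>Q. pauli_entry (p q) (q \<in> x) (q \<in> z) * pauli_entry (r q) (q \<in> z) (q \<in> y))"
    by (simp add: pauli_kernel_def prod.distrib)
  also have "\<dots> = (\<Prod>q\<in>Q. pauli_phase (p q) (r q) * pauli_entry ((p + r) q) (q \<in> x) (q \<in> y))"
    by (subst sum_Pow_prod[OF assms]) (simp add: pauli_entry_mult)
  finally show ?thesis by (simp add: label_phase_def pauli_kernel_def prod.distrib)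
qed

lemma pauli_op_mult:
  assumes "finite Q"
  shows "pauli_op Q p * pauli_op Q r = label_phase Q p r \<cdot>\<^sub>m pauli_op Q (p + r)"
  unfolding pauli_op_kernel op_on_mult[OF assms] op_on_smult
  by (intro op_on_cong pauli_kernel_mult assms)

lemma pauli_kernel_0:
  assumes "x \<subseteq> Q" "y \<subseteq> Q" "finite Q"
  shows "pauli_kernel Q 0 x y = of_bool (x = y)"
proof (cases "x = y")
  case False
  then obtain q where "q \<in> Q" "(q \<in> x) \<noteq> (q \<in> y)" using assms by blast
  then show ?thesis
    using False assms(3) by (auto simp: pauli_kernel_def pauli_entry_0 intro!: prod_zero bexI[of _ q])
qed (simp add: pauli_kernel_def pauli_entry_0)

lemma pauli_op_0:
  assumes "finite Q"
  shows "pauli_op Q 0 = 1\<^sub>m (2 ^ card Q)"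
  unfolding op_on_one[OF assms] pauli_op_kernel by (intro op_on_cong) (simp add: pauli_kernel_0 assms)

lemma label_phase_commute: "label_phase Q p r = label_sign Q p r * label_phase Q r p"
  unfolding label_phase_def label_sign_def prod.distrib[symmetric]
  by (intro prod.cong refl pauli_phase_commute)

lemma label_phase_self [simp]: "label_phase Q p p = 1"
  by (simp add: label_phase_def)

lemma label_phase_nonzero [simp]: "label_phase Q p r \<noteq> 0"
proof -
  have "pauli_phase a b \<noteq> 0" for a b by (cases a; cases b) simp_all
  then show ?thesis by (cases "finite Q") (auto simp: label_phase_def)
qed

lemma label_phase_power: "\<exists>k. label_phase Q p r = \<i> ^ k"
proof -
  have 1: "\<exists>k. pauli_phase a b = \<i> ^ k" for a b
    by (cases a; cases b) (auto intro: exI[of _ 0] exI[of _ 1] exI[of _ 3] simp: power3_eq_cube)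
  have "\<exists>k. (\<Prod>q\<in>Q. pauli_phase (p q) (r q)) = \<i> ^ k"
  proof (induction Q rule: infinite_finite_induct)
    case (insert a Q)
    then show ?case using 1[of "p a" "r a"] by (auto simp flip: power_add)
  qed (auto intro: exI[of _ 0])
  then show ?thesis by (simp add: label_phase_def)
qed

lemma label_sign_add: "label_sign Q (p + r) s = label_sign Q p s * label_sign Q r s"
  by (simp add: label_sign_def pauli_sign_add prod.distrib)

lemma label_sign_commute: "label_sign Q p r = label_sign Q r p"
  by (simp add: label_sign_def pauli_sign_commute)

lemma label_sign_cases: "label_sign Q p r = 1 \<or> label_sign Q p r = - 1"
  by (induction Q rule: infinite_finite_induct) (auto simp: label_sign_def pauli_sign_def)

lemma label_sign_self [simp]: "label_sign Q p p = 1"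
  by (simp add: label_sign_def pauli_sign_def)

lemma label_sign_0 [simp]: "label_sign Q 0 p = 1" "label_sign Q p 0 = 1"
  by (simp_all add: label_sign_def pauli_sign_def)

lemma mat_trace_pauli_op:
  assumes "finite Q"
  shows "mat_trace (pauli_op Q p) = (if \<forall>q\<in>Q. p q = 0 then 2 ^ card Q else 0)"
proof -
  have "mat_trace (pauli_op Q p) = (\<Prod>q\<in>Q. if p q = 0 then 2 else 0)"
    unfolding pauli_op_kernel mat_trace_op_on[OF assms] pauli_kernel_def
    by (subst sum_Pow_prod[OF assms]) (simp add: pauli_entry_trace)
  then show ?thesis using assms by auto
qed

lemma pauli_op_cong: "(\<And>q. q \<in> Q \<Longrightarrow> p q = r q) \<Longrightarrow> pauli_op Q p = pauli_op Q r"
  by (simp add: pauli_op_def)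

lemma smult_pauli_op_mult:
  assumes "finite Q"
  shows "(u \<cdot>\<^sub>m pauli_op Q p) * (v \<cdot>\<^sub>m pauli_op Q r) = (u * v * label_phase Q p r) \<cdot>\<^sub>m pauli_op Q (p + r)"
proof -
  have "(u \<cdot>\<^sub>m pauli_op Q p) * (v \<cdot>\<^sub>m pauli_op Q r) = (u * v) \<cdot>\<^sub>m (pauli_op Q p * pauli_op Q r)"
    by (auto simp: mult_smult_assoc_mat[of _ "2 ^ card Q" "2 ^ card Q" _ "2 ^ card Q"]
        mult_smult_distrib[of _ "2 ^ card Q" "2 ^ card Q" _ "2 ^ card Q"])
  then show ?thesis by (simp add: pauli_op_mult[OF assms] smult_smult_mat)
qed

text \<open>Pauli operators are orthogonal for the trace form: after multiplication by
  \<open>pauli_op Q p\<close> the left side has nonzero trace, while the right side has trace 0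
  unless the labels agree on \<open>Q\<close>.\<close>

lemma smult_pauli_op_eq:
  assumes "finite Q" "u \<cdot>\<^sub>m pauli_op Q p = v \<cdot>\<^sub>m pauli_op Q r" "u \<noteq> 0"
  shows "u = v" "q \<in> Q \<Longrightarrow> p q = r q"
proof -
  have "u * label_phase Q p p * mat_trace (pauli_op Q (p + p))
      = v * label_phase Q r p * mat_trace (pauli_op Q (r + p))"
    using arg_cong[OF assms(2), where f = "\<lambda>M. mat_trace (M * (1 \<cdot>\<^sub>m pauli_op Q p))"]
    by (simp add: smult_pauli_op_mult[OF assms(1)] mat_trace_smult[OF pauli_op_carrier]
        del: pauli_fun_add_self one_smult_mat)
  then have *: "u * 2 ^ card Q = v * label_phase Q r p * mat_trace (pauli_op Q (r + p))"
    using assms(1) by (simp add: mat_trace_pauli_op)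
  then have "mat_trace (pauli_op Q (r + p)) \<noteq> 0" using assms(3) by auto
  then have all: "\<forall>q\<in>Q. r q + p q = 0" using assms(1) by (simp add: mat_trace_pauli_op split: if_splits)
  then have eq: "r q = p q" if "q \<in> Q" for q
    using that by (metis add.assoc add.right_neutral add_0 pauli_add_self)
  then show "q \<in> Q \<Longrightarrow> p q = r q" by simp
  have "label_phase Q r p = 1" using eq by (simp add: label_phase_def)
  then show "u = v" using * all assms(1) by (simp add: mat_trace_pauli_op)
qed

lemma adjoint_pauli_op:
  assumes "finite Q"
  shows "mat_adjoint (u \<cdot>\<^sub>m pauli_op Q p) = cnj u \<cdot>\<^sub>m pauli_op Q p"
proof -
  have "cnj (pauli_kernel Q p x y) = pauli_kernel Q p y x" for x y
    by (simp add: pauli_kernel_def cnj_pauli_entry)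
  then show ?thesis
    by (intro eq_matI) (auto simp: mat_adjoint_def mat_of_rows_def pauli_op_kernel op_on_def)
qed

text \<open>Every traced out qubit contributes the trace of its single-qubit factor, which is 2 for
  the identity and 0 otherwise.\<close>

lemma sum_pauli_kernel_partial:
  assumes "finite Q" "B \<subseteq> Q" "x \<subseteq> B" "y \<subseteq> B"
  shows "(\<Sum>z\<in>Pow (Q - B). pauli_kernel Q p (x \<union> z) (y \<union> z))
    = (if \<forall>q\<in>Q - B. p q = 0 then 2 ^ card (Q - B) * pauli_kernel B p x y else 0)"
proof -
  have fin: "finite (Q - B)" "finite B" using assms finite_subset by auto
  have "pauli_kernel Q p (x \<union> z) (y \<union> z)
      = pauli_kernel B p x y * (\<Prod>q\<in>Q - B. pauli_entry (p q) (q \<in> z) (q \<in> z))" if "z \<in> Pow (Q - B)" for z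
  proof -
    have "pauli_kernel Q p (x \<union> z) (y \<union> z)
        = (\<Prod>q\<in>B. pauli_entry (p q) (q \<in> x \<union> z) (q \<in> y \<union> z)) *
          (\<Prod>q\<in>Q - B. pauli_entry (p q) (q \<in> x \<union> z) (q \<in> y \<union> z))"
      unfolding pauli_kernel_def using prod.subset_diff[OF assms(2,1)] by (simp add: mult.commute)
    also have "(\<Prod>q\<in>B. pauli_entry (p q) (q \<in> x \<union> z) (q \<in> y \<union> z)) = pauli_kernel B p x y"
      unfolding pauli_kernel_def
    proof (intro prod.cong refl)
      fix q assume "q \<in> B"
      then have "q \<notin> z" using \<open>z \<in> Pow (Q - B)\<close> by blast
      then show "pauli_entry (p q) (q \<in> x \<union> z) (q \<in> y \<union> z) = pauli_entry (p q) (q \<in> x) (q \<in> y)"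
        by simp
    qed
    also have "(\<Prod>q\<in>Q - B. pauli_entry (p q) (q \<in> x \<union> z) (q \<in> y \<union> z))
        = (\<Prod>q\<in>Q - B. pauli_entry (p q) (q \<in> z) (q \<in> z))"
    proof (intro prod.cong refl)
      fix q assume "q \<in> Q - B"
      then have "q \<notin> x" "q \<notin> y" using assms(3,4) by blast+
      then show "pauli_entry (p q) (q \<in> x \<union> z) (q \<in> y \<union> z) = pauli_entry (p q) (q \<in> z) (q \<in> z)" by simp
    qed
    finally show ?thesis .
  qed
  then have "(\<Sum>z\<in>Pow (Q - B). pauli_kernel Q p (x \<union> z) (y \<union> z))
      = pauli_kernel B p x y * (\<Sum>z\<in>Pow (Q - B). \<Prod>q\<in>Q - B. pauli_entry (p q) (q \<in> z) (q \<in> z))"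
    by (simp add: sum_distrib_left)
  also have "(\<Sum>z\<in>Pow (Q - B). \<Prod>q\<in>Q - B. pauli_entry (p q) (q \<in> z) (q \<in> z))
      = (\<Prod>q\<in>Q - B. if p q = 0 then 2 else 0)"
    by (subst sum_Pow_prod[OF fin(1)]) (simp add: pauli_entry_trace)
  finally show ?thesis using fin by (auto intro: prod_zero simp: prod_zero_iff)
qed

section \<open>Counting commuting labels\<close>

text \<open>Labels are total functions; demanding 0 outside \<open>Q\<close> makes the label of an
  operator unique and turns support on a subset into membership.\<close>

definition labels :: "nat set \<Rightarrow> (nat \<Rightarrow> pauli) set" where
  "labels Q = {p. \<forall>q. q \<notin> Q \<longrightarrow> p q = 0}"

lemma labels_mono: "B \<subseteq> Q \<Longrightarrow> labels B \<subseteq> labels Q"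
  by (auto simp: labels_def)

lemma zero_in_labels [simp]: "0 \<in> labels Q"
  by (simp add: labels_def)

lemma labels_add: "p \<in> labels Q \<Longrightarrow> r \<in> labels Q \<Longrightarrow> p + r \<in> labels Q"
  by (simp add: labels_def)

lemma labels_eqI: "p \<in> labels Q \<Longrightarrow> r \<in> labels Q \<Longrightarrow> (\<And>q. q \<in> Q \<Longrightarrow> p q = r q) \<Longrightarrow> p = r"
  by (auto simp: labels_def fun_eq_iff) metis

lemma labels_empty [simp]: "labels {} = {0}"
  by (auto simp: labels_def fun_eq_iff)

lemma labels_insert:
  assumes "a \<notin> Q"
  shows "bij_betw (\<lambda>(c, p). p(a := c)) (UNIV \<times> labels Q) (labels (insert a Q))"
proof (rule bij_betwI[where g = "\<lambda>p. (p a, p(a := 0))"])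
  show "(\<lambda>(c, p). p(a := c)) \<in> UNIV \<times> labels Q \<rightarrow> labels (insert a Q)"
    by (auto simp: labels_def)
  show "(\<lambda>p. (p a, p(a := 0))) \<in> labels (insert a Q) \<rightarrow> UNIV \<times> labels Q"
    by (auto simp: labels_def)
qed (use assms in \<open>auto simp: labels_def fun_eq_iff\<close>)

lemma sum_labels_prod:
  assumes "finite Q"
  shows "(\<Sum>p\<in>labels Q. \<Prod>q\<in>Q. F q (p q)) = (\<Prod>q\<in>Q. \<Sum>a\<in>UNIV. F q a :: 'b::comm_semiring_1)"
  using assms
proof (induction Q)
  case (insert a Q)
  have "(\<Sum>p\<in>labels (insert a Q). \<Prod>q\<in>insert a Q. F q (p q))
      = (\<Sum>(c, p)\<in>UNIV \<times> labels Q. \<Prod>q\<in>insert a Q. F q ((p(a := c)) q))"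
    using sum.reindex_bij_betw[OF labels_insert[OF insert.hyps(2)], symmetric]
    by (simp only: case_prod_unfold)
  also have "\<dots> = (\<Sum>(c, p)\<in>UNIV \<times> labels Q. F a c * (\<Prod>q\<in>Q. F q (p q)))"
  proof (intro sum.cong refl, clarify)
    fix c p
    have "(\<Prod>q\<in>Q. F q ((p(a := c)) q)) = (\<Prod>q\<in>Q. F q (p q))"
      using insert.hyps by (intro prod.cong) auto
    then show "(\<Prod>q\<in>insert a Q. F q ((p(a := c)) q)) = F a c * (\<Prod>q\<in>Q. F q (p q))"
      using insert.hyps by simp
  qed
  also have "\<dots> = (\<Sum>c\<in>UNIV. F a c) * (\<Sum>p\<in>labels Q. \<Prod>q\<in>Q. F q (p q))"
    by (simp add: sum_product sum.cartesian_product)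
  finally show ?case using insert by simp
qed simp

lemma finite_labels [simp]: "finite Q \<Longrightarrow> finite (labels Q)"
proof (induction Q rule: finite_induct)
  case (insert a Q)
  then show ?case using bij_betw_finite[OF labels_insert[OF insert.hyps(2)]] by simp
qed simp

lemma label_sign_support:
  assumes "finite Q" "B \<subseteq> Q" "p \<in> labels B"
  shows "label_sign Q p r = label_sign B p r"
  unfolding label_sign_def
  by (rule prod.mono_neutral_right) (use assms in \<open>auto simp: labels_def pauli_sign_def\<close>)

lemma label_phase_support:
  assumes "finite Q" "B \<subseteq> Q" "p \<in> labels B"
  shows "label_phase Q p r = label_phase B p r"
  unfolding label_phase_def
  by (rule prod.mono_neutral_right) (use assms in \<open>auto simp: labels_def\<close>)

text \<open>Every label is its own negative, so this already describes subgroups.\<close>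

definition add_closed :: "(nat \<Rightarrow> pauli) set \<Rightarrow> bool" where
  "add_closed F \<longleftrightarrow> 0 \<in> F \<and> (\<forall>p\<in>F. \<forall>r\<in>F. p + r \<in> F)"

lemma add_closed_translate:
  assumes "add_closed F" "s \<in> F"
  shows "(+) s ` F = F"
proof
  show "F \<subseteq> (+) s ` F"
  proof
    fix p assume "p \<in> F"
    then have "s + p \<in> F" "p = s + (s + p)" using assms by (auto simp: add_closed_def)
    then show "p \<in> (+) s ` F" by blast
  qed
qed (use assms in \<open>auto simp: add_closed_def\<close>)

text \<open>The symplectic complement of \<open>F\<close>, restricted to labels supported on
  \<open>B\<close>.\<close>

definition perp :: "nat set \<Rightarrow> nat set \<Rightarrow> (nat \<Rightarrow> pauli) set \<Rightarrow> (nat \<Rightarrow> pauli) set" where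
  "perp Q B F = {p \<in> labels B. \<forall>s\<in>F. label_sign Q p s = 1}"

text \<open>Orthogonality of characters: translation by an element of sign -1 permutes
  \<open>F\<close> but negates the sum, which is therefore 0.\<close>

lemma sum_label_sign:
  assumes "add_closed F"
  shows "(\<Sum>s\<in>F. label_sign Q p s) = (if \<forall>s\<in>F. label_sign Q p s = 1 then of_nat (card F) else 0)"
proof (cases "\<forall>s\<in>F. label_sign Q p s = 1")
  case False
  then obtain s where s: "s \<in> F" "label_sign Q p s = - 1" using label_sign_cases by blast
  have "(\<Sum>t\<in>F. label_sign Q p t) = (\<Sum>t\<in>(+) s ` F. label_sign Q p t)"
    using add_closed_translate[OF assms s(1)] by simp
  also have "\<dots> = (\<Sum>t\<in>F. label_sign Q p (s + t))"
    by (subst sum.reindex) (auto simp: inj_on_def)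
  also have "\<dots> = - (\<Sum>t\<in>F. label_sign Q p t)"
    using s(2) by (simp add: label_sign_commute[of Q p] label_sign_add sum_negf)
  finally have "(\<Sum>t\<in>F. label_sign Q p t) = 0" by simp
  then show ?thesis using False by auto
qed simp

text \<open>Both sides evaluate the character sum of the commutation signs over \<open>labels B \<times> F\<close>.\<close>

lemma card_perp:
  assumes Q: "finite Q" "B \<subseteq> Q" and F: "add_closed F" "F \<subseteq> labels Q"
  shows "card (perp Q B F) * card F = 4 ^ card B * card (F \<inter> labels (Q - B))"
proof -
  have B: "finite B" using Q finite_subset by blast
  have finF: "finite F" using F(2) Q(1) finite_subset finite_labels by blast
  have "(\<Sum>p\<in>labels B. \<Sum>s\<in>F. label_sign Q p s) = (\<Sum>p\<in>labels B. if p \<in> perp Q B F then of_nat (card F) else 0)"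
    by (intro sum.cong refl) (simp add: sum_label_sign[OF F(1)] perp_def)
  also have "\<dots> = of_nat (card (perp Q B F) * card F)"
  proof -
    have "{p \<in> labels B. p \<in> perp Q B F} = perp Q B F" by (auto simp: perp_def)
    then show ?thesis using B by (simp add: sum.If_cases Int_def)
  qed
  finally have 1: "(\<Sum>p\<in>labels B. \<Sum>s\<in>F. label_sign Q p s) = of_nat (card (perp Q B F) * card F)" .
  \<comment> \<open>With \<open>s\<close> fixed the sum factorises over the qubits of
    \<open>B\<close>. It survives only if \<open>s\<close> is trivial on all of them, that is,
    supported on the complement.\<close>
  have inner: "(\<Sum>p\<in>labels B. label_sign Q p s) = (if s \<in> labels (Q - B) then 4 ^ card B else 0)"
    if "s \<in> F" for s
  proof -
    have "(\<Sum>p\<in>labels B. label_sign Q p s) = (\<Sum>p\<in>labels B. \<Prod>q\<in>B. pauli_sign (p q) (s q))"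
      using label_sign_support[OF Q] by (intro sum.cong refl) (simp add: label_sign_def)
    also have "\<dots> = (\<Prod>q\<in>B. if s q = 0 then 4 else 0)"
      by (subst sum_labels_prod[OF B]) (simp add: sum_pauli_sign)
    also have "\<dots> = (if \<forall>q\<in>B. s q = 0 then 4 ^ card B else 0)"
      using B by (auto simp: prod_zero_iff)
    also have "(\<forall>q\<in>B. s q = 0) \<longleftrightarrow> s \<in> labels (Q - B)"
      using that F(2) by (auto simp: labels_def)
    finally show ?thesis .
  qed
  have "(\<Sum>p\<in>labels B. \<Sum>s\<in>F. label_sign Q p s) = (\<Sum>s\<in>F. if s \<in> labels (Q - B) then 4 ^ card B else 0)"
    by (subst sum.swap) (simp add: inner)
  also have "\<dots> = of_nat (4 ^ card B * card (F \<inter> labels (Q - B)))"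
    using finF by (simp add: sum.If_cases mult.commute)
  finally show ?thesis using 1 of_nat_eq_iff[where ?'a = complex] by metis
qed

text \<open>A commuting group lies in its own complement. \<open>card_perp\<close> with
  \<open>B = Q\<close> gives that complement 4^|Q| / 2^|Q| elements, as many as \<open>F\<close>
  has, so the two coincide.\<close>

lemma perp_self_dual:
  assumes Q: "finite Q" and F: "add_closed F" "F \<subseteq> labels Q" "card F = 2 ^ card Q"
    and comm: "\<And>p r. p \<in> F \<Longrightarrow> r \<in> F \<Longrightarrow> label_sign Q p r = 1" and B: "B \<subseteq> Q"
  shows "perp Q B F = F \<inter> labels B"
proof -
  have "F \<inter> labels (Q - Q) = {0}" using F(1) by (auto simp: add_closed_def)
  then have "card (perp Q Q F) * card F = 2 ^ card Q * 2 ^ card Q"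
    using card_perp[OF Q subset_refl F(1,2)] by (simp flip: power_mult_distrib)
  then have "card (perp Q Q F) = card F" by (simp add: F(3))
  moreover have "F \<subseteq> perp Q Q F" using F(2) comm by (auto simp: perp_def)
  moreover have "finite (perp Q Q F)" using Q by (simp add: perp_def)
  ultimately have "perp Q Q F = F" by (metis card_subset_eq)
  moreover have "perp Q B F = perp Q Q F \<inter> labels B"
    using labels_mono[OF B] by (auto simp: perp_def)
  ultimately show ?thesis by simp
qed

text \<open>An abelian group of Pauli operators without nontrivial scalars, given by the labels of its
  elements and their phases \<open>ph\<close>.\<close>

locale signed_labels =
  fixes Q :: "nat set" and F :: "(nat \<Rightarrow> pauli) set" and ph :: "(nat \<Rightarrow> pauli) \<Rightarrow> complex"
  assumes finite_Q: "finite Q" and F_closed: "add_closed F" and F_labels: "F \<subseteq> labels Q"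
    and ph_0: "ph 0 = 1"
    and ph_add: "\<And>p r. p \<in> F \<Longrightarrow> r \<in> F \<Longrightarrow> ph p * ph r * label_phase Q p r = ph (p + r)"
begin

lemma finite_F: "finite F"
  using F_labels finite_Q finite_subset finite_labels by blast

lemma ph_square: "p \<in> F \<Longrightarrow> ph p * ph p = 1"
  using ph_add[of p p] ph_0 by simp

lemma ph_cases: "p \<in> F \<Longrightarrow> ph p = 1 \<or> ph p = - 1"
  using ph_square square_eq_1_iff by blast

text \<open>The right side of \<open>ph_add\<close> is symmetric in \<open>p\<close> and
  \<open>r\<close>, so the phases of the two orders of multiplication agree.\<close>

lemma sign_F:
  assumes "p \<in> F" "r \<in> F"
  shows "label_sign Q p r = 1"
proof -
  have "ph p * ph r * label_phase Q p r = ph r * ph p * label_phase Q r p"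
    using ph_add[OF assms] ph_add[OF assms(2,1)] by (simp add: add.commute)
  moreover have "ph p \<noteq> 0" "ph r \<noteq> 0" using ph_square assms by force+
  ultimately have "label_phase Q p r = label_phase Q r p" by simp
  then show ?thesis using label_phase_commute[of Q p r] by simp
qed

text \<open>The kernel of the sum of the signed Pauli operators with labels in \<open>M\<close>,
  read on \<open>B\<close>. For a subgroup of labels on \<open>B\<close> it is a multiple of a
  projection.\<close>

definition kern :: "nat set \<Rightarrow> (nat \<Rightarrow> pauli) set \<Rightarrow> nat set \<Rightarrow> nat set \<Rightarrow> complex" where
  "kern B M x y = (\<Sum>r\<in>M. ph r * pauli_kernel B r x y)"

text \<open>Each \<open>r \<in> M\<close> carries \<open>M'\<close> bijectively to the same set
  \<open>M''\<close>, so the product consists of \<open>card M\<close> equal copies. Letting the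
  three sets differ covers products of cosets as well as of subgroups.\<close>

lemma kern_mult:
  assumes B: "B \<subseteq> Q" and M: "M \<subseteq> F \<inter> labels B" "M' \<subseteq> F \<inter> labels B"
    and tr: "\<And>r. r \<in> M \<Longrightarrow> (+) r ` M' = M''"
  shows "(\<Sum>z\<in>Pow B. kern B M x z * kern B M' z y) = of_nat (card M) * kern B M'' x y"
proof -
  have fB: "finite B" using B finite_Q finite_subset by blast
  have "(\<Sum>z\<in>Pow B. kern B M x z * kern B M' z y)
      = (\<Sum>z\<in>Pow B. \<Sum>r\<in>M. \<Sum>t\<in>M'. ph r * pauli_kernel B r x z * (ph t * pauli_kernel B t z y))"
    by (simp add: kern_def sum_product)
  also have "\<dots> = (\<Sum>r\<in>M. \<Sum>t\<in>M'. \<Sum>z\<in>Pow B. ph r * pauli_kernel B r x z * (ph t * pauli_kernel B t z y))"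
    by (subst sum.swap, intro sum.cong refl, subst sum.swap, simp)
  also have "\<dots> = (\<Sum>r\<in>M. \<Sum>t\<in>M'. ph (r + t) * pauli_kernel B (r + t) x y)"
  proof (intro sum.cong refl)
    fix r t assume rt: "r \<in> M" "t \<in> M'"
    have "(\<Sum>z\<in>Pow B. ph r * pauli_kernel B r x z * (ph t * pauli_kernel B t z y))
        = ph r * ph t * (\<Sum>z\<in>Pow B. pauli_kernel B r x z * pauli_kernel B t z y)"
      by (simp add: sum_distrib_left ac_simps)
    also have "\<dots> = ph r * ph t * label_phase Q r t * pauli_kernel B (r + t) x y"
      using rt M label_phase_support[OF finite_Q B, of r t]
      by (subst pauli_kernel_mult[OF fB]) auto
    also have "\<dots> = ph (r + t) * pauli_kernel B (r + t) x y"
      using rt M by (subst ph_add) auto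
    finally show "(\<Sum>z\<in>Pow B. ph r * pauli_kernel B r x z * (ph t * pauli_kernel B t z y))
        = ph (r + t) * pauli_kernel B (r + t) x y" .
  qed
  also have "\<dots> = (\<Sum>r\<in>M. kern B M'' x y)"
  proof (intro sum.cong refl)
    fix r assume "r \<in> M"
    then show "(\<Sum>t\<in>M'. ph (r + t) * pauli_kernel B (r + t) x y) = kern B M'' x y"
      unfolding kern_def tr[OF \<open>r \<in> M\<close>, symmetric] by (subst sum.reindex) (auto simp: inj_on_def)
  qed
  finally show ?thesis by simp
qed

lemma kern_partial:
  assumes B: "B \<subseteq> Q" "x \<subseteq> B" "y \<subseteq> B" and M: "M \<subseteq> F"
  shows "(\<Sum>z\<in>Pow (Q - B). kern Q M (x \<union> z) (y \<union> z)) = 2 ^ card (Q - B) * kern B (M \<inter> labels B) x y"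
proof -
  have finM: "finite M" using M finite_F finite_subset by blast
  have "(\<Sum>z\<in>Pow (Q - B). kern Q M (x \<union> z) (y \<union> z))
      = (\<Sum>r\<in>M. ph r * (\<Sum>z\<in>Pow (Q - B). pauli_kernel Q r (x \<union> z) (y \<union> z)))"
    unfolding kern_def by (subst sum.swap) (simp add: sum_distrib_left)
  also have "\<dots> = (\<Sum>r\<in>M. if r \<in> labels B then 2 ^ card (Q - B) * (ph r * pauli_kernel B r x y) else 0)"
  proof (intro sum.cong refl)
    fix r assume "r \<in> M"
    then have "r \<in> labels Q" using M F_labels by blast
    then have "(\<forall>q\<in>Q - B. r q = 0) \<longleftrightarrow> r \<in> labels B"
      using B(1) by (auto simp: labels_def)
    then show "ph r * (\<Sum>z\<in>Pow (Q - B). pauli_kernel Q r (x \<union> z) (y \<union> z))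
        = (if r \<in> labels B then 2 ^ card (Q - B) * (ph r * pauli_kernel B r x y) else 0)"
      by (simp add: sum_pauli_kernel_partial[OF finite_Q B])
  qed
  also have "\<dots> = (\<Sum>r\<in>M \<inter> labels B. 2 ^ card (Q - B) * (ph r * pauli_kernel B r x y))"
    using finM by (simp add: sum.If_cases)
  finally show ?thesis by (simp add: kern_def sum_distrib_left)
qed

text \<open>Only the identity, with label 0 and phase 1, has nonzero trace.\<close>

lemma kern_trace:
  assumes "B \<subseteq> Q" "M \<subseteq> F \<inter> labels B"
  shows "(\<Sum>x\<in>Pow B. kern B M x x) = (if 0 \<in> M then 2 ^ card B else 0)"
proof -
  have fB: "finite B" using assms(1) finite_Q finite_subset by blast
  have finM: "finite M" using assms(2) finite_F finite_subset by blast
  have "(\<Sum>x\<in>Pow B. kern B M x x) = (\<Sum>r\<in>M. ph r * mat_trace (pauli_op B r))"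
    unfolding kern_def pauli_op_kernel mat_trace_op_on[OF fB]
    by (subst sum.swap) (simp add: sum_distrib_left)
  also have "\<dots> = (\<Sum>r\<in>M. if r = 0 then 2 ^ card B else 0)"
  proof (intro sum.cong refl)
    fix r assume "r \<in> M"
    then have "r \<in> labels B" using assms(2) by blast
    then have "(\<forall>q\<in>B. r q = 0) \<longleftrightarrow> r = 0" by (auto simp: labels_def fun_eq_iff)
    then show "ph r * mat_trace (pauli_op B r) = (if r = 0 then 2 ^ card B else 0)"
      by (simp add: mat_trace_pauli_op[OF fB] ph_0)
  qed
  also have "\<dots> = (if 0 \<in> M then 2 ^ card B else 0)"
    using finM by (simp add: sum.delta)
  finally show ?thesis .
qed

lemma cnj_kern: "M \<subseteq> F \<Longrightarrow> cnj (kern B M x y) = kern B M y x"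
proof -
  assume "M \<subseteq> F"
  then have "cnj (ph r) = ph r" if "r \<in> M" for r using ph_cases that by force
  then show ?thesis by (simp add: kern_def pauli_kernel_def cnj_pauli_entry)
qed

end

section \<open>Groups of Pauli operators\<close>

lemma pauli_group_simps [simp]:
  "monoid.mult (pauli_group Q) = (*)" "one (pauli_group Q) = 1\<^sub>m (2 ^ card Q)"
  by (simp_all add: pauli_group_def)

lemma pauli_group_carrier:
  "carrier (pauli_group Q) = {\<i> ^ k \<cdot>\<^sub>m pauli_op Q p | k p. p \<in> labels Q}" (is "_ = ?R")
proof
  show "carrier (pauli_group Q) \<subseteq> ?R"
  proof
    fix P assume "P \<in> carrier (pauli_group Q)"
    then obtain k p where P: "P = \<i> ^ k \<cdot>\<^sub>m pauli_op Q p" by (auto simp: pauli_group_def)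
    define r where "r = (\<lambda>q. if q \<in> Q then p q else 0)"
    have "pauli_op Q p = pauli_op Q r" by (intro pauli_op_cong) (simp add: r_def)
    moreover have "r \<in> labels Q" by (simp add: labels_def r_def)
    ultimately show "P \<in> ?R" using P by (auto intro!: exI[of _ k] exI[of _ r])
  qed
qed (auto simp: pauli_group_def)

lemma pauli_group_in_carrier [intro]: "\<i> ^ k \<cdot>\<^sub>m pauli_op Q p \<in> carrier (pauli_group Q)"
  by (auto simp: pauli_group_def)

lemma pauli_group_carrier_mat:
  "P \<in> carrier (pauli_group Q) \<Longrightarrow> P \<in> carrier_mat (2 ^ card Q) (2 ^ card Q)"
  by (auto simp: pauli_group_def)

text \<open>Phases have natural exponents; since i^4 = 1, the exponent \<open>3 * k\<close> serves
  for the inverse.\<close>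

lemma i_power_inverse: "\<i> ^ k * \<i> ^ (3 * k) = 1"
proof -
  have "\<i> ^ k * \<i> ^ (3 * k) = (\<i> ^ 4) ^ k" by (simp flip: power_add power_mult)
  then show ?thesis by simp
qed

lemma group_pauli_group:
  assumes "finite Q"
  shows "group (pauli_group Q)"
proof (rule groupI)
  fix x y assume x: "x \<in> carrier (pauli_group Q)" and y: "y \<in> carrier (pauli_group Q)"
  obtain k p l r where xy: "x = \<i> ^ k \<cdot>\<^sub>m pauli_op Q p" "y = \<i> ^ l \<cdot>\<^sub>m pauli_op Q r"
    using x y by (auto simp: pauli_group_def)
  obtain m where "label_phase Q p r = \<i> ^ m" using label_phase_power by blast
  then show "x \<otimes>\<^bsub>pauli_group Q\<^esub> y \<in> carrier (pauli_group Q)"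
    by (auto simp: xy smult_pauli_op_mult[OF assms] simp flip: power_add)
next
  fix x y z assume "x \<in> carrier (pauli_group Q)" "y \<in> carrier (pauli_group Q)" "z \<in> carrier (pauli_group Q)"
  then show "x \<otimes>\<^bsub>pauli_group Q\<^esub> y \<otimes>\<^bsub>pauli_group Q\<^esub> z = x \<otimes>\<^bsub>pauli_group Q\<^esub> (y \<otimes>\<^bsub>pauli_group Q\<^esub> z)"
    by (auto dest!: pauli_group_carrier_mat)
next
  have "1\<^sub>m (2 ^ card Q) = \<i> ^ 0 \<cdot>\<^sub>m pauli_op Q 0"
    by (simp add: pauli_op_0[OF assms])
  then show "\<one>\<^bsub>pauli_group Q\<^esub> \<in> carrier (pauli_group Q)"
    by (metis pauli_group_in_carrier pauli_group_simps(2))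
next
  fix x assume "x \<in> carrier (pauli_group Q)"
  then show "\<one>\<^bsub>pauli_group Q\<^esub> \<otimes>\<^bsub>pauli_group Q\<^esub> x = x"
    by (auto dest!: pauli_group_carrier_mat)
next
  fix x assume "x \<in> carrier (pauli_group Q)"
  then obtain k p where x: "x = \<i> ^ k \<cdot>\<^sub>m pauli_op Q p" by (auto simp: pauli_group_def)
  have "\<i> ^ (3 * k) \<cdot>\<^sub>m pauli_op Q p * x = 1\<^sub>m (2 ^ card Q)"
    using i_power_inverse[of k]
    by (simp add: x smult_pauli_op_mult[OF assms] pauli_op_0[OF assms] mult.commute)
  then show "\<exists>y\<in>carrier (pauli_group Q). y \<otimes>\<^bsub>pauli_group Q\<^esub> x = \<one>\<^bsub>pauli_group Q\<^esub>"
    by (intro bexI[of _ "\<i> ^ (3 * k) \<cdot>\<^sub>m pauli_op Q p"]) auto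
qed

text \<open>In a commutative group of involutions, adjoining a generator \<open>g\<close> outside
  the subgroup \<open>?K\<close> generated so far yields \<open>?K\<close> and its translate by
  \<open>g\<close>, hence doubles the size.\<close>

lemma card_generate_independent:
  assumes "group H" and S: "subgroup S H" and sq: "\<And>x. x \<in> S \<Longrightarrow> x \<otimes>\<^bsub>H\<^esub> x = \<one>\<^bsub>H\<^esub>"
    and comm: "\<And>x y. x \<in> S \<Longrightarrow> y \<in> S \<Longrightarrow> x \<otimes>\<^bsub>H\<^esub> y = y \<otimes>\<^bsub>H\<^esub> x"
    and G: "finite G" "G \<subseteq> S" and ind: "\<And>g. g \<in> G \<Longrightarrow> g \<notin> generate H (G - {g})"
  shows "card (generate H G) = 2 ^ card G"
  using G ind
proof (induction G rule: finite_induct)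
  case empty
  interpret group H by fact
  show ?case by (simp add: generate_empty)
next
  case (insert g G)
  interpret group H by fact
  interpret S: subgroup S H by fact
  let ?K = "generate H G"
  have carr: "G \<subseteq> carrier H" "g \<in> carrier H" "g \<in> S" "G \<subseteq> S"
    using insert.prems S.subset by auto
  have K: "subgroup ?K H" using carr by (intro generate_is_subgroup) auto
  interpret K: subgroup ?K H by (rule K)
  have KS: "?K \<subseteq> S" using carr S by (intro generate_subgroup_incl) auto
  have ind: "h \<notin> generate H (G - {h})" if "h \<in> G" for h
    using insert.prems(2)[of h] that mono_generate[of "G - {h}" "insert g G - {h}"] by blast
  have IH: "card ?K = 2 ^ card G"
    using insert.IH carr(4) ind by blast
  have g: "g \<notin> ?K" using insert.prems(2)[of g] insert.hyps(2) by simp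
  let ?gK = "(\<lambda>x. g \<otimes>\<^bsub>H\<^esub> x) ` ?K"
  have inv_self: "inv\<^bsub>H\<^esub> x = x" if "x \<in> S" for x
    using sq[OF that] that S.subset by (intro inv_equality) auto
  \<comment> \<open>As \<open>g\<close> squares to the identity, the product of two elements of the
    translate falls back into \<open>?K\<close>.\<close>
  have dist: "(g \<otimes>\<^bsub>H\<^esub> x) \<otimes>\<^bsub>H\<^esub> (g \<otimes>\<^bsub>H\<^esub> y) = x \<otimes>\<^bsub>H\<^esub> y" if "x \<in> ?K" "y \<in> ?K" for x y
  proof -
    have xS: "x \<in> S" "y \<in> S" "x \<in> carrier H" "y \<in> carrier H" using that KS S.subset by auto
    have "(g \<otimes>\<^bsub>H\<^esub> x) \<otimes>\<^bsub>H\<^esub> (g \<otimes>\<^bsub>H\<^esub> y) = (x \<otimes>\<^bsub>H\<^esub> g) \<otimes>\<^bsub>H\<^esub> (g \<otimes>\<^bsub>H\<^esub> y)"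
      using comm[OF xS(1) carr(3)] by simp
    also have "\<dots> = x \<otimes>\<^bsub>H\<^esub> (g \<otimes>\<^bsub>H\<^esub> g) \<otimes>\<^bsub>H\<^esub> y" using xS carr by (simp add: m_assoc)
    finally show ?thesis using xS by (simp add: sq carr)
  qed
  have sub: "subgroup (?K \<union> ?gK) H"
  proof (rule subgroupI)
    show "?K \<union> ?gK \<subseteq> carrier H" using carr K.subset by auto
    show "?K \<union> ?gK \<noteq> {}" using K.one_closed by blast
  next
    fix a assume "a \<in> ?K \<union> ?gK"
    moreover from this have "a \<in> S" using KS carr by auto
    ultimately show "inv\<^bsub>H\<^esub> a \<in> ?K \<union> ?gK" by (simp add: inv_self)
  next
    fix a b assume ab: "a \<in> ?K \<union> ?gK" "b \<in> ?K \<union> ?gK"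
    have gc: "g \<otimes>\<^bsub>H\<^esub> (x \<otimes>\<^bsub>H\<^esub> y) = (g \<otimes>\<^bsub>H\<^esub> x) \<otimes>\<^bsub>H\<^esub> y" "x \<otimes>\<^bsub>H\<^esub> (g \<otimes>\<^bsub>H\<^esub> y) = g \<otimes>\<^bsub>H\<^esub> (x \<otimes>\<^bsub>H\<^esub> y)"
      if "x \<in> ?K" "y \<in> ?K" for x y
    proof -
      have xS: "x \<in> S" "x \<in> carrier H" "y \<in> carrier H" using that KS S.subset by auto
      show "g \<otimes>\<^bsub>H\<^esub> (x \<otimes>\<^bsub>H\<^esub> y) = (g \<otimes>\<^bsub>H\<^esub> x) \<otimes>\<^bsub>H\<^esub> y" using xS carr by (simp add: m_assoc)
      then show "x \<otimes>\<^bsub>H\<^esub> (g \<otimes>\<^bsub>H\<^esub> y) = g \<otimes>\<^bsub>H\<^esub> (x \<otimes>\<^bsub>H\<^esub> y)"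
        using xS carr comm[OF xS(1) carr(3)] by (simp flip: m_assoc)
    qed
    from ab consider "a \<in> ?K" "b \<in> ?K" | x where "x \<in> ?K" "a = g \<otimes>\<^bsub>H\<^esub> x" "b \<in> ?K"
      | y where "a \<in> ?K" "y \<in> ?K" "b = g \<otimes>\<^bsub>H\<^esub> y"
      | x y where "x \<in> ?K" "a = g \<otimes>\<^bsub>H\<^esub> x" "y \<in> ?K" "b = g \<otimes>\<^bsub>H\<^esub> y"
      by blast
    then show "a \<otimes>\<^bsub>H\<^esub> b \<in> ?K \<union> ?gK"
    proof cases
      case 2
      then have "a \<otimes>\<^bsub>H\<^esub> b = g \<otimes>\<^bsub>H\<^esub> (x \<otimes>\<^bsub>H\<^esub> b)" by (simp add: gc)
      then show ?thesis using 2 by blast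
    next
      case 3
      then have "a \<otimes>\<^bsub>H\<^esub> b = g \<otimes>\<^bsub>H\<^esub> (a \<otimes>\<^bsub>H\<^esub> y)" by (simp add: gc)
      then show ?thesis using 3 by blast
    qed (auto simp: dist)
  qed
  have "generate H (insert g G) = ?K \<union> ?gK"
  proof
    have "g = g \<otimes>\<^bsub>H\<^esub> \<one>\<^bsub>H\<^esub>" using carr by simp
    then have "insert g G \<subseteq> ?K \<union> ?gK"
      using generate.incl[of _ G H] K.one_closed by blast
    then show "generate H (insert g G) \<subseteq> ?K \<union> ?gK"
      using sub by (rule generate_subgroup_incl)
    have "?K \<subseteq> generate H (insert g G)" by (rule mono_generate) auto
    then show "?K \<union> ?gK \<subseteq> generate H (insert g G)"
      by (auto intro: generate.incl generate.eng)
  qed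
  \<comment> \<open>A common element would let \<open>g\<close> be solved for inside
    \<open>?K\<close>, against independence.\<close>
  moreover have "?K \<inter> ?gK = {}"
  proof (rule ccontr)
    assume "?K \<inter> ?gK \<noteq> {}"
    then obtain x where x: "x \<in> ?K" "g \<otimes>\<^bsub>H\<^esub> x \<in> ?K" by auto
    then have "g \<otimes>\<^bsub>H\<^esub> x \<otimes>\<^bsub>H\<^esub> inv\<^bsub>H\<^esub> x \<in> ?K" by blast
    moreover have "x \<in> carrier H" using x K.subset by blast
    ultimately show False using g carr by (simp add: m_assoc)
  qed
  moreover have "inj_on (\<lambda>x. g \<otimes>\<^bsub>H\<^esub> x) ?K"
    using carr K.subset by (auto intro!: inj_onI)
  then have "card ?gK = card ?K" by (rule card_image)
  moreover have "finite ?K" using IH card_eq_0_iff by fastforce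
  ultimately show ?case
    using insert.hyps IH by (simp add: card_Un_disjoint)
qed

definition label_set :: "nat set \<Rightarrow> complex mat set \<Rightarrow> (nat \<Rightarrow> pauli) set" where
  "label_set Q T = {p \<in> labels Q. \<exists>k. \<i> ^ k \<cdot>\<^sub>m pauli_op Q p \<in> T}"

text \<open>Without nontrivial scalars in \<open>T\<close>, two elements with the same label have
  the same phase. The phase is thus a function of the label, and forgetting it loses
  nothing.\<close>

lemma signed_labels_of_group:
  assumes Q: "finite Q" and T: "T \<subseteq> carrier (pauli_group Q)" "1\<^sub>m (2 ^ card Q) \<in> T"
    and closed: "\<And>s t. s \<in> T \<Longrightarrow> t \<in> T \<Longrightarrow> s * t \<in> T"
    and scalar: "\<And>k. \<i> ^ k \<cdot>\<^sub>m 1\<^sub>m (2 ^ card Q) \<in> T \<Longrightarrow> \<i> ^ k = 1"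
  obtains ph where "signed_labels Q (label_set Q T) ph"
    and "bij_betw (\<lambda>p. ph p \<cdot>\<^sub>m pauli_op Q p) (label_set Q T) T"
proof -
  let ?F = "label_set Q T"
  have "\<exists>u. p \<in> ?F \<longrightarrow> (u \<cdot>\<^sub>m pauli_op Q p \<in> T \<and> (\<exists>k. u = \<i> ^ k))" for p
    by (auto simp: label_set_def)
  then obtain ph where ph: "\<And>p. p \<in> ?F \<Longrightarrow> ph p \<cdot>\<^sub>m pauli_op Q p \<in> T"
    and phk: "\<And>p. p \<in> ?F \<Longrightarrow> \<exists>k. ph p = \<i> ^ k"
    by metis
  \<comment> \<open>Multiplying either operator by the one chosen for \<open>p\<close> gives a
    scalar in \<open>T\<close>, hence 1; comparing the two scalars identifies the phases.\<close>
  have unique: "\<i> ^ l = ph p" if p: "p \<in> ?F" and l: "\<i> ^ l \<cdot>\<^sub>m pauli_op Q p \<in> T" for l p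
  proof -
    obtain k where k: "ph p = \<i> ^ k" using phk[OF p] by blast
    have "(ph p \<cdot>\<^sub>m pauli_op Q p) * (ph p \<cdot>\<^sub>m pauli_op Q p) \<in> T"
      "(\<i> ^ l \<cdot>\<^sub>m pauli_op Q p) * (ph p \<cdot>\<^sub>m pauli_op Q p) \<in> T"
      using closed ph[OF p] l by blast+
    then have "\<i> ^ (k + k) = 1" "\<i> ^ (l + k) = 1"
      using scalar[of "k + k"] scalar[of "l + k"]
      by (auto simp: smult_pauli_op_mult[OF Q] pauli_op_0[OF Q] k power_add)
    then have "\<i> ^ l * \<i> ^ k = \<i> ^ k * \<i> ^ k" by (simp add: power_add)
    then show ?thesis using k by simp
  qed
  have one: "(0 :: nat \<Rightarrow> pauli) \<in> ?F" and ph0: "ph 0 = 1"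
  proof -
    have "\<i> ^ 0 \<cdot>\<^sub>m pauli_op Q 0 \<in> T" using T(2) by (simp add: pauli_op_0[OF Q])
    then show "(0 :: nat \<Rightarrow> pauli) \<in> ?F" unfolding label_set_def using zero_in_labels by blast
    then show "ph 0 = 1" using unique[of 0 0] T(2) by (simp add: pauli_op_0[OF Q])
  qed
  have add: "p + r \<in> ?F" "ph p * ph r * label_phase Q p r = ph (p + r)" if pr: "p \<in> ?F" "r \<in> ?F" for p r
  proof -
    obtain k l m where klm: "ph p = \<i> ^ k" "ph r = \<i> ^ l" "label_phase Q p r = \<i> ^ m"
      using phk pr label_phase_power by metis
    have "(ph p \<cdot>\<^sub>m pauli_op Q p) * (ph r \<cdot>\<^sub>m pauli_op Q r) \<in> T" using closed ph pr by blast
    then have *: "\<i> ^ (k + l + m) \<cdot>\<^sub>m pauli_op Q (p + r) \<in> T"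
      by (simp add: smult_pauli_op_mult[OF Q] klm power_add)
    then show pr': "p + r \<in> ?F" using pr labels_add by (auto simp: label_set_def)
    show "ph p * ph r * label_phase Q p r = ph (p + r)"
      using unique[OF pr' *] by (simp add: klm power_add)
  qed
  have "signed_labels Q ?F ph"
    using Q one ph0 add by unfold_locales (auto simp: add_closed_def label_set_def)
  moreover have "bij_betw (\<lambda>p. ph p \<cdot>\<^sub>m pauli_op Q p) ?F T"
    unfolding bij_betw_def
  proof (intro conjI inj_onI subset_antisym)
    fix p r assume pr: "p \<in> ?F" "r \<in> ?F" "ph p \<cdot>\<^sub>m pauli_op Q p = ph r \<cdot>\<^sub>m pauli_op Q r"
    have "ph p \<noteq> 0" using phk[OF pr(1)] by auto
    then show "p = r"
      using smult_pauli_op_eq(2)[OF Q pr(3)] pr(1,2) labels_eqI by (auto simp: label_set_def)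
  next
    show "T \<subseteq> (\<lambda>p. ph p \<cdot>\<^sub>m pauli_op Q p) ` ?F"
    proof
      fix t assume t: "t \<in> T"
      then obtain k p where kp: "t = \<i> ^ k \<cdot>\<^sub>m pauli_op Q p" "p \<in> labels Q"
        using T(1) pauli_group_carrier by blast
      then have p: "p \<in> ?F" using t by (auto simp: label_set_def)
      then show "t \<in> (\<lambda>p. ph p \<cdot>\<^sub>m pauli_op Q p) ` ?F"
        using unique[OF p, of k] kp t by auto
    qed
  qed (use ph in auto)
  ultimately show ?thesis using that by blast
qed

section \<open>Pure stabilizer states\<close>

lemma amplitude_op_on_mult:
  assumes "finite Q" "v \<in> carrier_vec (2 ^ card Q)" "x \<subseteq> Q"
  shows "amplitude Q (op_on Q f *\<^sub>v v) x = (\<Sum>y\<in>Pow Q. f x y * amplitude Q v y)"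
proof -
  have "amplitude Q (op_on Q f *\<^sub>v v) x
      = (\<Sum>j<2 ^ card Q. f x (basis_label Q j) * amplitude Q v (basis_label Q j))"
    using assms
    by (simp add: amplitude_def op_on_def basis_index_less scalar_prod_def lessThan_atLeast0)
  then show ?thesis using sum_basis_label[OF assms(1)] by simp
qed

lemma inner_prod_amplitude:
  assumes "finite Q" "v \<in> carrier_vec (2 ^ card Q)" "w \<in> carrier_vec (2 ^ card Q)"
  shows "v \<bullet>c w = (\<Sum>x\<in>Pow Q. amplitude Q v x * cnj (amplitude Q w x))"
proof -
  have "v \<bullet>c w = (\<Sum>j<2 ^ card Q. amplitude Q v (basis_label Q j) * cnj (amplitude Q w (basis_label Q j)))"
    using assms by (simp add: amplitude_def scalar_prod_def lessThan_atLeast0)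
  then show ?thesis using sum_basis_label[OF assms(1)] by simp
qed

text \<open>A projection of trace 1 fixing the unit vector \<open>f\<close> is the projection onto \<open>f\<close>, because
  the squared Hilbert-Schmidt norm of the difference is 0.\<close>

lemma rank_one_projection:
  fixes D :: "'a \<Rightarrow> 'a \<Rightarrow> complex"
  assumes fin: "finite V"
    and fix_f: "\<And>x. x \<in> V \<Longrightarrow> (\<Sum>y\<in>V. D x y * f y) = f x"
    and herm: "\<And>x y. x \<in> V \<Longrightarrow> y \<in> V \<Longrightarrow> D y x = cnj (D x y)"
    and idem: "\<And>x y. x \<in> V \<Longrightarrow> y \<in> V \<Longrightarrow> (\<Sum>z\<in>V. D x z * D z y) = D x y"
    and tr: "(\<Sum>x\<in>V. D x x) = 1" and unit: "(\<Sum>x\<in>V. f x * cnj (f x)) = 1"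
    and xy: "x \<in> V" "y \<in> V"
  shows "D x y = f x * cnj (f y)"
proof -
  define E where "E = (\<lambda>x y. D x y - f x * cnj (f y))"
  have E_herm: "E y x = cnj (E x y)" if "x \<in> V" "y \<in> V" for x y
    using herm[OF that] by (simp add: E_def)
  have fix_f': "(\<Sum>x\<in>V. cnj (f x) * D x y) = cnj (f y)" if "y \<in> V" for y
  proof -
    have "cnj (\<Sum>x\<in>V. D y x * f x) = (\<Sum>x\<in>V. cnj (f x) * D x y)"
      using herm[OF that] by (simp add: mult.commute)
    then show ?thesis using fix_f[OF that] by simp
  qed
  have unit': "(\<Sum>x\<in>V. cnj (f x) * f x) = 1"
    using unit by (simp add: mult.commute)
  \<comment> \<open>Summed over \<open>x\<close> and \<open>y\<close>, the four terms are tr(D^2),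
    the expectation of \<open>D\<close> in \<open>f\<close> twice, and the squared norm of
    \<open>f\<close> squared: 1 - 1 - 1 + 1 = 0.\<close>
  have "E x y * E y x = D x y * D y x - cnj (f x) * (D x y * f y) - f x * (cnj (f y) * D y x)
      + f x * cnj (f x) * (f y * cnj (f y))" for x y
    by (simp add: E_def algebra_simps)
  then have "(\<Sum>x\<in>V. \<Sum>y\<in>V. E x y * E y x)
      = (\<Sum>x\<in>V. \<Sum>y\<in>V. D x y * D y x) - (\<Sum>x\<in>V. cnj (f x) * (\<Sum>y\<in>V. D x y * f y))
        - (\<Sum>x\<in>V. f x * (\<Sum>y\<in>V. cnj (f y) * D y x))
        + (\<Sum>x\<in>V. f x * cnj (f x) * (\<Sum>y\<in>V. f y * cnj (f y)))"
    by (simp add: sum.distrib sum_subtractf sum_distrib_left)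
  then have "(\<Sum>x\<in>V. \<Sum>y\<in>V. E x y * E y x) = 0"
    using tr unit unit' by (simp add: idem fix_f fix_f')
  moreover have "E x y * E y x = of_real ((cmod (E x y))\<^sup>2)" if "x \<in> V" "y \<in> V" for x y
    using E_herm[OF that] by (simp only: complex_norm_square)
  ultimately have "(\<Sum>x\<in>V. \<Sum>y\<in>V. complex_of_real ((cmod (E x y))\<^sup>2)) = 0" by simp
  then have "(\<Sum>x\<in>V. \<Sum>y\<in>V. (cmod (E x y))\<^sup>2) = 0"
    unfolding of_real_sum[symmetric] of_real_eq_0_iff .
  then have "\<forall>x\<in>V. (\<Sum>y\<in>V. (cmod (E x y))\<^sup>2) = 0"
    using fin by (subst (asm) sum_nonneg_eq_0_iff) (auto intro: sum_nonneg)
  then have "(cmod (E x y))\<^sup>2 = 0"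
    using fin xy by (subst (asm) sum_nonneg_eq_0_iff) auto
  then show ?thesis by (simp add: E_def)
qed

text \<open>The average over a group of 2^|Q| signed Pauli operators is a projection. Only the
  identity contributes to its trace, which is 1, so a unit vector fixed by the group determines
  it.\<close>

lemma (in signed_labels) pure_state_kern:
  assumes card: "card F = 2 ^ card Q"
    and stab: "\<And>r x. r \<in> F \<Longrightarrow> x \<subseteq> Q \<Longrightarrow> (\<Sum>y\<in>Pow Q. ph r * pauli_kernel Q r x y * f y) = f x"
    and unit: "(\<Sum>x\<in>Pow Q. f x * cnj (f x)) = 1"
    and xy: "x \<subseteq> Q" "y \<subseteq> Q"
  shows "f x * cnj (f y) = kern Q F x y / 2 ^ card Q"
proof -
  have FQ: "F \<subseteq> F \<inter> labels Q" "F \<subseteq> F" using F_labels by auto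
  have "kern Q F x y / 2 ^ card Q = f x * cnj (f y)"
  proof (rule rank_one_projection[where V = "Pow Q" and D = "\<lambda>x y. kern Q F x y / 2 ^ card Q"])
    fix x assume x: "x \<in> Pow Q"
    have "(\<Sum>y\<in>Pow Q. kern Q F x y * f y) = (\<Sum>r\<in>F. \<Sum>y\<in>Pow Q. ph r * pauli_kernel Q r x y * f y)"
      unfolding kern_def sum_distrib_right by (rule sum.swap)
    also have "\<dots> = 2 ^ card Q * f x" using x stab card by simp
    finally show "(\<Sum>y\<in>Pow Q. kern Q F x y / 2 ^ card Q * f y) = f x"
      by (simp flip: sum_divide_distrib)
  next
    fix x y assume "x \<in> Pow Q" "y \<in> Pow Q"
    show "kern Q F y x / 2 ^ card Q = cnj (kern Q F x y / 2 ^ card Q)"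
      by (simp add: cnj_kern[OF FQ(2)])
    have "(\<Sum>z\<in>Pow Q. kern Q F x z * kern Q F z y) = 2 ^ card Q * kern Q F x y"
      using kern_mult[OF subset_refl FQ(1) FQ(1) add_closed_translate[OF F_closed]] card by simp
    then show "(\<Sum>z\<in>Pow Q. kern Q F x z / 2 ^ card Q * (kern Q F z y / 2 ^ card Q)) = kern Q F x y / 2 ^ card Q"
      by (simp flip: sum_divide_distrib)
  next
    have "(\<Sum>x\<in>Pow Q. kern Q F x x) = 2 ^ card Q"
      using kern_trace[OF subset_refl FQ(1)] F_closed by (simp add: add_closed_def)
    then show "(\<Sum>x\<in>Pow Q. kern Q F x x / 2 ^ card Q) = 1" by (simp flip: sum_divide_distrib)
  qed (use finite_Q unit xy in auto)
  then show ?thesis ..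
qed

section \<open>Codes with one logical qubit\<close>

locale qubit_code =
  fixes n d :: nat and S :: "complex mat set" and Z X :: "complex mat" and \<psi>\<^sub>0 \<psi>\<^sub>1 :: "complex vec"
  assumes code: "stabilizer_code_1 n d S" and pair: "logical_pair n S Z X"
    and basis: "logical_basis n S Z \<psi>\<^sub>0 \<psi>\<^sub>1"
begin

abbreviation "N \<equiv> {1..n}"
abbreviation "P \<equiv> pauli_op N"

definition L :: "(nat \<Rightarrow> pauli) set" where "L = label_set N S"
text \<open>The group S' of the overview. Two cosets suffice because \<open>Z\<close> commutes with
  \<open>S\<close> and squares to the identity.\<close>

definition ext :: "complex mat set" where "ext = S \<union> (*) Z ` S"
definition L' :: "(nat \<Rightarrow> pauli) set" where "L' = label_set N ext"

lemma card_N [simp]: "card N = n" by simp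

lemma S_subgroup: "subgroup S (pauli_group N)"
  and S_comm: "s \<in> S \<Longrightarrow> t \<in> S \<Longrightarrow> s * t = t * s"
  and minus_one: "- 1\<^sub>m (2 ^ n) \<notin> S"
  using code by (auto simp: stabilizer_code_1_def stabilizer_group_def)

lemma S_carrier: "S \<subseteq> carrier (pauli_group N)"
  using subgroup.subset[OF S_subgroup] .

lemma S_mult: "s \<in> S \<Longrightarrow> t \<in> S \<Longrightarrow> s * t \<in> S"
  using subgroup.m_closed[OF S_subgroup] by simp

lemma S_one: "1\<^sub>m (2 ^ n) \<in> S"
  using subgroup.one_closed[OF S_subgroup] by simp

lemma S_mat: "s \<in> S \<Longrightarrow> s \<in> carrier_mat (2 ^ n) (2 ^ n)"
  using S_carrier pauli_group_carrier_mat[of s N] by auto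

lemma smult_one_eq: "u \<cdot>\<^sub>m 1\<^sub>m (2 ^ n) = v \<cdot>\<^sub>m 1\<^sub>m (2 ^ n) \<Longrightarrow> u = (v :: complex)"
  by (drule arg_cong[where f = "\<lambda>M. M $$ (0, 0)"]) simp

text \<open>The square of a Pauli operator is plus or minus the identity, and the minus sign is
  excluded from \<open>S\<close>.\<close>

lemma S_square:
  assumes "s \<in> S"
  shows "s * s = 1\<^sub>m (2 ^ n)"
proof -
  obtain k p where s: "s = \<i> ^ k \<cdot>\<^sub>m P p" using assms S_carrier pauli_group_carrier by blast
  have "s * s = (\<i> ^ k * \<i> ^ k) \<cdot>\<^sub>m 1\<^sub>m (2 ^ n)"
    by (simp add: s smult_pauli_op_mult pauli_op_0)
  moreover have "\<i> ^ k * \<i> ^ k = (- 1) ^ k" by (simp flip: power_mult_distrib)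
  moreover have "(- 1 :: complex) ^ k = 1 \<or> (- 1 :: complex) ^ k = - 1"
    by (cases "even k") auto
  moreover have "(- 1 :: complex) \<cdot>\<^sub>m 1\<^sub>m (2 ^ n) = - 1\<^sub>m (2 ^ n)" by (intro eq_matI) auto
  ultimately show ?thesis using S_mult[OF assms assms] minus_one by auto
qed

lemma S_scalar:
  assumes "\<i> ^ k \<cdot>\<^sub>m 1\<^sub>m (2 ^ n) \<in> S"
  shows "\<i> ^ k = 1"
proof -
  have "(\<i> ^ k * \<i> ^ k) \<cdot>\<^sub>m 1\<^sub>m (2 ^ n) = 1 \<cdot>\<^sub>m 1\<^sub>m (2 ^ n)"
    using S_square[OF assms] by (simp add: mult_smult_assoc_mat[of _ "2 ^ n" "2 ^ n" _ "2 ^ n"]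
        mult_smult_distrib[of _ "2 ^ n" "2 ^ n" _ "2 ^ n"] smult_smult_mat)
  then have "\<i> ^ k * \<i> ^ k = 1" by (rule smult_one_eq)
  then have "\<i> ^ k = 1 \<or> \<i> ^ k = - 1" using square_eq_1_iff by blast
  moreover have "(- 1 :: complex) \<cdot>\<^sub>m 1\<^sub>m (2 ^ n) = - 1\<^sub>m (2 ^ n)" by (intro eq_matI) auto
  ultimately show ?thesis using assms minus_one by auto
qed

lemma n_pos: "n > 0" and card_S: "card S = 2 ^ (n - 1)"
proof -
  obtain G where G: "independent_generators n S G" "card G + 1 = n"
    using code by (auto simp: stabilizer_code_1_def)
  show "n > 0" using G by simp
  have "card (generate (pauli_group N) G) = 2 ^ card G"
    by (rule card_generate_independent[OF group_pauli_group S_subgroup])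
      (use G S_square S_comm in \<open>auto simp: independent_generators_def\<close>)
  then show "card S = 2 ^ (n - 1)" using G by (auto simp: independent_generators_def)
qed

text \<open>A Pauli operator is Hermitian only if its phase is real, whence
  \<open>u * u = 1\<close>.\<close>

lemma Z_pauli:
  obtains u z where "Z = u \<cdot>\<^sub>m P z" "z \<in> labels N" "u * u = 1" "\<exists>k. u = \<i> ^ k"
proof -
  have "Z \<in> carrier (pauli_group N)" using pair by (auto simp: logical_pair_def commutant_def)
  then obtain k z where kz: "Z = \<i> ^ k \<cdot>\<^sub>m P z" "z \<in> labels N" unfolding pauli_group_carrier by blast
  have "cnj (\<i> ^ k) \<cdot>\<^sub>m P z = \<i> ^ k \<cdot>\<^sub>m P z"
    using pair kz adjoint_pauli_op[of N "\<i> ^ k" z] by (simp add: logical_pair_def)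
  then have "cnj (\<i> ^ k) = \<i> ^ k" using smult_pauli_op_eq(1)[of N "cnj (\<i> ^ k)"] by simp
  moreover have "\<i> ^ k * cnj (\<i> ^ k) = 1" by (simp flip: power_mult_distrib)
  ultimately have "\<i> ^ k * \<i> ^ k = 1" by simp
  with kz that show ?thesis by blast
qed

lemma Z_mat: "Z \<in> carrier_mat (2 ^ n) (2 ^ n)"
  using pair pauli_group_carrier_mat[of Z N] by (auto simp: logical_pair_def commutant_def)

lemma Z_square: "Z * Z = 1\<^sub>m (2 ^ n)"
  by (rule Z_pauli) (simp add: smult_pauli_op_mult pauli_op_0)

lemma Z_comm: "s \<in> S \<Longrightarrow> Z * s = s * Z"
  using pair by (auto simp: logical_pair_def commutant_def)

text \<open>This is where \<open>X\<close> enters. Membership outside \<open>S\<close> would still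
  allow Z = -s, but a multiple of \<open>s\<close> commutes with \<open>X\<close>, whereas
  \<open>Z\<close> anticommutes with it and the product is nonzero.\<close>

lemma Z_nontrivial:
  assumes s: "s \<in> S"
  shows "Z \<noteq> \<i> ^ k \<cdot>\<^sub>m s"
proof
  assume Z: "Z = \<i> ^ k \<cdot>\<^sub>m s"
  have X: "X \<in> carrier (pauli_group N)" "X * s = s * X" and anti: "Z * X = - (X * Z)"
    using pair s by (auto simp: logical_pair_def commutant_def)
  have Xm: "X \<in> carrier_mat (2 ^ n) (2 ^ n)" using X(1) pauli_group_carrier_mat[of X N] by simp
  have "Z * X = X * Z"
    using X Xm S_mat[OF s] unfolding Z
    by (simp add: mult_smult_assoc_mat[of _ "2 ^ n" "2 ^ n" _ "2 ^ n"]
        mult_smult_distrib[of _ "2 ^ n" "2 ^ n" _ "2 ^ n"])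
  then have eq: "X * Z = - (X * Z)" using anti by simp
  obtain u z where uz: "Z = u \<cdot>\<^sub>m P z" "u * u = 1" by (rule Z_pauli)
  obtain l p where lp: "X = \<i> ^ l \<cdot>\<^sub>m P p" using X(1) pauli_group_carrier by blast
  define w where "w = \<i> ^ l * u * label_phase N p z"
  have XZ: "X * Z = w \<cdot>\<^sub>m P (p + z)" by (simp add: uz lp w_def smult_pauli_op_mult)
  have "w \<cdot>\<^sub>m P (p + z) = (- w) \<cdot>\<^sub>m P (p + z)"
    proof -
    have "w \<cdot>\<^sub>m P (p + z) = - (w \<cdot>\<^sub>m P (p + z))" using eq unfolding XZ .
    also have "\<dots> = (- w) \<cdot>\<^sub>m P (p + z)" by (intro eq_matI) auto
    finally show ?thesis .
  qed
  moreover have "w \<noteq> 0" using uz(2) by (auto simp: w_def)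
  ultimately show False using smult_pauli_op_eq(1)[of N w _ "- w"] by simp
qed

lemma ext_mult:
  assumes "s \<in> ext" "t \<in> ext"
  shows "s * t \<in> ext"
proof -
  have a: "Z * s * t = Z * (s * t)" if "s \<in> S" "t \<in> S" for s t
    using assoc_mult_mat[OF Z_mat S_mat S_mat] that by blast
  have b: "s * (Z * t) = Z * (s * t)" if "s \<in> S" "t \<in> S" for s t
    using assoc_mult_mat[OF S_mat Z_mat S_mat] Z_comm a that by metis
  have c: "Z * s * (Z * t) = s * t" if "s \<in> S" "t \<in> S" for s t
  proof -
    have "Z * s * (Z * t) = Z * (s * (Z * t))" 
      using assoc_mult_mat[OF Z_mat S_mat[OF that(1)], of "Z * t" "2 ^ n"] Z_mat S_mat[OF that(2)] by simp
    also have "\<dots> = Z * (Z * (s * t))" using b[OF that] by simp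
    also have "\<dots> = Z * Z * (s * t)"
      using assoc_mult_mat[OF Z_mat Z_mat, of "s * t" "2 ^ n"] S_mat[OF S_mult[OF that]] by simp
    finally show ?thesis unfolding Z_square left_mult_one_mat[OF S_mat[OF S_mult[OF that]]] .
  qed
  show ?thesis using assms S_mult unfolding ext_def by (auto simp: a b c)
qed

lemma ext_carrier: "ext \<subseteq> carrier (pauli_group N)"
proof -
  interpret group "pauli_group N" by (rule group_pauli_group) simp
  have "Z \<in> carrier (pauli_group N)" using pair by (auto simp: logical_pair_def commutant_def)
  then show ?thesis using S_carrier m_closed[of Z] by (auto simp: ext_def)
qed

lemma ZZ_cancel:
  assumes "s \<in> S"
  shows "Z * (Z * s) = s"
proof -
  have "Z * (Z * s) = Z * Z * s" using assoc_mult_mat[OF Z_mat Z_mat S_mat[OF assms]] by simp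
  then show ?thesis using Z_square S_mat[OF assms] by simp
qed

text \<open>Multiplying by \<open>s\<close> would make \<open>Z\<close> a phase times an element of
  \<open>S\<close>. With \<open>k = 0\<close> this separates the two cosets in \<open>ext\<close>;
  with \<open>t\<close> the identity it keeps scalars out of the second one.\<close>

lemma ZS_scalar:
  assumes "s \<in> S" "t \<in> S"
  shows "\<i> ^ k \<cdot>\<^sub>m t \<noteq> Z * s"
proof
  assume eq: "\<i> ^ k \<cdot>\<^sub>m t = Z * s"
  have "Z = Z * (s * s)" using S_square[OF assms(1)] Z_mat by simp
  also have "\<dots> = (Z * s) * s" using assoc_mult_mat[OF Z_mat S_mat S_mat] assms by simp
  also have "\<dots> = \<i> ^ k \<cdot>\<^sub>m (t * s)"
    using S_mat assms by (simp flip: eq add: mult_smult_assoc_mat[of _ "2 ^ n" "2 ^ n" _ "2 ^ n"])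
  finally show False using Z_nontrivial[OF S_mult[OF assms(2,1)]] by blast
qed

lemma card_ext: "card ext = 2 ^ n"
proof -
  have "inj_on ((*) Z) S" by (rule inj_on_inverseI[of _ "(*) Z"]) (simp add: ZZ_cancel)
  then have 1: "card ((*) Z ` S) = card S" by (rule card_image)
  have "S \<inter> (*) Z ` S = {}" using ZS_scalar[of _ _ 0] by auto
  moreover have "finite S" using card_S by (metis card.infinite power_not_zero zero_neq_numeral)
  ultimately have "card ext = card S + card S"
    unfolding ext_def using 1 by (subst card_Un_disjoint) auto
  also have "\<dots> = 2 ^ n" using card_S n_pos by (cases n) auto
  finally show ?thesis .
qed

lemma ext_scalar:
  assumes "\<i> ^ k \<cdot>\<^sub>m 1\<^sub>m (2 ^ card N) \<in> ext"
  shows "\<i> ^ k = 1"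
  using assms S_scalar ZS_scalar[OF _ S_one, of _ k] by (auto simp: ext_def)

section \<open>Labels of the stabilizer group and of its extension by the logical Z\<close>

definition zl :: "nat \<Rightarrow> pauli" where
  "zl = (SOME z. z \<in> labels N \<and> (\<exists>k. Z = \<i> ^ k \<cdot>\<^sub>m P z))"

lemma zl: "zl \<in> labels N" "\<exists>k. Z = \<i> ^ k \<cdot>\<^sub>m P zl"
proof -
  have "\<exists>z. z \<in> labels N \<and> (\<exists>k. Z = \<i> ^ k \<cdot>\<^sub>m P z)" by (rule Z_pauli) blast
  from someI_ex[OF this] show "zl \<in> labels N" "\<exists>k. Z = \<i> ^ k \<cdot>\<^sub>m P zl" by (auto simp: zl_def)
qed

text \<open>Fixed once by choice, so that the extended group becomes an instance of
  \<open>signed_labels\<close> for the whole locale.\<close>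

definition ph :: "(nat \<Rightarrow> pauli) \<Rightarrow> complex" where
  "ph = (SOME f. signed_labels N L' f \<and> bij_betw (\<lambda>p. f p \<cdot>\<^sub>m P p) L' ext)"

lemma ph: "signed_labels N L' ph" "bij_betw (\<lambda>p. ph p \<cdot>\<^sub>m P p) L' ext"
proof -
  have "\<exists>f. signed_labels N L' f \<and> bij_betw (\<lambda>p. f p \<cdot>\<^sub>m P p) L' ext"
    unfolding L'_def
    by (rule signed_labels_of_group[of N ext])
      (use ext_carrier ext_mult ext_scalar S_one in \<open>auto simp: ext_def\<close>)
  from someI_ex[OF this] show "signed_labels N L' ph" "bij_betw (\<lambda>p. ph p \<cdot>\<^sub>m P p) L' ext"
    by (auto simp: ph_def)
qed

sublocale signed_labels N L' ph by (rule ph)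

lemma card_L': "card L' = 2 ^ n"
  using bij_betw_same_card[OF ph(2)] card_ext by simp

lemma card_L: "card L = 2 ^ (n - 1)" and L_closed: "add_closed L"
proof -
  obtain f where f: "signed_labels N L f" "bij_betw (\<lambda>p. f p \<cdot>\<^sub>m P p) L S"
    unfolding L_def
    by (rule signed_labels_of_group[of N S]) (use S_carrier S_mult S_scalar S_one in auto)
  show "card L = 2 ^ (n - 1)" using bij_betw_same_card[OF f(2)] card_S by simp
  show "add_closed L" using signed_labels.F_closed[OF f(1)] .
qed

lemma L_sub: "L \<subseteq> L'"
  by (auto simp: L_def L'_def ext_def label_set_def)

lemma finite_L: "finite L"
  using L_sub finite_F finite_subset by blast

text \<open>In \<open>ext\<close> a label occurs with only one phase, so the element of
  \<open>S\<close> with label \<open>r\<close> must be the one that \<open>ph\<close> selects from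
  the larger group.\<close>

lemma ph_in_S:
  assumes "r \<in> L"
  shows "ph r \<cdot>\<^sub>m P r \<in> S"
proof -
  obtain k where k: "\<i> ^ k \<cdot>\<^sub>m P r \<in> S" "r \<in> labels N" using assms by (auto simp: L_def label_set_def)
  then have "\<i> ^ k \<cdot>\<^sub>m P r \<in> (\<lambda>p. ph p \<cdot>\<^sub>m P p) ` L'"
    using ph(2) by (auto simp: bij_betw_def ext_def)
  then obtain p where p: "p \<in> L'" "\<i> ^ k \<cdot>\<^sub>m P r = ph p \<cdot>\<^sub>m P p" by blast
  then have "r q = p q" if "q \<in> N" for q using smult_pauli_op_eq(2)[OF _ p(2)] that by simp
  then have "r = p" using p(1) F_labels k(2) by (intro labels_eqI) auto
  then show ?thesis using p k by simp
qed

lemma ph_in_ZS: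
  assumes "r \<in> L' - L"
  shows "ph r \<cdot>\<^sub>m P r \<in> (*) Z ` S"
proof -
  have "ph r \<cdot>\<^sub>m P r \<in> ext" using assms ph(2) by (auto simp: bij_betw_def)
  moreover have "ph r \<cdot>\<^sub>m P r \<notin> S"
  proof
    assume r: "ph r \<cdot>\<^sub>m P r \<in> S"
    have "\<exists>k. ph r = \<i> ^ k"
      using ph_cases[of r] assms by (metis DiffD1 power2_i power_0)
    then have "r \<in> L" using r assms F_labels by (auto simp: L_def label_set_def)
    then show False using assms by simp
  qed
  ultimately show ?thesis by (simp add: ext_def)
qed

lemma zl_notin: "zl \<notin> L"
proof
  assume "zl \<in> L"
  then obtain k where k: "\<i> ^ k \<cdot>\<^sub>m P zl \<in> S" by (auto simp: L_def label_set_def)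
  obtain l where l: "Z = \<i> ^ l \<cdot>\<^sub>m P zl" using zl(2) by blast
  have "\<i> ^ (l + 3 * k) * \<i> ^ k = \<i> ^ l * (\<i> ^ k * \<i> ^ (3 * k))"
    by (simp add: power_add)
  also have "\<dots> = \<i> ^ l" using i_power_inverse[of k] by simp
  finally have phase: "\<i> ^ (l + 3 * k) * \<i> ^ k = \<i> ^ l" .
  have "Z = \<i> ^ (l + 3 * k) \<cdot>\<^sub>m (\<i> ^ k \<cdot>\<^sub>m P zl)"
    unfolding smult_smult_mat phase by (rule l)
  then show False using Z_nontrivial[OF k] by blast
qed

lemma zl_L': "zl \<in> L'"
proof -
  have "Z = Z * 1\<^sub>m (2 ^ n)" using Z_mat by simp
  then have "Z \<in> ext" using S_one unfolding ext_def by blast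
  moreover obtain k where "Z = \<i> ^ k \<cdot>\<^sub>m P zl" using zl(2) by blast
  ultimately have "\<i> ^ k \<cdot>\<^sub>m P zl \<in> ext" by argo
  then show ?thesis using zl(1) unfolding L'_def label_set_def by blast
qed

text \<open>The two translates are disjoint subsets of \<open>L'\<close>, and their sizes add up to
  2^n.\<close>

lemma L'_eq: "L' = L \<union> (+) zl ` L" and L'_disj: "L \<inter> (+) zl ` L = {}"
proof -
  have "zl + r \<notin> L" if "r \<in> L" for r
  proof
    assume "zl + r \<in> L"
    then have "(zl + r) + r \<in> L" using that L_closed unfolding add_closed_def by blast
    then show False using zl_notin by (simp add: add.assoc)
  qed
  then show disj: "L \<inter> (+) zl ` L = {}" by auto
  have sub: "L \<union> (+) zl ` L \<subseteq> L'"
    using L_sub zl_L' F_closed by (auto simp: add_closed_def)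
  have "card (L \<union> (+) zl ` L) = card L + card L"
    using disj finite_L by (subst card_Un_disjoint) (auto simp: card_image inj_on_def)
  also have "\<dots> = card L'" using card_L card_L' n_pos by (cases n) auto
  finally show "L' = L \<union> (+) zl ` L" using sub finite_F by (metis card_subset_eq)
qed

end

section \<open>Marginals of a pure state\<close>

lemma partial_trace_pure:
  assumes "finite Q" "B \<subseteq> Q" "v \<in> carrier_vec (2 ^ card Q)"
  shows "partial_trace Q B (pure_density v)
    = op_on B (\<lambda>x y. \<Sum>z\<in>Pow (Q - B). amplitude Q v (x \<union> z) * cnj (amplitude Q v (y \<union> z)))"
  unfolding partial_trace_def
proof (intro op_on_cong sum.cong refl)
  fix x y z assume "x \<subseteq> B" "y \<subseteq> B" "z \<in> Pow (Q - B)"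
  then have "x \<union> z \<subseteq> Q" "y \<union> z \<subseteq> Q" using assms(2) by auto
  then show "entry Q (pure_density v) (x \<union> z) (y \<union> z) = amplitude Q v (x \<union> z) * cnj (amplitude Q v (y \<union> z))"
    using assms by (simp add: entry_def pure_density_def amplitude_def basis_index_less)
qed

text \<open>The Schmidt argument without a Schmidt decomposition: arranged as a matrix
  \<open>W\<close> indexed by the two parts, the amplitudes give one marginal as
  \<open>W * V\<close>, with \<open>V\<close> the adjoint of \<open>W\<close>, and the other as the
  transpose of \<open>V * W\<close>.\<close>

lemma vn_entropy_complement:
  assumes Q: "finite Q" "B \<subseteq> Q" and v: "v \<in> carrier_vec (2 ^ card Q)"
    and tl: "two_level (partial_trace Q B (pure_density v)) (2 ^ card B) p q c"
  shows "vn_entropy (partial_trace Q (Q - B) (pure_density v)) = two_entropy p q - log 2 c"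
proof -
  define B' where "B' = Q - B"
  have fin: "finite B" "finite B'" using Q finite_subset by (auto simp: B'_def)
  have QB': "Q - B' = B" using Q by (auto simp: B'_def)
  define w where "w = (\<lambda>i j. amplitude Q v (basis_label B i \<union> basis_label B' j))"
  define W where "W = mat (2 ^ card B) (2 ^ card B') (\<lambda>(i, j). w i j)"
  define V where "V = mat (2 ^ card B') (2 ^ card B) (\<lambda>(j, i). cnj (w i j))"
  have W: "W \<in> carrier_mat (2 ^ card B) (2 ^ card B')" and V: "V \<in> carrier_mat (2 ^ card B') (2 ^ card B)"
    by (simp_all add: W_def V_def)
  have "partial_trace Q B (pure_density v) = W * V"
    unfolding partial_trace_pure[OF Q v] B'_def[symmetric]
    by (intro eq_matI)
      (simp_all add: op_on_def W_def V_def w_def scalar_prod_def lessThan_atLeast0[symmetric]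
        sum_basis_label[OF fin(2), symmetric])
  \<comment> \<open>The conjugate falls on the column index of the marginal but on the row index of
    \<open>V * W\<close>; transposition leaves the characteristic polynomial unchanged.\<close>
  moreover have "partial_trace Q B' (pure_density v) = transpose_mat (V * W)"
  proof -
    have "partial_trace Q B' (pure_density v)
        = op_on B' (\<lambda>x y. \<Sum>z\<in>Pow B. amplitude Q v (z \<union> x) * cnj (amplitude Q v (z \<union> y)))"
      using partial_trace_pure[OF Q(1) _ v, of B'] unfolding QB' by (simp add: B'_def Un_commute)
    then show ?thesis
      by (intro eq_matI)
        (simp_all add: op_on_def W_def V_def w_def scalar_prod_def lessThan_atLeast0[symmetric]
          sum_basis_label[OF fin(1), symmetric] mult.commute)
  qed
  moreover have "vn_entropy (transpose_mat M) = vn_entropy M" if "M \<in> carrier_mat m m" for M m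
    using char_poly_transpose_mat[OF that] by (simp add: vn_entropy_def)
  moreover have "V * W \<in> carrier_mat (2 ^ card B') (2 ^ card B')" using V W by simp
  ultimately show ?thesis
    using vn_entropy_two_level_comm[OF W V] tl by (simp flip: B'_def)
qed

lemma translate_eq: "(+) r ` M = {t. r + t \<in> M}" for M :: "('a \<Rightarrow> pauli) set"
proof
  show "{t. r + t \<in> M} \<subseteq> (+) r ` M"
  proof clarify
    fix t assume "r + t \<in> M"
    moreover have "t = r + (r + t)" by simp
    ultimately show "t \<in> (+) r ` M" by blast
  qed
qed auto

lemma labels_add_iff: "r \<in> labels B \<Longrightarrow> r + t \<in> labels B \<longleftrightarrow> t \<in> labels B"
  by (auto simp: labels_def)

context qubit_code
begin

text \<open>The labels of the coset \<open>Z S\<close>.\<close>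

definition Lc :: "(nat \<Rightarrow> pauli) set" where "Lc = L' - L"

lemma L'_add_iff: "r \<in> L' \<Longrightarrow> r + t \<in> L' \<longleftrightarrow> t \<in> L'"
  using F_closed unfolding add_closed_def by (metis pauli_fun_add_cancel)

lemma L_add_iff1: "r \<in> L \<Longrightarrow> r + t \<in> L \<longleftrightarrow> t \<in> L"
  using L_closed unfolding add_closed_def by (metis pauli_fun_add_cancel)

lemma Lc_eq: "Lc = (+) zl ` L"
  using L'_eq L'_disj by (auto simp: Lc_def)

lemma L_add_iff2:
  assumes r: "r \<in> Lc" and t: "t \<in> L'"
  shows "r + t \<in> L \<longleftrightarrow> t \<notin> L"
proof -
  obtain r' where r': "r' \<in> L" "r = zl + r'" using r Lc_eq by blast
  show ?thesis
  proof
    assume "t \<notin> L"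
    then obtain t' where "t' \<in> L" "t = zl + t'" using t L'_eq by blast
    then have "r + t = r' + t'" using r'(2) by (simp add: add.assoc add.left_commute)
    then show "r + t \<in> L" using r'(1) \<open>t' \<in> L\<close> L_add_iff1 by simp
  next
    assume "r + t \<in> L"
    show "t \<notin> L"
    proof
      assume "t \<in> L"
      then have "r \<in> L" using \<open>r + t \<in> L\<close> L_add_iff1[of t r] by (simp add: add.commute)
      then show False using r by (simp add: Lc_def)
    qed
  qed
qed

text \<open>The multiplication table of \<open>L'\<close> modulo \<open>L\<close>, cut down to
  \<open>labels B\<close>: the translation hypotheses that \<open>kern_mult\<close> asks
  for.\<close>

lemma translate_L:
  "r \<in> L \<inter> labels B \<Longrightarrow> (+) r ` (L \<inter> labels B) = L \<inter> labels B"
  "r \<in> L \<inter> labels B \<Longrightarrow> (+) r ` (Lc \<inter> labels B) = Lc \<inter> labels B"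
  "r \<in> Lc \<inter> labels B \<Longrightarrow> (+) r ` (L \<inter> labels B) = Lc \<inter> labels B"
  "r \<in> Lc \<inter> labels B \<Longrightarrow> (+) r ` (Lc \<inter> labels B) = L \<inter> labels B"
  unfolding translate_eq
  using L_sub by (auto simp: labels_add_iff L_add_iff1 L'_add_iff L_add_iff2 Lc_def)

lemma card_Lc:
  assumes "Lc \<inter> labels B \<noteq> {}"
  shows "card (Lc \<inter> labels B) = card (L \<inter> labels B)"
proof -
  obtain r where "r \<in> Lc \<inter> labels B" using assms by blast
  then have "Lc \<inter> labels B = (+) r ` (L \<inter> labels B)" using translate_L(3) by simp
  then show ?thesis by (simp add: card_image inj_on_def)
qed

text \<open>The second factor is 2^z_B in the notation of the overview.\<close>

lemma card_L'_labels:
  "card (L' \<inter> labels B) = card (L \<inter> labels B) * (if Lc \<inter> labels B = {} then 1 else 2)"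
proof -
  have fin: "finite L" "finite Lc" using finite_L finite_F by (auto simp: Lc_def)
  have "L' \<inter> labels B = (L \<inter> labels B) \<union> (Lc \<inter> labels B)" using L_sub by (auto simp: Lc_def)
  moreover have "(L \<inter> labels B) \<inter> (Lc \<inter> labels B) = {}" by (auto simp: Lc_def)
  ultimately have "card (L' \<inter> labels B) = card (L \<inter> labels B) + card (Lc \<inter> labels B)"
    using fin by (simp add: card_Un_disjoint)
  then show ?thesis using card_Lc[of B] by auto
qed

section \<open>Amplitudes of the logical basis states\<close>

definition f0 :: "nat set \<Rightarrow> complex" where "f0 = amplitude N \<psi>\<^sub>0"
definition f1 :: "nat set \<Rightarrow> complex" where "f1 = amplitude N \<psi>\<^sub>1"

lemma psi_carrier: "\<psi>\<^sub>0 \<in> carrier_vec (2 ^ n)" "\<psi>\<^sub>1 \<in> carrier_vec (2 ^ n)"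
  using basis by (auto simp: logical_basis_def codespace_def)

lemma psi_S: "s \<in> S \<Longrightarrow> s *\<^sub>v \<psi>\<^sub>0 = \<psi>\<^sub>0" "s \<in> S \<Longrightarrow> s *\<^sub>v \<psi>\<^sub>1 = \<psi>\<^sub>1"
  using basis by (auto simp: logical_basis_def codespace_def)

lemma psi_ZS:
  assumes "t \<in> (*) Z ` S"
  shows "t *\<^sub>v \<psi>\<^sub>0 = \<psi>\<^sub>0" "t *\<^sub>v \<psi>\<^sub>1 = - \<psi>\<^sub>1"
proof -
  obtain s where s: "s \<in> S" "t = Z * s" using assms by blast
  have "(Z * s) *\<^sub>v v = Z *\<^sub>v (s *\<^sub>v v)" if "v \<in> carrier_vec (2 ^ n)" for v
    using assoc_mult_mat_vec[OF Z_mat S_mat[OF s(1)] that] .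
  then show "t *\<^sub>v \<psi>\<^sub>0 = \<psi>\<^sub>0" "t *\<^sub>v \<psi>\<^sub>1 = - \<psi>\<^sub>1"
    using psi_carrier psi_S[OF s(1)] basis s(2) by (simp_all add: logical_basis_def)
qed

lemma amplitude_pauli:
  assumes "v \<in> carrier_vec (2 ^ n)" "x \<subseteq> N"
  shows "amplitude N ((u \<cdot>\<^sub>m P r) *\<^sub>v v) x = (\<Sum>y\<in>Pow N. u * pauli_kernel N r x y * amplitude N v y)"
  unfolding pauli_op_kernel op_on_smult using assms by (intro amplitude_op_on_mult) auto

lemma f0_stab:
  assumes "r \<in> L'" "x \<subseteq> N"
  shows "(\<Sum>y\<in>Pow N. ph r * pauli_kernel N r x y * f0 y) = f0 x"
proof -
  have "(ph r \<cdot>\<^sub>m P r) *\<^sub>v \<psi>\<^sub>0 = \<psi>\<^sub>0"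
    using ph_in_S[of r] ph_in_ZS[of r] psi_S(1) psi_ZS(1) assms(1) by blast
  then show ?thesis using amplitude_pauli[OF psi_carrier(1) assms(2), of "ph r" r] by (simp add: f0_def)
qed

lemma f1_stab:
  assumes "r \<in> L'" "x \<subseteq> N"
  shows "(\<Sum>y\<in>Pow N. ph r * pauli_kernel N r x y * f1 y) = (if r \<in> L then f1 x else - f1 x)"
proof -
  have "(ph r \<cdot>\<^sub>m P r) *\<^sub>v \<psi>\<^sub>1 = (if r \<in> L then \<psi>\<^sub>1 else - \<psi>\<^sub>1)"
    using ph_in_S[of r] ph_in_ZS[of r] psi_S(2) psi_ZS(2) assms(1) by auto
  moreover have "amplitude N (- \<psi>\<^sub>1) x = - f1 x"
    using psi_carrier(2) assms(2) by (simp add: amplitude_def f1_def basis_index_less[of N x, simplified])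
  ultimately show ?thesis
    using amplitude_pauli[OF psi_carrier(2) assms(2), of "ph r" r] by (auto simp: f1_def)
qed

lemma f_unit: "(\<Sum>x\<in>Pow N. f0 x * cnj (f0 x)) = 1" "(\<Sum>x\<in>Pow N. f1 x * cnj (f1 x)) = 1"
  using basis inner_prod_amplitude[of N] psi_carrier
  by (simp_all add: logical_basis_def f0_def f1_def)

lemma kern_L': "kern B (L' \<inter> M) x y = kern B (L \<inter> M) x y + kern B (Lc \<inter> M) x y"
proof -
  have "L' \<inter> M = (L \<inter> M) \<union> (Lc \<inter> M)" using L_sub by (auto simp: Lc_def)
  moreover have "(L \<inter> M) \<inter> (Lc \<inter> M) = {}" by (auto simp: Lc_def)
  ultimately show ?thesis
    using finite_L finite_F by (simp add: kern_def sum.union_disjoint Lc_def)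
qed

lemma f0_pure:
  assumes "x \<subseteq> N" "y \<subseteq> N"
  shows "f0 x * cnj (f0 y) = (kern N L x y + kern N Lc x y) / 2 ^ n"
  using pure_state_kern[OF _ f0_stab f_unit(1) assms] card_L' kern_L'[of N UNIV] by simp

text \<open>Flipping the phases on the coset of \<open>Z\<close> describes the group generated by
  \<open>S\<close> and -Z, the stabilizer of \<open>\<psi>\<^sub>1\<close>. The sign is
  multiplicative because \<open>L\<close> has index 2 in \<open>L'\<close>.\<close>

lemma twisted: "signed_labels N L' (\<lambda>r. if r \<in> L then ph r else - ph r)"
proof
  fix p r assume pr: "p \<in> L'" "r \<in> L'"
  have "p + r \<in> L \<longleftrightarrow> (p \<in> L \<longleftrightarrow> r \<in> L)"
    using L_add_iff1[of p r] L_add_iff2[OF _ pr(2), of p] pr by (auto simp: Lc_def)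
  then show "(if p \<in> L then ph p else - ph p) * (if r \<in> L then ph r else - ph r) * label_phase N p r
      = (if p + r \<in> L then ph (p + r) else - ph (p + r))"
    using ph_add[OF pr] by auto
qed (use F_closed F_labels ph_0 L_closed in \<open>auto simp: add_closed_def\<close>)

lemma f1_pure:
  assumes "x \<subseteq> N" "y \<subseteq> N"
  shows "f1 x * cnj (f1 y) = (kern N L x y - kern N Lc x y) / 2 ^ n"
proof -
  let ?ph = "\<lambda>r. if r \<in> L then ph r else - ph r"
  interpret tw: signed_labels N L' ?ph by (rule twisted)
  have "(\<Sum>y\<in>Pow N. ?ph r * pauli_kernel N r x y * f1 y) = f1 x" if "r \<in> L'" "x \<subseteq> N" for r x
    using f1_stab[OF that] by (auto simp: sum_negf)
  then have "f1 x * cnj (f1 y) = tw.kern N L' x y / 2 ^ n"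
    using tw.pure_state_kern[OF _ _ f_unit(2) assms] card_L' by simp
  also have "tw.kern N L' x y = kern N L x y - kern N Lc x y"
  proof -
    have "L' = L \<union> Lc" "L \<inter> Lc = {}" using L_sub by (auto simp: Lc_def)
    moreover have "finite L" "finite Lc" using finite_L finite_F by (auto simp: Lc_def)
    ultimately have "tw.kern N L' x y = (\<Sum>r\<in>L. ?ph r * pauli_kernel N r x y) + (\<Sum>r\<in>Lc. ?ph r * pauli_kernel N r x y)"
      by (simp add: tw.kern_def sum.union_disjoint)
    moreover have "(\<Sum>r\<in>Lc. ?ph r * pauli_kernel N r x y) = (\<Sum>r\<in>Lc. - (ph r * pauli_kernel N r x y))"
      by (intro sum.cong) (auto simp: Lc_def)
    ultimately show ?thesis by (simp add: kern_def sum_negf)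
  qed
  finally show ?thesis .
qed

text \<open>The projection onto the second state is a multiple of the sum over \<open>L\<close>
  minus the sum over \<open>Lc\<close>. Both sums multiply \<open>f0\<close> by the same
  cardinality, so the projection annihilates it; some \<open>f1 x\<close> is nonzero and can be
  cancelled.\<close>

lemma f_orthogonal: "(\<Sum>y\<in>Pow N. f0 y * cnj (f1 y)) = 0"
proof -
  have "f1 x * (\<Sum>y\<in>Pow N. f0 y * cnj (f1 y)) = 0" if x: "x \<subseteq> N" for x
  proof -
    have k: "(\<Sum>y\<in>Pow N. kern N M x y * f0 y) = of_nat (card M) * f0 x" if "M \<subseteq> L'" for M
    proof -
      have "(\<Sum>y\<in>Pow N. kern N M x y * f0 y) = (\<Sum>r\<in>M. \<Sum>y\<in>Pow N. ph r * pauli_kernel N r x y * f0 y)"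
        unfolding kern_def sum_distrib_right by (rule sum.swap)
      also have "\<dots> = (\<Sum>r\<in>M. f0 x)"
        using that x by (intro sum.cong refl f0_stab) auto
      finally show ?thesis by simp
    qed
    have "card Lc = card L" unfolding Lc_eq by (simp add: card_image inj_on_def)
    then have "(\<Sum>y\<in>Pow N. (kern N L x y - kern N Lc x y) * f0 y) = 0"
      using k[of L] k[of Lc] L_sub by (simp add: Lc_def left_diff_distrib sum_subtractf)
    moreover have "f1 x * (\<Sum>y\<in>Pow N. f0 y * cnj (f1 y))
        = (\<Sum>y\<in>Pow N. (kern N L x y - kern N Lc x y) * f0 y) / 2 ^ n"
    proof -
      have "f1 x * (\<Sum>y\<in>Pow N. f0 y * cnj (f1 y)) = (\<Sum>y\<in>Pow N. f1 x * cnj (f1 y) * f0 y)"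
        by (simp add: sum_distrib_left ac_simps)
      also have "\<dots> = (\<Sum>y\<in>Pow N. (kern N L x y - kern N Lc x y) / 2 ^ n * f0 y)"
        using f1_pure[OF x] by (intro sum.cong refl) auto
      finally show ?thesis by (simp add: sum_divide_distrib)
    qed
    ultimately show ?thesis by simp
  qed
  moreover have "\<exists>x\<subseteq>N. f1 x \<noteq> 0"
  proof (rule ccontr)
    assume "\<not> (\<exists>x\<subseteq>N. f1 x \<noteq> 0)"
    then have "(\<Sum>x\<in>Pow N. f1 x * cnj (f1 x)) = 0" by (intro sum.neutral) auto
    then show False using f_unit(2) by simp
  qed
  ultimately show ?thesis by auto
qed

end

section \<open>Reduced states\<close>

lemma amplitude_tensor_ket:
  assumes "finite Q" "finite R" "x \<subseteq> Q \<union> R"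
  shows "amplitude (Q \<union> R) (tensor_ket Q R u v) x = amplitude Q u (x \<inter> Q) * amplitude R v (x \<inter> R)"
  using assms by (simp add: tensor_ket_def)

lemma amplitude_add_smult:
  assumes "finite Q" "u \<in> carrier_vec (2 ^ card Q)" "v \<in> carrier_vec (2 ^ card Q)" "x \<subseteq> Q"
  shows "amplitude Q (a \<cdot>\<^sub>v u + b \<cdot>\<^sub>v v) x = a * amplitude Q u x + b * amplitude Q v x"
  using assms basis_index_less[of Q x] by (simp add: amplitude_def)

lemma tensor_ket_carrier: "tensor_ket Q R u v \<in> carrier_vec (2 ^ card (Q \<union> R))"
  by (simp add: tensor_ket_def ket_on_def)

context qubit_code
begin

context
  fixes \<alpha> \<beta> :: complex
begin

abbreviation (input) "\<Psi> \<equiv> encoded_state n \<alpha> \<beta> \<psi>\<^sub>0 \<psi>\<^sub>1"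
abbreviation (input) "pa \<equiv> (cmod \<alpha>)\<^sup>2"
abbreviation (input) "pb \<equiv> (cmod \<beta>)\<^sup>2"

lemma register_split: "{0} \<union> N = {0..n}" "insert 0 N = {0..n}"
  by auto

lemma encoded_carrier: "\<Psi> \<in> carrier_vec (2 ^ card {0..n})"
  by (simp only: encoded_state_def tensor_ket_def ket_on_def register_split vec_carrier
      add_carrier_vec smult_carrier_vec)

lemma amplitude_encoded:
  assumes "x \<subseteq> N"
  shows "amplitude {0..n} \<Psi> x = \<alpha> * f0 x" "amplitude {0..n} \<Psi> (insert 0 x) = \<beta> * f1 x"
proof -
  have amp_sum: "amplitude {0..n} \<Psi> x = \<alpha> * (amplitude {0} (unit_vec 2 0) (x \<inter> {0}) * f0 (x \<inter> N))
      + \<beta> * (amplitude {0} (unit_vec 2 1) (x \<inter> {0}) * f1 (x \<inter> N))" if "x \<subseteq> {0..n}" for x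
    unfolding encoded_state_def f0_def f1_def
    using that amplitude_tensor_ket[of "{0}" N x] tensor_ket_carrier[of "{0}" N]
    unfolding register_split by (subst amplitude_add_smult) simp_all
  have 0: "basis_index {0} {} = 0" "basis_index {0} {0} = 1"
    by (simp_all add: basis_index_def)
  have x: "x \<inter> {0} = {}" "x \<inter> N = x" "insert 0 x \<inter> {0} = {0}" "insert 0 x \<inter> N = x" "x \<subseteq> {0..n}" "insert 0 x \<subseteq> {0..n}"
    using assms by auto
  show "amplitude {0..n} \<Psi> x = \<alpha> * f0 x" "amplitude {0..n} \<Psi> (insert 0 x) = \<beta> * f1 x"
    unfolding amp_sum[OF x(5)] amp_sum[OF x(6)] x amplitude_def[of "{0}"] 0 by simp_all
qed

text \<open>The two logical projections share the terms from \<open>L\<close> and have opposite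
  signs on \<open>Lc\<close>, so mixing them with weights \<open>pa\<close> and \<open>pb\<close>
  leaves the coefficients 1 and \<open>pa - pb\<close>.\<close>

lemma reduced_state_physical:
  assumes norm: "pa + pb = 1" and B: "B \<subseteq> N"
  shows "reduced_state n \<Psi> B = op_on B (\<lambda>x y.
    (kern B (L \<inter> labels B) x y + of_real (pa - pb) * kern B (Lc \<inter> labels B) x y) / 2 ^ card B)"
proof -
  have B': "B \<subseteq> {0..n}" "{0..n} - B = insert 0 (N - B)" using B by auto
  have cmod_sq: "c * cnj c = of_real ((cmod c)\<^sup>2)" for c
    by (simp only: complex_norm_square)
  have cardB: "2 ^ n = (2 ^ card B * 2 ^ card (N - B) :: complex)"
  proof -
    have "card N = card B + card (N - B)"
      using B by (metis card_Diff_subset card_mono finite_atLeastAtMost finite_subset le_add_diff_inverse)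
    then have "(2 :: complex) ^ card N = 2 ^ (card B + card (N - B))" by (rule arg_cong)
    then show ?thesis by (simp only: card_N power_add)
  qed
  show ?thesis
    unfolding reduced_state_def
    unfolding partial_trace_pure[OF finite_atLeastAtMost B'(1) encoded_carrier] B'(2)
  proof (intro op_on_cong)
    fix x y assume xy: "x \<subseteq> B" "y \<subseteq> B"
    have "(\<Sum>z\<in>Pow (insert 0 (N - B)). amplitude {0..n} \<Psi> (x \<union> z) * cnj (amplitude {0..n} \<Psi> (y \<union> z)))
      = (\<Sum>z\<in>Pow (N - B). of_real pa * ((kern N L (x \<union> z) (y \<union> z) + kern N Lc (x \<union> z) (y \<union> z)) / 2 ^ n)
          + of_real pb * ((kern N L (x \<union> z) (y \<union> z) - kern N Lc (x \<union> z) (y \<union> z)) / 2 ^ n))"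
    \<comment> \<open>The qubit \<open>T\<close> has label 0 and is traced out too; its two values
      contribute one logical state each.\<close>
    proof (subst sum_Pow_insert, simp, simp, intro sum.cong refl)
      fix z assume "z \<in> Pow (N - B)"
      then have xyz: "x \<union> z \<subseteq> N" "y \<union> z \<subseteq> N" "x \<union> insert 0 z = insert 0 (x \<union> z)" "y \<union> insert 0 z = insert 0 (y \<union> z)"
        using xy B by auto
      show "amplitude {0..n} \<Psi> (x \<union> z) * cnj (amplitude {0..n} \<Psi> (y \<union> z)) +
          amplitude {0..n} \<Psi> (x \<union> insert 0 z) * cnj (amplitude {0..n} \<Psi> (y \<union> insert 0 z)) =
          of_real pa * ((kern N L (x \<union> z) (y \<union> z) + kern N Lc (x \<union> z) (y \<union> z)) / 2 ^ n) +
          of_real pb * ((kern N L (x \<union> z) (y \<union> z) - kern N Lc (x \<union> z) (y \<union> z)) / 2 ^ n)"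
        unfolding xyz(3,4) amplitude_encoded[OF xyz(1)] amplitude_encoded[OF xyz(2)]
          f0_pure[OF xyz(1,2), symmetric] f1_pure[OF xyz(1,2), symmetric] cmod_sq[symmetric]
        by (simp add: ac_simps)
    qed
    also have "\<dots> = (\<Sum>z\<in>Pow (N - B). (of_real (pa + pb) * kern N L (x \<union> z) (y \<union> z)
        + of_real (pa - pb) * kern N Lc (x \<union> z) (y \<union> z)) / 2 ^ n)"
      by (intro sum.cong refl) (simp add: add_divide_distrib diff_divide_distrib algebra_simps)
    also have "\<dots> = ((\<Sum>z\<in>Pow (N - B). kern N L (x \<union> z) (y \<union> z))
        + of_real (pa - pb) * (\<Sum>z\<in>Pow (N - B). kern N Lc (x \<union> z) (y \<union> z))) / 2 ^ n"
      unfolding norm by (simp add: sum.distrib sum_distrib_left flip: sum_divide_distrib)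
    also have "\<dots> = (kern B (L \<inter> labels B) x y + of_real (pa - pb) * kern B (Lc \<inter> labels B) x y) / 2 ^ card B"
      using kern_partial[OF B xy L_sub] kern_partial[OF B xy, of Lc] unfolding cardB
      by (simp add: Lc_def field_simps)
    finally show "(\<Sum>z\<in>Pow (insert 0 (N - B)). amplitude {0..n} \<Psi> (x \<union> z) * cnj (amplitude {0..n} \<Psi> (y \<union> z)))
      = (kern B (L \<inter> labels B) x y + of_real (pa - pb) * kern B (Lc \<inter> labels B) x y) / 2 ^ card B" .
  qed
qed

text \<open>Orthogonality of the logical states removes the off-diagonal entries. What remains is
  diagonal with entries \<open>pa\<close> and \<open>pb\<close>, one of each, hence
  \<open>c = 1\<close>.\<close>

lemma two_level_T:
  assumes norm: "pa + pb = 1"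
  shows "two_level (reduced_state n \<Psi> {0}) (2 ^ card {0 :: nat}) pa pb 1"
proof -
  define g :: "nat set \<Rightarrow> nat set \<Rightarrow> complex" where
    "g = (\<lambda>x y. if x = y then (if 0 \<in> x then of_real pb else of_real pa) else 0)"
  have cmod_sq: "c * cnj c = of_real ((cmod c)\<^sup>2)" for c
    by (simp only: complex_norm_square)
  have N: "{0} \<subseteq> {0..n}" "{0..n} - {0} = N" by auto
  have conj0: "(\<Sum>y\<in>Pow N. f1 y * cnj (f0 y)) = 0"
  proof -
    have "(\<Sum>y\<in>Pow N. f1 y * cnj (f0 y)) = cnj (\<Sum>y\<in>Pow N. f0 y * cnj (f1 y))"
      by (simp add: mult.commute)
    then show ?thesis by (simp only: f_orthogonal complex_cnj_zero)
  qed
  have scale: "(\<Sum>z\<in>Pow N. a * u z * cnj (b * v z)) = a * cnj b * (\<Sum>z\<in>Pow N. u z * cnj (v z))" for a b u v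
    by (simp add: sum_distrib_left ac_simps)
  have rho: "reduced_state n \<Psi> {0} = op_on {0} g"
    unfolding reduced_state_def
    unfolding partial_trace_pure[OF finite_atLeastAtMost N(1) encoded_carrier] N(2)
  proof (intro op_on_cong)
    fix x y :: "nat set" assume "x \<subseteq> {0}" "y \<subseteq> {0}"
    then have xy: "x = {} \<or> x = {0}" "y = {} \<or> y = {0}" by auto
    define w where "w = (\<lambda>x. if 0 \<in> (x :: nat set) then \<beta> else \<alpha>)"
    define f where "f = (\<lambda>x. if 0 \<in> (x :: nat set) then f1 else f0)"
    have amp: "amplitude {0..n} \<Psi> (x \<union> z) = w x * f x z" if "z \<in> Pow N" "x = {} \<or> x = {0}" for x z
      using that amplitude_encoded[of z] by (auto simp: w_def f_def)
    have "(\<Sum>z\<in>Pow N. amplitude {0..n} \<Psi> (x \<union> z) * cnj (amplitude {0..n} \<Psi> (y \<union> z)))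
        = (\<Sum>z\<in>Pow N. w x * f x z * cnj (w y * f y z))"
      by (intro sum.cong refl) (simp only: amp xy)
    also have "\<dots> = w x * cnj (w y) * (\<Sum>z\<in>Pow N. f x z * cnj (f y z))" by (rule scale)
    also have "\<dots> = g x y"
      using xy by (elim disjE) (simp_all only: w_def f_def g_def f_unit f_orthogonal conj0 empty_iff
          insert_iff if_True if_False simp_thms mult_1_right mult_zero_right insert_not_empty empty_not_insert,
          simp_all only: cmod_sq)
    finally show "(\<Sum>z\<in>Pow N. amplitude {0..n} \<Psi> (x \<union> z) * cnj (amplitude {0..n} \<Psi> (y \<union> z))) = g x y" .
  qed
  have Pow0: "Pow {0 :: nat} = {{}, {0}}" by auto
  have gg: "op_on {0} g * op_on {0} g = op_on {0} (\<lambda>x y. g x y * g x y)"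
    unfolding op_on_mult[OF finite.intros(2)[OF finite.emptyI]] Pow0
    by (intro op_on_cong) (auto simp: g_def)
  have ggg: "op_on {0} (\<lambda>x y. g x y * g x y) * op_on {0} g = op_on {0} (\<lambda>x y. g x y * g x y * g x y)"
    unfolding op_on_mult[OF finite.intros(2)[OF finite.emptyI]] Pow0
    by (intro op_on_cong) (auto simp: g_def)
  have "pb = 1 - pa" using norm by simp
  then have pq: "(complex_of_real (cmod \<beta>))\<^sup>2 = 1 - (complex_of_real (cmod \<alpha>))\<^sup>2"
    by (metis of_real_power of_real_1 of_real_diff)
  show ?thesis
    unfolding two_level_def rho gg ggg op_on_smult op_on_add
  proof (intro conjI)
    show "op_on {0} (\<lambda>x y. g x y * g x y * g x y + complex_of_real (pa * pb * 1\<^sup>2) * g x y)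
        = op_on {0} (\<lambda>x y. complex_of_real 1 * (g x y * g x y))"
      by (intro op_on_cong) (simp add: g_def pq algebra_simps)
    show "mat_trace (op_on {0} g) = 1"
      by (simp add: mat_trace_op_on Pow0 g_def pq)
    show "mat_trace (op_on {0} (\<lambda>x y. g x y * g x y)) = complex_of_real ((pa\<^sup>2 + pb\<^sup>2) * 1)"
      by (simp add: mat_trace_op_on Pow0 g_def power2_eq_square)
  qed (use norm in auto)
qed

text \<open>If \<open>Lc\<close> meets \<open>labels B\<close>, then k1 / m is a projection and k2 /
  m a reflection on its range, so that (k1 + k2) / 2m and (k1 - k2) / 2m are orthogonal projections.
  On these the state takes the values m (1 + z) / b and m (1 - z) / b, that is, \<open>pa c\<close>
  and \<open>pb c\<close> with c = 2 m / b.\<close>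

lemma two_level_physical:
  assumes norm: "pa + pb = 1" and B: "B \<subseteq> N"
  shows "two_level (reduced_state n \<Psi> B) (2 ^ card B)
    (if Lc \<inter> labels B = {} then 1 else pa) (if Lc \<inter> labels B = {} then 0 else pb)
    (card (L' \<inter> labels B) / 2 ^ card B)"
proof -
  define m where "m = card (L \<inter> labels B)"
  define b :: complex where "b = 2 ^ card B"
  define z :: complex where "z = of_real (pa - pb)"
  define k1 where "k1 = kern B (L \<inter> labels B)"
  define k2 where "k2 = kern B (Lc \<inter> labels B)"
  have fB: "finite B" using B finite_subset by blast
  have b0: "b \<noteq> 0" by (simp add: b_def)
  have zero: "0 \<in> L \<inter> labels B" using L_closed by (simp add: add_closed_def)
  have m: "m > 0" using zero finite_L by (auto simp: m_def card_gt_0_iff)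
  have rho: "reduced_state n \<Psi> B = op_on B (\<lambda>x y. (k1 x y + z * k2 x y) / b)"
    unfolding reduced_state_physical[OF norm B] k1_def k2_def b_def z_def ..
  have sub: "L \<inter> labels B \<subseteq> L' \<inter> labels B" "Lc \<inter> labels B \<subseteq> L' \<inter> labels B"
    using L_sub by (auto simp: Lc_def)
  have tr1: "(\<Sum>x\<in>Pow B. k1 x x) = b" and tr2: "(\<Sum>x\<in>Pow B. k2 x x) = 0"
    using kern_trace[OF B sub(1)] kern_trace[OF B sub(2)] zero by (auto simp: k1_def k2_def b_def Lc_def)
  have k11: "(\<Sum>w\<in>Pow B. k1 x w * k1 w y) = of_nat m * k1 x y"
    and k12: "(\<Sum>w\<in>Pow B. k1 x w * k2 w y) = of_nat m * k2 x y" for x y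
    unfolding k1_def k2_def m_def
    using kern_mult[OF B sub(1) sub(1) translate_L(1)] kern_mult[OF B sub(1) sub(2) translate_L(2)] by auto
  show ?thesis
  proof (cases "Lc \<inter> labels B = {}")
    \<comment> \<open>Without a supported representative of \<open>Z S\<close> the state is k1 / b,
      whose only nonzero level is m / b: weights 1 and 0.\<close>
    case True
    then have k2: "k2 x y = 0" for x y by (simp add: k2_def kern_def)
    define c where "c = card (L' \<inter> labels B) / 2 ^ card B"
    have c: "complex_of_real c = of_nat m / b" and c0: "c > 0"
      using True m by (simp_all add: c_def card_L'_labels m_def b_def)
    let ?R = "op_on B (\<lambda>x y. k1 x y / b)"
    have RR: "?R * ?R = complex_of_real c \<cdot>\<^sub>m ?R"
      unfolding op_on_mult[OF fB] op_on_smult c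
      using b0 by (intro op_on_cong) (simp add: k11 flip: sum_divide_distrib)
    have RRR: "?R * ?R * ?R = complex_of_real c \<cdot>\<^sub>m (?R * ?R)"
      by (subst (1) RR) (rule mult_smult_assoc_mat[OF op_on_carrier op_on_carrier])
    have trR: "mat_trace ?R = 1"
      using tr1 b0 by (simp add: mat_trace_op_on[OF fB] flip: sum_divide_distrib)
    have "mat_trace (?R * ?R) = complex_of_real c"
      unfolding RR mat_trace_smult[OF op_on_carrier] trR by simp
    then show ?thesis
      unfolding two_level_def rho k2 c_def[symmetric] using True c0 RRR trR
      by (auto simp: intro!: eq_matI)
  next
    case False
    then obtain r where r: "r \<in> Lc \<inter> labels B" by blast
    have k21: "(\<Sum>w\<in>Pow B. k2 x w * k1 w y) = of_nat m * k2 x y"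
      and k22: "(\<Sum>w\<in>Pow B. k2 x w * k2 w y) = of_nat m * k1 x y" for x y
      unfolding k1_def k2_def m_def
      using kern_mult[OF B sub(2) sub(1) translate_L(3)] kern_mult[OF B sub(2) sub(2) translate_L(4)] card_Lc[OF False]
      by auto
    define c where "c = card (L' \<inter> labels B) / 2 ^ card B"
    have c: "complex_of_real c = 2 * of_nat m / b" and c0: "c > 0"
      using False m by (simp_all add: c_def card_L'_labels m_def b_def)
    define g where "g = (\<lambda>x y. (k1 x y + z * k2 x y) / b)"
    \<comment> \<open>Multiplication by the state in the coordinates with respect to
      \<open>k1\<close> and \<open>k2\<close>; applied twice it yields the square and the
      cube.\<close>
    have comp: "(\<Sum>w\<in>Pow B. (u * k1 x w + v * k2 x w) * g w y)
        = of_nat m * ((u + v * z) * k1 x y + (u * z + v) * k2 x y) / b" for u v x y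
    proof -
      have "(\<Sum>w\<in>Pow B. (u * k1 x w + v * k2 x w) * g w y)
        = (u * (\<Sum>w\<in>Pow B. k1 x w * k1 w y) + u * z * (\<Sum>w\<in>Pow B. k1 x w * k2 w y)
          + v * (\<Sum>w\<in>Pow B. k2 x w * k1 w y) + v * z * (\<Sum>w\<in>Pow B. k2 x w * k2 w y)) / b"
        by (simp add: g_def sum_distrib_left add_divide_distrib algebra_simps sum.distrib sum_divide_distrib)
      then show ?thesis unfolding k11 k12 k21 k22 by (simp add: algebra_simps)
    qed
    let ?R = "op_on B g"
    define h where "h = (\<lambda>x y. (of_nat m * (1 + z * z) / b\<^sup>2) * k1 x y + (of_nat m * (2 * z) / b\<^sup>2) * k2 x y)"
    have gg: "(\<Sum>w\<in>Pow B. g x w * g w y) = h x y" for x y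
      using comp[of "1 / b" x "z / b" y] by (simp add: h_def g_def add_divide_distrib algebra_simps power2_eq_square)
    have RR: "?R * ?R = op_on B h"
      unfolding op_on_mult[OF fB] by (intro op_on_cong gg)
    have RRR: "?R * ?R * ?R = op_on B (\<lambda>x y. of_nat m * ((of_nat m * (1 + z * z) / b\<^sup>2 + of_nat m * (2 * z) / b\<^sup>2 * z) * k1 x y
        + (of_nat m * (1 + z * z) / b\<^sup>2 * z + of_nat m * (2 * z) / b\<^sup>2) * k2 x y) / b)"
      unfolding RR unfolding op_on_mult[OF fB] h_def by (intro op_on_cong comp)
    have "pb = 1 - pa" using norm by simp
  then have pq: "(complex_of_real (cmod \<beta>))\<^sup>2 = 1 - (complex_of_real (cmod \<alpha>))\<^sup>2"
    by (metis of_real_power of_real_1 of_real_diff)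
    \<comment> \<open>With everything expressed through \<open>a\<close>, the cubic identity becomes
      a polynomial identity in \<open>a\<close>, \<open>k1\<close> and \<open>k2\<close>.\<close>
    define a where "a = complex_of_real pa"
    have z: "z = 2 * a - 1" by (simp add: z_def pq a_def)
    have cubic_coeff: "complex_of_real (pa * pb * c\<^sup>2) = a * (1 - a) * (2 * of_nat m / b)\<^sup>2"
      by (simp add: pq a_def flip: c)
    have trace_coeff: "complex_of_real ((pa\<^sup>2 + pb\<^sup>2) * c) = (a\<^sup>2 + (1 - a)\<^sup>2) * (2 * of_nat m / b)"
    proof -
      have "complex_of_real pb = 1 - a" by (simp add: pq a_def)
      moreover have "complex_of_real ((pa\<^sup>2 + pb\<^sup>2) * c)
          = ((complex_of_real pa)\<^sup>2 + (complex_of_real pb)\<^sup>2) * complex_of_real c"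
        by (simp only: of_real_mult of_real_add of_real_power)
      ultimately show ?thesis by (simp only: c a_def)
    qed
    have "?R * ?R * ?R + complex_of_real (pa * pb * c\<^sup>2) \<cdot>\<^sub>m ?R = complex_of_real c \<cdot>\<^sub>m (?R * ?R)"
      unfolding RRR unfolding RR unfolding op_on_smult op_on_add h_def g_def cubic_coeff c z
      by (intro op_on_cong) (simp add: divide_inverse algebra_simps power2_eq_square)
    moreover have "mat_trace ?R = 1"
      using tr1 tr2 b0
      by (simp add: mat_trace_op_on[OF fB] g_def sum.distrib flip: sum_divide_distrib sum_distrib_left)
    moreover have "mat_trace (?R * ?R) = of_real ((pa\<^sup>2 + pb\<^sup>2) * c)"
    proof -
      have "mat_trace (?R * ?R) = (of_nat m * (1 + z * z) / b\<^sup>2) * b"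
        unfolding RR mat_trace_op_on[OF fB] h_def using tr1 tr2
        by (simp only: sum.distrib flip: sum_distrib_left) simp
      also have "\<dots> = of_real ((pa\<^sup>2 + pb\<^sup>2) * c)"
        unfolding trace_coeff z using b0 by (simp add: field_simps power2_eq_square)
      finally show ?thesis .
    qed
    ultimately show ?thesis
      unfolding two_level_def rho c_def[symmetric] g_def[symmetric] using False c0 norm by auto
  qed
qed

end

end

section \<open>Supported logical operators\<close>

text \<open>Coordinates in a finite basis identify the space with the functions from the basis to
  the field. This turns the dimension in the definition of \<open>logical_dim\<close> into a
  count.\<close>

lemma (in vectorspace) card_carrier_eq_power_dim:
  assumes fin: "finite (carrier V)"
  shows "card (carrier V) = card (carrier K) ^ dim"
proof -
  have "fin_dim"
    unfolding fin_dim_def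
    using fin in_own_span[of "carrier V"] span_is_subset2[of "carrier V"] by blast
  then obtain \<beta> where \<beta>: "finite \<beta>" "basis \<beta>" using finite_basis_exists by blast
  then have sub: "\<beta> \<subseteq> carrier V" by (simp add: basis_def)
  have unique: "\<exists>!a. a \<in> \<beta> \<rightarrow>\<^sub>E carrier K \<and> lincomb a \<beta> = v" if "v \<in> carrier V" for v
    using basis_criterion[OF \<beta>(1) sub] \<beta>(2) that by blast
  have closed: "lincomb a \<beta> \<in> carrier V" if "a \<in> \<beta> \<rightarrow>\<^sub>E carrier K" for a
    using that sub by (intro lincomb_closed) auto
  have "bij_betw (\<lambda>a. lincomb a \<beta>) (\<beta> \<rightarrow>\<^sub>E carrier K) (carrier V)"
    unfolding bij_betw_def
  proof (intro conjI inj_onI subset_antisym subsetI)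
    fix a b assume "a \<in> \<beta> \<rightarrow>\<^sub>E carrier K" "b \<in> \<beta> \<rightarrow>\<^sub>E carrier K" "lincomb a \<beta> = lincomb b \<beta>"
    then show "a = b" using unique[OF closed[of b]] by blast
  next
    fix v assume "v \<in> carrier V"
    then show "v \<in> (\<lambda>a. lincomb a \<beta>) ` (\<beta> \<rightarrow>\<^sub>E carrier K)" using unique by blast
  qed (use closed in auto)
  then have "card (carrier V) = card (\<beta> \<rightarrow>\<^sub>E carrier K)" using bij_betw_same_card by metis
  also have "\<dots> = card (carrier K) ^ card \<beta>" using \<beta>(1) by (simp add: card_PiE)
  finally show ?thesis using dim_basis[OF \<beta>] by simp
qed

lemma perp_add: "p \<in> perp Q B F \<Longrightarrow> r \<in> perp Q B F \<Longrightarrow> p + r \<in> perp Q B F"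
  by (auto simp: perp_def labels_add label_sign_add)

lemma zero_in_perp: "0 \<in> perp Q B F"
  by (simp add: perp_def)

lemma field_residue_ring_2: "field (residue_ring 2)"
proof -
  interpret residues_prime 2 "residue_ring (int 2)"
    by unfold_locales simp_all
  show ?thesis using is_field by simp
qed

context qubit_code
begin

text \<open>The class of \<open>P p\<close> modulo \<open>S\<close> and phases, written through
  labels so that the quotient group becomes addition of labels modulo \<open>L\<close>.\<close>

definition coset :: "(nat \<Rightarrow> pauli) \<Rightarrow> complex mat set" where
  "coset p = {\<i> ^ k \<cdot>\<^sub>m P (p + r) | k r. r \<in> L}"

abbreviation "C \<equiv> perp N N L"

lemma L_labels: "L \<subseteq> labels N"
  by (auto simp: L_def label_set_def)

lemma label_set_power: "r \<in> L \<Longrightarrow> \<exists>k. \<i> ^ k \<cdot>\<^sub>m P r \<in> S"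
  by (auto simp: L_def label_set_def)

lemma L_in_C: "L \<subseteq> C"
  using L_labels sign_F[OF subsetD[OF L_sub] subsetD[OF L_sub]] by (auto simp: perp_def)

lemma i_power_shift: "\<exists>m. \<i> ^ m * \<i> ^ k = \<i> ^ l"
  using i_power_inverse[of k] by (intro exI[of _ "l + 3 * k"]) (simp add: power_add mult.assoc mult.commute)

lemma phase_closure_eq: "phase_closure S = {\<i> ^ k \<cdot>\<^sub>m P r | k r. r \<in> L}"
proof (intro subset_antisym subsetI)
  fix M assume "M \<in> phase_closure S"
  then obtain k s where ks: "M = \<i> ^ k \<cdot>\<^sub>m s" "s \<in> S" by (auto simp: phase_closure_def)
  then obtain l r where lr: "s = \<i> ^ l \<cdot>\<^sub>m P r" "r \<in> labels N" using S_carrier pauli_group_carrier by blast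
  then have "r \<in> L" using ks(2) by (auto simp: L_def label_set_def)
  moreover have "M = \<i> ^ (k + l) \<cdot>\<^sub>m P r" by (simp add: ks lr smult_smult_mat power_add)
  ultimately show "M \<in> {\<i> ^ k \<cdot>\<^sub>m P r | k r. r \<in> L}" by blast
next
  fix M assume "M \<in> {\<i> ^ k \<cdot>\<^sub>m P r | k r. r \<in> L}"
  then obtain k r where kr: "M = \<i> ^ k \<cdot>\<^sub>m P r" "r \<in> L" by blast
  obtain l where l: "\<i> ^ l \<cdot>\<^sub>m P r \<in> S" using label_set_power[OF kr(2)] by blast
  obtain m where "\<i> ^ m * \<i> ^ l = \<i> ^ k" using i_power_shift by blast
  then have "M = \<i> ^ m \<cdot>\<^sub>m (\<i> ^ l \<cdot>\<^sub>m P r)" by (simp add: kr smult_smult_mat)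
  then show "M \<in> phase_closure S" using l by (auto simp: phase_closure_def)
qed

lemma smult_pauli_commute_iff:
  "(\<i> ^ k \<cdot>\<^sub>m P p) * (\<i> ^ l \<cdot>\<^sub>m P r) = (\<i> ^ l \<cdot>\<^sub>m P r) * (\<i> ^ k \<cdot>\<^sub>m P p) \<longleftrightarrow> label_sign N p r = 1"
proof -
  have a: "(\<i> ^ k \<cdot>\<^sub>m P p) * (\<i> ^ l \<cdot>\<^sub>m P r) = (\<i> ^ k * \<i> ^ l * label_phase N p r) \<cdot>\<^sub>m P (p + r)"
    by (simp add: smult_pauli_op_mult)
  have b: "(\<i> ^ l \<cdot>\<^sub>m P r) * (\<i> ^ k \<cdot>\<^sub>m P p) = (\<i> ^ k * \<i> ^ l * label_phase N r p) \<cdot>\<^sub>m P (p + r)"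
    by (simp add: smult_pauli_op_mult add.commute mult.commute)
  show ?thesis
  proof
    assume "(\<i> ^ k \<cdot>\<^sub>m P p) * (\<i> ^ l \<cdot>\<^sub>m P r) = (\<i> ^ l \<cdot>\<^sub>m P r) * (\<i> ^ k \<cdot>\<^sub>m P p)"
    then have "\<i> ^ k * \<i> ^ l * label_phase N p r = \<i> ^ k * \<i> ^ l * label_phase N r p"
      unfolding a b by (rule smult_pauli_op_eq(1)[OF finite_atLeastAtMost]) simp
    then show "label_sign N p r = 1" using label_phase_commute[of N p r] by simp
  next
    assume "label_sign N p r = 1"
    then show "(\<i> ^ k \<cdot>\<^sub>m P p) * (\<i> ^ l \<cdot>\<^sub>m P r) = (\<i> ^ l \<cdot>\<^sub>m P r) * (\<i> ^ k \<cdot>\<^sub>m P p)"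
      unfolding a b label_phase_commute[of N p r] by simp
  qed
qed

text \<open>Phases do not affect commutation, so only the signs against the labels of
  \<open>S\<close> matter and every phase occurs.\<close>

lemma commutant_eq: "commutant n S = {\<i> ^ k \<cdot>\<^sub>m P p | k p. p \<in> C}"
proof (intro subset_antisym subsetI)
  fix M assume M: "M \<in> commutant n S"
  then obtain k p where kp: "M = \<i> ^ k \<cdot>\<^sub>m P p" "p \<in> labels N"
    unfolding commutant_def pauli_group_carrier by blast
  have "label_sign N p r = 1" if "r \<in> L" for r
  proof -
    obtain l where "\<i> ^ l \<cdot>\<^sub>m P r \<in> S" using label_set_power[OF \<open>r \<in> L\<close>] by blast
    then have "M * (\<i> ^ l \<cdot>\<^sub>m P r) = (\<i> ^ l \<cdot>\<^sub>m P r) * M" using M by (auto simp: commutant_def)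
    then show ?thesis unfolding kp smult_pauli_commute_iff .
  qed
  then have "p \<in> C" using kp by (simp add: perp_def)
  then show "M \<in> {\<i> ^ k \<cdot>\<^sub>m P p | k p. p \<in> C}" using kp by blast
next
  fix M assume "M \<in> {\<i> ^ k \<cdot>\<^sub>m P p | k p. p \<in> C}"
  then obtain k p where kp: "M = \<i> ^ k \<cdot>\<^sub>m P p" "p \<in> C" by blast
  have "M * s = s * M" if "s \<in> S" for s
  proof -
    obtain l r where lr: "s = \<i> ^ l \<cdot>\<^sub>m P r" "r \<in> labels N"
      using \<open>s \<in> S\<close> S_carrier pauli_group_carrier by blast
    then have "r \<in> L" using that by (auto simp: L_def label_set_def)
    then have "label_sign N p r = 1" using kp(2) by (auto simp: perp_def)
    then show ?thesis unfolding kp lr smult_pauli_commute_iff .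
  qed
  then show "M \<in> commutant n S" using kp by (auto simp: commutant_def)
qed

lemma coset_eq_iff:
  assumes "p \<in> labels N" "p' \<in> labels N"
  shows "coset p = coset p' \<longleftrightarrow> p + p' \<in> L"
proof
  assume eq: "coset p = coset p'"
  have "0 \<in> L" using L_closed by (simp add: add_closed_def)
  then have "\<i> ^ 0 \<cdot>\<^sub>m P (p + 0) \<in> coset p" unfolding coset_def by blast
  then obtain k r where r: "r \<in> L" "\<i> ^ 0 \<cdot>\<^sub>m P (p + 0) = \<i> ^ k \<cdot>\<^sub>m P (p' + r)"
    unfolding eq by (auto simp: coset_def)
  have "(p + 0) q = (p' + r) q" if "q \<in> N" for q
    using smult_pauli_op_eq(2)[OF _ r(2) _ that] by simp
  then have "p = p' + r" using assms r(1) L_labels labels_add by (intro labels_eqI[of _ N]) auto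
  then have "p + p' = r" by (simp add: add.commute add.left_commute)
  then show "p + p' \<in> L" using r(1) by simp
next
  assume pp: "p + p' \<in> L"
  have sub: "coset q \<subseteq> coset q'" if "q + q' \<in> L" for q q'
  proof
    fix M assume "M \<in> coset q"
    then obtain k r where kr: "M = \<i> ^ k \<cdot>\<^sub>m P (q + r)" "r \<in> L" by (auto simp: coset_def)
    have "q + r = q' + (q + q' + r)" by (simp add: add.assoc add.left_commute)
    then have "M = \<i> ^ k \<cdot>\<^sub>m P (q' + (q + q' + r))" using kr(1) by metis
    moreover have "q + q' + r \<in> L" using that kr(2) L_closed by (simp add: add_closed_def)
    ultimately show "M \<in> coset q'" unfolding coset_def by blast
  qed
  show "coset p = coset p'" using sub[OF pp] sub[of p' p] pp by (auto simp: add.commute)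
qed

lemma set_mult_coset:
  "set_mult (pauli_group N) (coset p) (coset p') = coset (p + p')"
proof (intro subset_antisym subsetI)
  fix M assume "M \<in> set_mult (pauli_group N) (coset p) (coset p')"
  then obtain k l r r' where kl: "M = (\<i> ^ k \<cdot>\<^sub>m P (p + r)) * (\<i> ^ l \<cdot>\<^sub>m P (p' + r'))" "r \<in> L" "r' \<in> L"
    by (auto simp: set_mult_def coset_def)
  obtain m where "label_phase N (p + r) (p' + r') = \<i> ^ m" using label_phase_power by blast
  then have "M = \<i> ^ (k + l + m) \<cdot>\<^sub>m P (p + p' + (r + r'))"
    by (simp add: kl smult_pauli_op_mult power_add ac_simps)
  moreover have "r + r' \<in> L" using kl L_closed by (simp add: add_closed_def)
  ultimately show "M \<in> coset (p + p')" by (auto simp: coset_def)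
next
  fix M assume "M \<in> coset (p + p')"
  then obtain k r where kr: "M = \<i> ^ k \<cdot>\<^sub>m P (p + p' + r)" "r \<in> L" by (auto simp: coset_def)
  obtain m where m: "label_phase N p (p' + r) = \<i> ^ m" using label_phase_power by blast
  \<comment> \<open>The phase \<open>\<i> ^ l\<close> compensates the one that the product of the
    two representatives produces.\<close>
  obtain l where l: "\<i> ^ l * \<i> ^ m = \<i> ^ k" using i_power_shift by blast
  have "0 \<in> L" using L_closed by (simp add: add_closed_def)
  then have "\<i> ^ l \<cdot>\<^sub>m P (p + 0) \<in> coset p" "\<i> ^ 0 \<cdot>\<^sub>m P (p' + r) \<in> coset p'"
    using kr(2) unfolding coset_def by blast+
  moreover have "M = (\<i> ^ l \<cdot>\<^sub>m P (p + 0)) * (\<i> ^ 0 \<cdot>\<^sub>m P (p' + r))"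
    unfolding smult_pauli_op_mult[OF finite_atLeastAtMost] kr(1) using l m by (simp add: add.assoc)
  ultimately show "M \<in> set_mult (pauli_group N) (coset p) (coset p')"
    unfolding set_mult_def by auto
qed

lemma phase_closure_coset: "phase_closure S = coset 0"
  by (simp add: phase_closure_eq coset_def)

lemma quotient_simps:
  "carrier (logical_quotient n S) = coset ` C"
  "monoid.mult (logical_quotient n S) = set_mult (pauli_group N)"
  "one (logical_quotient n S) = coset 0"
proof -
  \<comment> \<open>A right coset absorbs the phase of its representative, because
    \<open>phase_closure S\<close> contains all phases.\<close>
  have rc: "r_coset (pauli_group N\<lparr>carrier := commutant n S\<rparr>) (coset 0) (\<i> ^ k \<cdot>\<^sub>m P p) = coset p" for k p
  proof (intro subset_antisym subsetI)
    fix M assume "M \<in> r_coset (pauli_group N\<lparr>carrier := commutant n S\<rparr>) (coset 0) (\<i> ^ k \<cdot>\<^sub>m P p)"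
    then obtain l r where lr: "M = (\<i> ^ l \<cdot>\<^sub>m P r) * (\<i> ^ k \<cdot>\<^sub>m P p)" "r \<in> L"
      by (auto simp: r_coset_def coset_def)
    obtain m where "label_phase N r p = \<i> ^ m" using label_phase_power by blast
    then have "M = \<i> ^ (l + k + m) \<cdot>\<^sub>m P (p + r)"
      by (simp add: lr smult_pauli_op_mult power_add add.commute mult.commute mult.left_commute)
    then show "M \<in> coset p" using lr(2) by (auto simp: coset_def)
  next
    fix M assume "M \<in> coset p"
    then obtain l r where lr: "M = \<i> ^ l \<cdot>\<^sub>m P (p + r)" "r \<in> L" by (auto simp: coset_def)
    obtain m where m: "label_phase N r p = \<i> ^ m" using label_phase_power by blast
    obtain j where j: "\<i> ^ j * \<i> ^ (k + m) = \<i> ^ l" using i_power_shift by blast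
    have "M = (\<i> ^ j \<cdot>\<^sub>m P r) * (\<i> ^ k \<cdot>\<^sub>m P p)"
      unfolding smult_pauli_op_mult[OF finite_atLeastAtMost] lr(1) m
      using j by (simp add: add.commute power_add mult.assoc)
    then show "M \<in> r_coset (pauli_group N\<lparr>carrier := commutant n S\<rparr>) (coset 0) (\<i> ^ k \<cdot>\<^sub>m P p)"
      using lr(2) by (auto simp: r_coset_def coset_def)
  qed
  show "carrier (logical_quotient n S) = coset ` C"
    unfolding logical_quotient_def FactGroup_def RCOSETS_def phase_closure_coset
    using rc by (auto simp: commutant_eq)
  show "monoid.mult (logical_quotient n S) = set_mult (pauli_group N)"
    "one (logical_quotient n S) = coset 0"
    by (simp_all add: logical_quotient_def FactGroup_def phase_closure_coset set_mult_def fun_eq_iff)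
qed

text \<open>The labels occurring in \<open>coset p\<close> are the sums \<open>p + r\<close> with
  \<open>r \<in> L\<close>, and all of them commute with \<open>L\<close>. A supported
  representative is therefore a label of this form in \<open>perp N A L\<close>.\<close>

lemma supported_coset:
  assumes A: "A \<subseteq> N" and p: "p \<in> C"
  shows "(\<exists>M\<in>coset p. supported_on N A M) \<longleftrightarrow> coset p \<in> coset ` perp N A L"
proof
  assume "\<exists>M\<in>coset p. supported_on N A M"
  then obtain k r l a where M: "r \<in> L" "\<i> ^ k \<cdot>\<^sub>m P (p + r) = \<i> ^ l \<cdot>\<^sub>m P a" "\<forall>q\<in>N - A. a q = 0"
    by (auto simp: coset_def supported_on_def zero_pauli_def)
  have pr: "p + r \<in> C" using perp_add p M(1) L_in_C by blast
  have eq: "(p + r) q = a q" if "q \<in> N" for q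
    using smult_pauli_op_eq(2)[OF _ M(2) _ that] by simp
  \<comment> \<open>The label \<open>a\<close> from \<open>supported_on\<close> is arbitrary outside
    \<open>N\<close>, so membership is shown for \<open>p + r\<close>, which vanishes there.\<close>
  have "p + r \<in> labels A"
  proof -
    have "(p + r) q = 0" if "q \<notin> A" for q
      using eq[of q] M(3) that pr by (cases "q \<in> N") (auto simp: perp_def labels_def)
    then show ?thesis by (simp add: labels_def)
  qed
  then have "p + r \<in> perp N A L" using pr by (simp add: perp_def)
  moreover have "coset p = coset (p + r)"
    using p pr M(1) by (subst coset_eq_iff) (auto simp: perp_def)
  ultimately show "coset p \<in> coset ` perp N A L" by blast
next
  assume "coset p \<in> coset ` perp N A L"
  then obtain a where a: "a \<in> perp N A L" "coset p = coset a" by blast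
  have "0 \<in> L" using L_closed by (simp add: add_closed_def)
  then have "\<i> ^ 0 \<cdot>\<^sub>m P (a + 0) \<in> coset a" unfolding coset_def by blast
  moreover have "supported_on N A (\<i> ^ 0 \<cdot>\<^sub>m P (a + 0))"
    unfolding supported_on_def using a(1)
    by (intro exI[of _ 0] exI[of _ a]) (auto simp: perp_def labels_def zero_pauli_def)
  ultimately show "\<exists>M\<in>coset p. supported_on N A M" using a(2) by blast
qed

lemma perp_sub_C: "A \<subseteq> N \<Longrightarrow> perp N A L \<subseteq> C"
  using labels_mono by (auto simp: perp_def)

lemma carrier_supported_logicals:
  assumes A: "A \<subseteq> N"
  shows "carrier (supported_logicals n S A) = coset ` perp N A L"
  using supported_coset[OF A] perp_sub_C[OF A]
  by (auto simp: supported_logicals_def quotient_simps)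

text \<open>Each fibre of \<open>coset\<close> on \<open>perp N A L\<close> is a translate of
  \<open>L \<inter> labels A\<close>.\<close>

lemma card_supported_logicals:
  assumes A: "A \<subseteq> N"
  shows "card (coset ` perp N A L) * card (L \<inter> labels A) = card (perp N A L)"
proof -
  have fin: "finite (perp N A L)"
    using A finite_subset[of A N] by (auto simp: perp_def)
  have "card {p \<in> perp N A L. coset p = K} = card (L \<inter> labels A)" if K: "K \<in> coset ` perp N A L" for K
  proof -
    obtain a where a: "a \<in> perp N A L" "K = coset a" using K by blast
    have aN: "a \<in> labels N" "a \<in> labels A" "a \<in> C" using a(1) perp_sub_C[OF A] by (auto simp: perp_def)
    have "{p \<in> perp N A L. coset p = K} = (+) a ` (L \<inter> labels A)"
      unfolding translate_eq
    proof (intro Collect_cong iffI)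
      fix p assume p: "p \<in> perp N A L \<and> coset p = K"
      then have "p \<in> labels N" "p \<in> labels A" using perp_sub_C[OF A] by (auto simp: perp_def)
      then show "a + p \<in> L \<inter> labels A"
        using p aN labels_add a(2) by (auto simp: coset_eq_iff add.commute)
    next
      fix p assume p: "a + p \<in> L \<inter> labels A"
      then have pA: "p \<in> labels A" using labels_add_iff[OF aN(2)] by blast
      have "a + (a + p) \<in> C" using p by (intro perp_add[OF aN(3) subsetD[OF L_in_C]]) blast
      then have pC: "p \<in> C" by simp
      then have "p \<in> perp N A L" using pA by (auto simp: perp_def)
      moreover have "coset p = K"
        using pC aN p unfolding a(2) by (subst coset_eq_iff) (auto simp: perp_def add.commute)
      ultimately show "p \<in> perp N A L \<and> coset p = K" by blast
    qed
    then show ?thesis by (simp add: card_image inj_on_def)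
  qed
  then have "(\<Sum>K\<in>coset ` perp N A L. card {p \<in> perp N A L. coset p = K})
      = card (coset ` perp N A L) * card (L \<inter> labels A)" by simp
  moreover have "card (perp N A L) = (\<Sum>K\<in>coset ` perp N A L. card {p \<in> perp N A L. coset p = K})"
    using sum.image_gen[OF fin, of "\<lambda>_. 1 :: nat" coset] by simp
  ultimately show ?thesis by simp
qed

lemma vectorspace_supported_logicals:
  assumes A: "A \<subseteq> N"
  shows "vectorspace (residue_ring 2) (supported_logicals n S A)"
proof -
  let ?V = "supported_logicals n S A"
  let ?Q = "logical_quotient n S"
  have V: "carrier ?V = coset ` perp N A L" by (rule carrier_supported_logicals[OF A])
  have add: "coset p \<oplus>\<^bsub>?V\<^esub> coset r = coset (p + r)" for p r
    by (simp add: supported_logicals_def quotient_simps set_mult_coset del: One_nat_def)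
  have zero: "\<zero>\<^bsub>?V\<^esub> = coset 0"
    by (simp add: supported_logicals_def quotient_simps)
  \<comment> \<open>Scalars are the integers 0 and 1 and act as exponents, so only two cases
    arise.\<close>
  have smult: "a \<odot>\<^bsub>?V\<^esub> coset p = (if a = 0 then coset 0 else coset p)" if "a = 0 \<or> a = 1" for a p
    using that by (auto simp: supported_logicals_def int_pow_def nat_pow_def quotient_simps set_mult_coset
      simp del: One_nat_def)
  have R: "carrier (residue_ring 2) = {0, 1}" "\<one>\<^bsub>residue_ring 2\<^esub> = 1"
    "a \<oplus>\<^bsub>residue_ring 2\<^esub> b = (a + b) mod 2" "a \<otimes>\<^bsub>residue_ring 2\<^esub> b = (a * b) mod 2" for a b
    by (auto simp: residue_ring_def)
  show ?thesis
  proof (rule vs_criteria[OF field_residue_ring_2])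
    show "\<forall>v\<in>carrier ?V. \<exists>w\<in>carrier ?V. v \<oplus>\<^bsub>?V\<^esub> w = \<zero>\<^bsub>?V\<^esub>"
    proof
      fix v assume v: "v \<in> carrier ?V"
      then obtain p where "v = coset p" by (auto simp: V)
      then have "v \<oplus>\<^bsub>?V\<^esub> v = \<zero>\<^bsub>?V\<^esub>" by (simp add: add zero)
      then show "\<exists>w\<in>carrier ?V. v \<oplus>\<^bsub>?V\<^esub> w = \<zero>\<^bsub>?V\<^esub>" using v by blast
    qed
  qed (auto simp: V add zero smult R add.assoc add.commute add.left_commute
      intro!: imageI[where f = coset] perp_add zero_in_perp)
qed

lemma card_perp_logical_dim:
  assumes A: "A \<subseteq> N"
  shows "2 ^ logical_dim n S A * card (L \<inter> labels A) = card (perp N A L)"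
proof -
  interpret V: vectorspace "residue_ring 2" "supported_logicals n S A"
    by (rule vectorspace_supported_logicals[OF A])
  have "finite (carrier (supported_logicals n S A))"
    unfolding carrier_supported_logicals[OF A] using A finite_subset[of A N] by (simp add: perp_def)
  then have "card (coset ` perp N A L) = card (carrier (residue_ring 2)) ^ logical_dim n S A"
    using V.card_carrier_eq_power_dim carrier_supported_logicals[OF A] by (simp add: logical_dim_def)
  also have "card (carrier (residue_ring 2)) = 2" by (simp add: residue_ring_def)
  finally show ?thesis using card_supported_logicals[OF A] by simp
qed

text \<open>Self-duality turns the complement counted by \<open>card_perp\<close> back into
  \<open>L'\<close>. This is the equality of c_B for a region and its complement, free of
  fractions.\<close>

lemma perp_L':
  assumes "B \<subseteq> N"
  shows "card (L' \<inter> labels B) * 2 ^ n = 4 ^ card B * card (L' \<inter> labels (N - B))"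
  using card_perp[OF _ assms F_closed F_labels] perp_self_dual[OF _ F_closed F_labels _ sign_F assms]
    card_L' by simp

text \<open>Equality of the exponents of 2 after comparing the counts for \<open>L'\<close> and
  \<open>L\<close>; the summand 1 on the left reflects that \<open>L\<close> is half of
  \<open>L'\<close>. The additive form avoids truncated subtraction.\<close>

lemma logical_dim_count:
  assumes A: "A \<subseteq> N"
  shows "(if Lc \<inter> labels A = {} then 0 else 1) + 1
    = logical_dim n S A + (if Lc \<inter> labels (N - A) = {} then 0 else 1)"
proof -
  let ?a = "card (L \<inter> labels A)" and ?a' = "card (L \<inter> labels (N - A))"
  let ?z = "if Lc \<inter> labels A = {} then 0 else 1 :: nat"
  let ?z' = "if Lc \<inter> labels (N - A) = {} then 0 else 1 :: nat"
  have pow: "(if b then 1 else 2 :: nat) = 2 ^ (if b then 0 else 1)" for b by simp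
  have 1: "?a * 2 ^ ?z * 2 ^ n = 4 ^ card A * (?a' * 2 ^ ?z')"
    using perp_L'[OF A] by (simp only: card_L'_labels pow)
  have 2: "2 ^ logical_dim n S A * ?a * 2 ^ (n - 1) = 4 ^ card A * ?a'"
    using card_perp[OF _ A L_closed L_labels] card_perp_logical_dim[OF A] card_L by simp
  have n: "(2 :: nat) ^ n = 2 * 2 ^ (n - 1)" using n_pos by (cases n) auto
  have "0 \<in> L \<inter> labels A" using L_closed by (simp add: add_closed_def)
  then have pos: "?a > 0" using finite_L by (auto simp: card_gt_0_iff)
  have "?a * 2 ^ (n - 1) * 2 ^ (?z + 1) = ?a * 2 ^ (n - 1) * 2 ^ (logical_dim n S A + ?z')"
  proof -
    have "?a * 2 ^ (n - 1) * 2 ^ (?z + 1) = ?a * 2 ^ ?z * 2 ^ n" by (simp add: n)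
    also have "\<dots> = (2 ^ logical_dim n S A * ?a * 2 ^ (n - 1)) * 2 ^ ?z'"
      unfolding 1 2 by (simp add: mult.assoc)
    finally show ?thesis by (simp add: power_add ac_simps)
  qed
  then have "(2 :: nat) ^ (?z + 1) = 2 ^ (logical_dim n S A + ?z')" using pos by simp
  moreover have "1 < (2 :: nat)" by simp
  ultimately show ?thesis using power_inject_exp by blast
qed

lemma superdense_capacity_logical_dim:
  assumes norm: "(cmod \<alpha>)\<^sup>2 + (cmod \<beta>)\<^sup>2 = 1" and A: "A \<subseteq> N"
  shows "superdense_capacity n (encoded_state n \<alpha> \<beta> \<psi>\<^sub>0 \<psi>\<^sub>1) A
    = 1 + (real (logical_dim n S A) - 1) * vn_entropy (reduced_state n (encoded_state n \<alpha> \<beta> \<psi>\<^sub>0 \<psi>\<^sub>1) {0})"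
proof -
  let ?\<Psi> = "encoded_state n \<alpha> \<beta> \<psi>\<^sub>0 \<psi>\<^sub>1"
  let ?h = "two_entropy ((cmod \<alpha>)\<^sup>2) ((cmod \<beta>)\<^sup>2)"
  define zz where "zz = (\<lambda>B. if Lc \<inter> labels B = {} then 0 else 1 :: nat)"
  define c where "c = (\<lambda>B. card (L' \<inter> labels B) / 2 ^ card B :: real)"
  have A': "N - A \<subseteq> N" "finite A" "0 \<notin> A" using A finite_subset[of A N] by auto
  have compl: "{0..n} - (N - A) = insert 0 A" "N - A \<subseteq> {0..n}" using A by auto
  \<comment> \<open>The weights (1, 0) have entropy 0, which lets \<open>zz B\<close> stand for the
    case distinction.\<close>
  have H: "two_entropy (if Lc \<inter> labels B = {} then 1 else (cmod \<alpha>)\<^sup>2) (if Lc \<inter> labels B = {} then 0 else (cmod \<beta>)\<^sup>2)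
      = zz B * ?h" for B
    by (simp add: zz_def two_entropy_def)
  note tlA = two_level_physical[OF norm A] and tlA' = two_level_physical[OF norm A'(1)]
  have cA: "c A > 0" using tlA by (simp add: two_level_def c_def)
  have "vn_entropy (tensor_op {0} A ((1 / 2) \<cdot>\<^sub>m 1\<^sub>m 2) (reduced_state n ?\<Psi> A)) = zz A * ?h - log 2 (c A / 2)"
    unfolding tensor_op_maximally_mixed[OF A'(2,3)]
    using vn_entropy_two_level[OF two_level_idle[OF A'(2,3) tlA]] by (simp only: H c_def)
  moreover have "log 2 (c A / 2) = log 2 (c A) - 1"
    using cA by (simp add: log_divide)
  \<comment> \<open>The whole register is pure and \<open>insert 0 A\<close> is the complement of
    \<open>N - A\<close>, a region without \<open>T\<close> whose levels are known.\<close>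
  moreover have "vn_entropy (reduced_state n ?\<Psi> (insert 0 A)) = zz (N - A) * ?h - log 2 (c (N - A))"
    using vn_entropy_complement[OF finite_atLeastAtMost compl(2) encoded_carrier tlA'[unfolded reduced_state_def]]
    unfolding compl(1) by (simp only: H c_def reduced_state_def)
  moreover have "c A = c (N - A)"
  proof -
    have "n = card A + card (N - A)"
      using A A'(2) by (metis card_Diff_subset card_N card_mono finite_atLeastAtMost le_add_diff_inverse)
    then have n: "(2 :: real) ^ n = 2 ^ card A * 2 ^ card (N - A)" by (metis power_add)
    have "real (card (L' \<inter> labels A)) * 2 ^ n = 4 ^ card A * real (card (L' \<inter> labels (N - A)))"
      using arg_cong[OF perp_L'[OF A], of real] by simp
    moreover have "(4 :: real) ^ card A = 2 ^ card A * 2 ^ card A" by (simp flip: power_mult_distrib)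
    ultimately show ?thesis unfolding c_def n by (simp add: field_simps)
  qed
  moreover have "vn_entropy (reduced_state n ?\<Psi> {0}) = ?h"
    using vn_entropy_two_level[OF two_level_T[OF norm]] by simp
  \<comment> \<open>With equal logarithms cancelled, the capacity is 1 plus the difference of the
    two entropy terms, which the exponent count evaluates.\<close>
  moreover have "real (zz A) * ?h = (real (logical_dim n S A) - 1) * ?h + real (zz (N - A)) * ?h"
  proof -
    have "real (zz A) + 1 = real (logical_dim n S A) + real (zz (N - A))"
      using logical_dim_count[OF A] unfolding zz_def by (metis of_nat_1 of_nat_add)
    then have "real (zz A) = (real (logical_dim n S A) - 1) + real (zz (N - A))" by linarith
    then show ?thesis by (simp only: distrib_right)
  qed
  ultimately show ?thesis
    unfolding superdense_capacity_def by simp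
qed

end

theorem theorem4:
  fixes n d :: nat
    and S :: "complex mat set"
    and Z X :: "complex mat"
    and \<psi>\<^sub>0 \<psi>\<^sub>1 :: "complex vec"
    and \<alpha> \<beta> :: complex
    and A :: "nat set"
  assumes "stabilizer_code_1 n d S"
    and "logical_pair n S Z X"
    and "logical_basis n S Z \<psi>\<^sub>0 \<psi>\<^sub>1"
    and "(cmod \<alpha>)\<^sup>2 + (cmod \<beta>)\<^sup>2 = 1"
    and "A \<subseteq> {1..n}"
  shows "let \<Psi> = encoded_state n \<alpha> \<beta> \<psi>\<^sub>0 \<psi>\<^sub>1;
             C = superdense_capacity n \<Psi> A;
             l = logical_dim n S A;
             H = vn_entropy (reduced_state n \<Psi> {0})
         in C = 1 + (real l - 1) * H \<and>
            (l = 2 \<longrightarrow> C = 1 + H) \<and> (l = 1 \<longrightarrow> C = 1) \<and> (l = 0 \<longrightarrow> C = 1 - H)"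
proof -
  interpret qubit_code n d S Z X \<psi>\<^sub>0 \<psi>\<^sub>1
    using assms(1-3) by unfold_locales
  show ?thesis
    using superdense_capacity_logical_dim[OF assms(4,5)] by (simp add: Let_def)
qed

end
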